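(* There is no universal operator for $\complement\mathfrak{V}$ and there is no universal operator for $\complement\mathfrak{DP}$. Moreover, there is no Borel subset of $\complement\mathfrak{V}\cap\mathcal{L}$ which is universal for $\complement\mathfrak{V}\cap\mathcal{L}$, and there is no Borel subset of $\complement\mathfrak{DP}\cap\mathcal{L}$ which is universal for $\complement\mathfrak{DP}\cap\mathcal{L}$.
   Context: Operators are bounded linear maps between Banach spaces. $A:X\to Y$ is in $\mathfrak{V}$ (completely continuous) if $(Ax_n)$ is norm null for every weakly null sequence $(x_n)$ in $X$. $A:X\to Y$ is in $\mathfrak{DP}$ if $\lim_ny_n^*(Ax_n)=0$ for every weakly null $(x_n)$ in $X$ and every weakly null $(y_n^* )$ in $Y^*$. $\complement\mathfrak{J}$ is the class of operators not in $\mathfrak{J}$. $A:X\to Y$ factors through $B:Z\to W$ if $A=DBC$ for some operators $C:X\to Z$, $D:W\to Y$. A universal operator for $\complement\mathfrak{J}$ is $U\in\complement\mathfrak{J}$ which factors through every member of $\complement\mathfrak{J}$. A subset $\mathcal{B}\subset\complement\mathfrak{J}\cap\mathcal{L}$ is universal for $\complement\mathfrak{J}\cap\mathcal{L}$ if for each $A\in\complement\mathfrak{J}\cap\mathcal{L}$ there is $B\in\mathcal{B}$ such that $B$ factors through $A$. $C(2^{\mathbb{N}})$ is the space of continuous functions on the Cantor set. $\mathbf{SB}$ is the set of closed linear subspaces of $C(2^{\mathbb N})$ with the Effros-Borel structure; $(d_n)_{n=1}^\infty$ is a fixed sequence of Borel functions $\mathbf{SB}\to C(2^{\mathbb N})$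 with $\{d_n(X):n\in\mathbb N\}$ a dense subset of $X$ for each $X$. $\mathcal{L}$ is the set of triples $(X,Y,(y_n)_{n=1}^\infty)\in\mathbf{SB}\times\mathbf{SB}\times C(2^{\mathbb N})^{\mathbb N}$ with $y_n\in Y$ for all $n$ and for which there is $k\in\mathbb N$ with $\|\sum_{i=1}^nq_iy_i\|\leqslant k\|\sum_{i=1}^nq_id_i(X)\|$ for all $n$ and rationals $q_1,\dots,q_n$; it is a standard Borel space. The triple codes the unique bounded operator $A:X\to Y$ with $Ad_n(X)=y_n$. For a class of operators, its intersection with $\mathcal{L}$ is the set of triples coding operators in the class. *)

theory Defs
  imports "HOL-Analysis.Analysis"
begin

section \<open>Banach spaces and operators\<close>

text \<open>
  Banach spaces are structures on a subset of an arbitrary type, so that one can quantify over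
  all Banach spaces carried by that type and so that closed subspaces, duals and biduals are
  Banach spaces in the same sense. Scalars are real. Operators are functions of which only the
  values on the carrier of the domain matter.
\<close>

record 'a nspace =
  vcarrier :: "'a set"
  vadd :: "'a \<Rightarrow> 'a \<Rightarrow> 'a"
  vzero :: 'a
  vscale :: "real \<Rightarrow> 'a \<Rightarrow> 'a"
  vnorm :: "'a \<Rightarrow> real"

definition vdiff :: "'a nspace \<Rightarrow> 'a \<Rightarrow> 'a \<Rightarrow> 'a" where
  "vdiff X x y = vadd X x (vscale X (-1) y)"

locale normed_space =
  fixes X :: "'a nspace"
  assumes add_closed: "x \<in> vcarrier X \<Longrightarrow> y \<in> vcarrier X \<Longrightarrow> vadd X x y \<in> vcarrier X"
    and zero_closed: "vzero X \<in> vcarrier X"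
    and scale_closed: "x \<in> vcarrier X \<Longrightarrow> vscale X c x \<in> vcarrier X"
    and add_assoc: "x \<in> vcarrier X \<Longrightarrow> y \<in> vcarrier X \<Longrightarrow> z \<in> vcarrier X \<Longrightarrow>
          vadd X (vadd X x y) z = vadd X x (vadd X y z)"
    and add_commute: "x \<in> vcarrier X \<Longrightarrow> y \<in> vcarrier X \<Longrightarrow> vadd X x y = vadd X y x"
    and add_zero: "x \<in> vcarrier X \<Longrightarrow> vadd X x (vzero X) = x"
    and add_inverse: "x \<in> vcarrier X \<Longrightarrow> vadd X x (vscale X (-1) x) = vzero X"
    and scale_one: "x \<in> vcarrier X \<Longrightarrow> vscale X 1 x = x"
    and scale_scale: "x \<in> vcarrier X \<Longrightarrow> vscale X b (vscale X c x) = vscale X (b * c) x"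
    and scale_add_left: "x \<in> vcarrier X \<Longrightarrow>
          vscale X (b + c) x = vadd X (vscale X b x) (vscale X c x)"
    and scale_add_right: "x \<in> vcarrier X \<Longrightarrow> y \<in> vcarrier X \<Longrightarrow>
          vscale X c (vadd X x y) = vadd X (vscale X c x) (vscale X c y)"
    and norm_nonneg: "x \<in> vcarrier X \<Longrightarrow> 0 \<le> vnorm X x"
    and norm_eq_zero: "x \<in> vcarrier X \<Longrightarrow> vnorm X x = 0 \<longleftrightarrow> x = vzero X"
    and norm_scale: "x \<in> vcarrier X \<Longrightarrow> vnorm X (vscale X c x) = \<bar>c\<bar> * vnorm X x"
    and norm_triangle: "x \<in> vcarrier X \<Longrightarrow> y \<in> vcarrier X \<Longrightarrow>
          vnorm X (vadd X x y) \<le> vnorm X x + vnorm X y"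

locale banach_space = normed_space +
  assumes complete:
    "\<lbrakk>\<And>n. s n \<in> vcarrier X;
      \<And>e. 0 < e \<Longrightarrow> \<exists>N. \<forall>m\<ge>N. \<forall>n\<ge>N. vnorm X (vdiff X (s m) (s n)) < e\<rbrakk>
     \<Longrightarrow> \<exists>x\<in>vcarrier X. (\<lambda>n. vnorm X (vdiff X (s n) x)) \<longlonglongrightarrow> 0"

definition subspace_nspace :: "'a::real_normed_vector set \<Rightarrow> 'a nspace" where
  "subspace_nspace S =
     \<lparr>vcarrier = S, vadd = (+), vzero = 0, vscale = (*\<^sub>R), vnorm = norm\<rparr>"

definition bounded_operator :: "'a nspace \<Rightarrow> 'b nspace \<Rightarrow> ('a \<Rightarrow> 'b) \<Rightarrow> bool" where
  "bounded_operator X Y A \<longleftrightarrow>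
     A \<in> vcarrier X \<rightarrow> vcarrier Y \<and>
     (\<forall>x\<in>vcarrier X. \<forall>y\<in>vcarrier X. A (vadd X x y) = vadd Y (A x) (A y)) \<and>
     (\<forall>c. \<forall>x\<in>vcarrier X. A (vscale X c x) = vscale Y c (A x)) \<and>
     (\<exists>K. \<forall>x\<in>vcarrier X. vnorm Y (A x) \<le> K * vnorm X x)"

text \<open>Functionals are taken extensional (\<open>undefined\<close> off the carrier), so that
  each functional on the space is a single element of the dual.\<close>

definition dual_nspace :: "'a nspace \<Rightarrow> ('a \<Rightarrow> real) nspace" where
  "dual_nspace X =
     \<lparr>vcarrier = {f \<in> extensional (vcarrier X).
                   bounded_operator X (subspace_nspace (UNIV :: real set)) f},
      vadd = (\<lambda>f g. \<lambda>x\<in>vcarrier X. f x + g x),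
      vzero = (\<lambda>x\<in>vcarrier X. 0),
      vscale = (\<lambda>c f. \<lambda>x\<in>vcarrier X. c * f x),
      vnorm = (\<lambda>f. SUP x\<in>{x\<in>vcarrier X. vnorm X x \<le> 1}. \<bar>f x\<bar>)\<rparr>"

definition weakly_null :: "'a nspace \<Rightarrow> (nat \<Rightarrow> 'a) \<Rightarrow> bool" where
  "weakly_null X x \<longleftrightarrow>
     (\<forall>n. x n \<in> vcarrier X) \<and>
     (\<forall>f\<in>vcarrier (dual_nspace X). (\<lambda>n. f (x n)) \<longlonglongrightarrow> 0)"

definition completely_continuous :: "'a nspace \<Rightarrow> 'b nspace \<Rightarrow> ('a \<Rightarrow> 'b) \<Rightarrow> bool" where
  "completely_continuous X Y A \<longleftrightarrow>
     (\<forall>x. weakly_null X x \<longrightarrow> (\<lambda>n. vnorm Y (A (x n))) \<longlonglongrightarrow> 0)"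

definition dunford_pettis :: "'a nspace \<Rightarrow> 'b nspace \<Rightarrow> ('a \<Rightarrow> 'b) \<Rightarrow> bool" where
  "dunford_pettis X Y A \<longleftrightarrow>
     (\<forall>x f. weakly_null X x \<and> weakly_null (dual_nspace Y) f \<longrightarrow> (\<lambda>n. f n (A (x n))) \<longlonglongrightarrow> 0)"

section \<open>Factorization and universal operators\<close>

text \<open>A class of operators is given by a predicate \<open>J X Y A\<close>.\<close>

definition compl_class ::
  "('a nspace \<Rightarrow> 'b nspace \<Rightarrow> ('a \<Rightarrow> 'b) \<Rightarrow> bool) \<Rightarrow>
    'a nspace \<Rightarrow> 'b nspace \<Rightarrow> ('a \<Rightarrow> 'b) \<Rightarrow> bool" where
  "compl_class J X Y A \<longleftrightarrow>
     banach_space X \<and> banach_space Y \<and> bounded_operator X Y A \<and> \<not> J X Y A"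

definition factors_through ::
  "'a nspace \<Rightarrow> 'b nspace \<Rightarrow> ('a \<Rightarrow> 'b) \<Rightarrow> 'c nspace \<Rightarrow> 'd nspace \<Rightarrow> ('c \<Rightarrow> 'd) \<Rightarrow> bool" where
  "factors_through X Y A Z W B \<longleftrightarrow>
     (\<exists>C D. bounded_operator X Z C \<and> bounded_operator W Y D \<and>
            (\<forall>x\<in>vcarrier X. A x = D (B (C x))))"

text \<open>The type \<open>'a\<close> is the universe of discourse: all Banach spaces, both those of the
  candidate \<open>U\<close> and those of the members of the class, have their carrier in \<open>'a\<close>.\<close>

definition universal_operator ::
  "('a nspace \<Rightarrow> 'a nspace \<Rightarrow> ('a \<Rightarrow> 'a) \<Rightarrow> bool) \<Rightarrow>
    'a nspace \<Rightarrow> 'a nspace \<Rightarrow> ('a \<Rightarrow> 'a) \<Rightarrow> bool" where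
  "universal_operator J X Y U \<longleftrightarrow>
     compl_class J X Y U \<and> (\<forall>Z W A. compl_class J Z W A \<longrightarrow> factors_through X Y U Z W A)"

section \<open>The coding of operators between separable Banach spaces\<close>

text \<open>\<open>nat \<Rightarrow> bool\<close> carries the product of the discrete topologies, so it is the Cantor set; by
  compactness every continuous function on it is bounded. The norm is the supremum norm.\<close>

type_synonym cantor_fun = "(nat \<Rightarrow> bool) \<Rightarrow>\<^sub>C real"

definition SB :: "cantor_fun set set" where
  "SB = {X. subspace X \<and> closed X}"

definition effros_borel :: "cantor_fun set measure" where
  "effros_borel = sigma SB {{X \<in> SB. X \<inter> U \<noteq> {}} | U. open U}"

definition dense_selectors :: "(nat \<Rightarrow> cantor_fun set \<Rightarrow> cantor_fun) \<Rightarrow> bool" where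
  "dense_selectors d \<longleftrightarrow>
     (\<forall>n. d n \<in> effros_borel \<rightarrow>\<^sub>M borel) \<and>
     (\<forall>X\<in>SB. range (\<lambda>n. d n X) \<subseteq> X \<and> X \<subseteq> closure (range (\<lambda>n. d n X)))"

type_synonym op_code = "cantor_fun set \<times> cantor_fun set \<times> (nat \<Rightarrow> cantor_fun)"

definition op_codes :: "(nat \<Rightarrow> cantor_fun set \<Rightarrow> cantor_fun) \<Rightarrow> op_code set" where
  "op_codes d =
     {(X, Y, y). X \<in> SB \<and> Y \<in> SB \<and> (\<forall>n. y n \<in> Y) \<and>
        (\<exists>k::nat. \<forall>n. \<forall>q::nat \<Rightarrow> rat.
           norm (\<Sum>i<n. of_rat (q i) *\<^sub>R y i) \<le> real k * norm (\<Sum>i<n. of_rat (q i) *\<^sub>R d i X))}"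

definition op_code_space :: "(nat \<Rightarrow> cantor_fun set \<Rightarrow> cantor_fun) \<Rightarrow> op_code measure" where
  "op_code_space d =
     restrict_space (effros_borel \<Otimes>\<^sub>M effros_borel \<Otimes>\<^sub>M (\<Pi>\<^sub>M n\<in>UNIV. borel)) (op_codes d)"

text \<open>Spaces and operator coded by a triple. For a triple in \<open>op_codes d\<close> there is exactly one
  operator sending \<open>d n X\<close> to \<open>y n\<close> for all \<open>n\<close>; extensionality removes the ambiguity off \<open>X\<close>.\<close>

definition code_dom :: "op_code \<Rightarrow> cantor_fun nspace" where
  "code_dom t = subspace_nspace (fst t)"

definition code_cod :: "op_code \<Rightarrow> cantor_fun nspace" where
  "code_cod t = subspace_nspace (fst (snd t))"

definition code_op ::
  "(nat \<Rightarrow> cantor_fun set \<Rightarrow> cantor_fun) \<Rightarrow> op_code \<Rightarrow> cantor_fun \<Rightarrow> cantor_fun" where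
  "code_op d t = (THE A. A \<in> extensional (fst t) \<and> bounded_operator (code_dom t) (code_cod t) A \<and>
                         (\<forall>n. A (d n (fst t)) = snd (snd t) n))"

definition coded_compl_class ::
  "(nat \<Rightarrow> cantor_fun set \<Rightarrow> cantor_fun) \<Rightarrow>
   (cantor_fun nspace \<Rightarrow> cantor_fun nspace \<Rightarrow> (cantor_fun \<Rightarrow> cantor_fun) \<Rightarrow> bool) \<Rightarrow> op_code set"
  where
  "coded_compl_class d J =
     {t \<in> op_codes d. compl_class J (code_dom t) (code_cod t) (code_op d t)}"

definition universal_code_set ::
  "(nat \<Rightarrow> cantor_fun set \<Rightarrow> cantor_fun) \<Rightarrow>
   (cantor_fun nspace \<Rightarrow> cantor_fun nspace \<Rightarrow> (cantor_fun \<Rightarrow> cantor_fun) \<Rightarrow> bool) \<Rightarrow>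
   op_code set \<Rightarrow> bool" where
  "universal_code_set d J \<B> \<longleftrightarrow>
     \<B> \<subseteq> coded_compl_class d J \<and>
     (\<forall>a\<in>coded_compl_class d J. \<exists>b\<in>\<B>.
        factors_through (code_dom b) (code_cod b) (code_op d b)
                        (code_dom a) (code_cod a) (code_op d a))"

end

theory Submission
  imports Defs
begin

text \<open>
  For a tree \<open>T\<close> on the natural numbers consider the family of finite sets \<open>n\<^sub>1 < \<dots> < n\<^sub>k\<close> for which \<open>T\<close> has
  a node \<open>(t\<^sub>1, \<dots>, t\<^sub>k)\<close> with \<open>t\<^sub>i \<le> n\<^sub>i\<close>. Let \<open>Z\<close> be the completion of the finitely supported
  sequences under the supremum of the sums of \<open>\<bar>z\<^sub>i\<bar>\<close> over sets of this family and of \<open>2^-k\<close> times the sums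
  over sets of at most \<open>16^k\<close> elements, and \<open>W\<close> the one for \<open>4^-k\<close> in place of \<open>2^-k\<close> without the
  family of \<open>T\<close>. If \<open>T\<close> has no infinite branch, the unit vectors are weakly null in \<open>Z\<close> by Ptak's lemma and the
  coordinate functionals are weakly null in the dual of \<open>W\<close>, so that the inclusion of \<open>Z\<close> into \<open>W\<close> is not
  Dunford-Pettis. If \<open>T\<close> has an infinite branch, the inclusion is completely continuous by a gliding hump
  argument, so that nothing outside the class of completely continuous operators (and hence nothing that is not
  Dunford-Pettis) factors through it.

  If one operator, or the members of a Borel set of coded operators, factored through all inclusions that
  belong to trees without infinite branches, these trees would therefore form a Souslin set.
  This is impossible: the tree of all attempts to verify that it belongs to the given Souslin set can be
  defined by recursion, and it has an infinite branch if and only if it belongs to the set.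
\<close>

text \<open>Complete continuity implies the Dunford-Pettis property, so one family of operators
  serves both classes: the inclusions of trees without branches must fail the weaker property, those
  of trees with a branch must have the stronger one. The constants balance three demands: 2^-k tends
  to 0, so that sets of large index k do not disturb the weak nullity of the unit vectors in Z; 16^k
  times 4^-k tends to infinity, so that averages of coordinate functionals become small in the dual
  of W; and 4^-k / 2^-k is summable, so that a gliding hump with unbounded k converges. A
  factorization quantifies over operators, and its source may be nonseparable. It is therefore
  tested on one sequence of vectors only: for a single operator a weakly null sequence whose images
  are not norm null, for a coded one the selected dense sequence. What is left is a countable system
  of inequalities between real numbers. For a single operator the universe must also have room for
  the tree spaces; a nonzero vector in it already yields a copy of the real line, and C(2^N) has no
  more elements than that.\<close>

section \<open>A gliding hump\<close>

text \<open>The rows form a weakly null sequence in l1, since the multipliers \<open>s\<close>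
  exhaust the unit ball of the dual of l1. This is the gliding hump behind Schur's theorem, aimed at
  the diagonal because the applications place there the quantity that has to tend to 0.\<close>

lemma diagonal_null:
  fixes a :: "nat \<Rightarrow> nat \<Rightarrow> real"
  assumes summ: "\<And>n. summable (\<lambda>j. \<bar>a n j\<bar>)"
    and null: "\<And>s :: nat \<Rightarrow> real. (\<And>j. \<bar>s j\<bar> \<le> 1) \<Longrightarrow> (\<lambda>n. \<Sum>j. s j * a n j) \<longlonglongrightarrow> 0"
  shows "(\<lambda>n. a n n) \<longlonglongrightarrow> 0"
proof (rule ccontr)
  assume "\<not> (\<lambda>n. a n n) \<longlonglongrightarrow> 0"
  then obtain \<delta> where \<delta>: "\<delta> > 0" and ex: "\<And>N. \<exists>n\<ge>N. \<bar>a n n\<bar> \<ge> \<delta>"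
    unfolding LIMSEQ_iff by (auto simp: not_less)
  have col: "(\<lambda>n. a n j) \<longlonglongrightarrow> 0" for j
  proof -
    have "(\<lambda>n. \<Sum>i. (if i = j then 1 else 0) * a n i) \<longlonglongrightarrow> 0"
      by (rule null) auto
    moreover have "(\<Sum>i. (if i = j then 1 else 0) * a n i) = a n j" for n
      by (subst suminf_finite[of "{j}"]) auto
    ultimately show ?thesis by simp
  qed
  \<comment> \<open>The column limits make a late row small up to \<open>m\<close>, and summability
    makes the tail of row \<open>m\<close> small from a late index on.\<close>
  have step: "\<exists>n>m. \<bar>a n n\<bar> \<ge> \<delta> \<and> (\<Sum>j\<le>m. \<bar>a n j\<bar>) < \<delta> / 4 \<and> (\<Sum>j. \<bar>a m (j + n)\<bar>) < \<delta> / 4" for m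
  proof -
    have "(\<lambda>n. \<Sum>j\<le>m. \<bar>a n j\<bar>) \<longlonglongrightarrow> (\<Sum>j\<le>m. \<bar>0\<bar>)"
      by (intro tendsto_sum tendsto_rabs col)
    then have "\<forall>\<^sub>F n in sequentially. (\<Sum>j\<le>m. \<bar>a n j\<bar>) < \<delta> / 4"
      by (rule order_tendstoD(2)) (use \<delta> in simp)
    then obtain N1 where N1: "\<And>n. n \<ge> N1 \<Longrightarrow> (\<Sum>j\<le>m. \<bar>a n j\<bar>) < \<delta> / 4"
      unfolding eventually_sequentially by blast
    obtain N2 where N2: "\<And>n. n \<ge> N2 \<Longrightarrow> norm (\<Sum>j. \<bar>a m (j + n)\<bar>) < \<delta> / 4"
      using suminf_exist_split[OF _ summ[of m], of "\<delta> / 4"] \<delta> by auto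
    obtain n where "n \<ge> max (Suc m) (max N1 N2)" "\<bar>a n n\<bar> \<ge> \<delta>"
      using ex by blast
    then show ?thesis
      using N1[of n] N2[of n] by (intro exI[of _ n]) auto
  qed
  define Q where "Q m n \<longleftrightarrow> n > m \<and> (\<Sum>j\<le>m. \<bar>a n j\<bar>) < \<delta> / 4 \<and> (\<Sum>j. \<bar>a m (j + n)\<bar>) < \<delta> / 4" for m n
  have "\<exists>r. \<forall>k. \<bar>a (r k) (r k)\<bar> \<ge> \<delta> \<and> Q (r k) (r (Suc k))"
  proof (rule dependent_nat_choice)
    show "\<exists>n. \<bar>a n n\<bar> \<ge> \<delta>" using ex by blast
    show "\<exists>n. \<bar>a n n\<bar> \<ge> \<delta> \<and> Q m n" for m
      using step[of m] unfolding Q_def by blast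
  qed
  then obtain r where r: "\<And>k. \<bar>a (r k) (r k)\<bar> \<ge> \<delta>" "\<And>k. Q (r k) (r (Suc k))"
    by blast
  have mono: "strict_mono r"
    using r(2) by (auto simp: strict_mono_Suc_iff Q_def)
  define s where "s j = (if j \<in> range r then sgn (a j j) else 0)" for j
  have s1: "\<bar>s j\<bar> \<le> 1" for j
    by (auto simp: s_def sgn_real_def)
  have big: "\<bar>\<Sum>j. s j * a (r (Suc k)) j\<bar> \<ge> \<delta> / 2" for k
  proof -
    let ?n = "r (Suc k)" and ?R = "r (Suc (Suc k))"
    have lt: "r k < ?n" "?n < ?R"
      using mono by (auto simp: strict_mono_Suc_iff)
    \<comment> \<open>The weighted row without its diagonal term. No chosen index other than
      \<open>?n\<close> lies strictly between \<open>r k\<close> and \<open>?R\<close>, so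
      \<open>g\<close> lives on the two ends, each of total size less than
      \<open>\<delta> / 4\<close>.\<close>
    define g where "g j = s j * a ?n j - (if j = ?n then \<bar>a ?n ?n\<bar> else 0)" for j
    have gle: "\<bar>g j\<bar> \<le> \<bar>a ?n j\<bar>" for j
    proof (cases "j = ?n")
      case True
      have "s ?n = sgn (a ?n ?n)" by (auto simp: s_def)
      then show ?thesis
        using True by (auto simp: g_def sgn_real_def)
    next
      case False
      then show ?thesis
        using s1[of j] by (auto simp: g_def abs_mult mult_left_le_one_le)
    qed
    have g0: "g j = 0" if "r k < j" "j < ?R" for j
    proof (cases "j = ?n")
      case True
      have "s ?n = sgn (a ?n ?n)" by (auto simp: s_def)
      then show ?thesis using True by (auto simp: g_def sgn_real_def)
    next
      case False
      have "j \<notin> range r"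
      proof
        assume "j \<in> range r"
        then obtain l where l: "j = r l" by auto
        with that have "k < l" "l < Suc (Suc k)"
          using mono by (auto simp: strict_mono_less)
        then have "l = Suc k" by simp
        then show False using l False by simp
      qed
      then show ?thesis using False by (simp add: g_def s_def)
    qed
    have sg: "summable (\<lambda>j. \<bar>g j\<bar>)"
      by (rule summable_comparison_test[OF _ summ[of ?n]]) (auto simp: gle)
    have "\<bar>\<Sum>j. g j\<bar> \<le> (\<Sum>j. \<bar>g j\<bar>)"
      by (rule summable_rabs[OF sg])
    also have "\<dots> = (\<Sum>j. \<bar>g (j + ?R)\<bar>) + (\<Sum>j<?R. \<bar>g j\<bar>)"
      by (rule suminf_split_initial_segment[OF sg])
    also have "(\<Sum>j<?R. \<bar>g j\<bar>) = (\<Sum>j\<le>r k. \<bar>g j\<bar>)"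
      using lt g0 by (intro sum.mono_neutral_right) auto
    also have "(\<Sum>j\<le>r k. \<bar>g j\<bar>) \<le> (\<Sum>j\<le>r k. \<bar>a ?n j\<bar>)"
      by (intro sum_mono gle)
    also have "(\<Sum>j. \<bar>g (j + ?R)\<bar>) \<le> (\<Sum>j. \<bar>a ?n (j + ?R)\<bar>)"
      using sg summ[of ?n] by (intro suminf_le gle) (simp_all add: summable_iff_shift[of "\<lambda>j. \<bar>g j\<bar>"] summable_iff_shift[of "\<lambda>j. \<bar>a ?n j\<bar>"])
    finally have gs: "\<bar>\<Sum>j. g j\<bar> \<le> \<delta> / 2"
      using r(2)[of k] r(2)[of "Suc k"] unfolding Q_def by simp
    have "(\<Sum>j. s j * a ?n j) = (\<Sum>j. g j + (if j = ?n then \<bar>a ?n ?n\<bar> else 0))"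
      by (simp add: g_def)
    also have "\<dots> = (\<Sum>j. g j) + (\<Sum>j. if j = ?n then \<bar>a ?n ?n\<bar> else 0)"
      using sg by (intro suminf_add[symmetric]) (auto intro: summable_rabs_cancel)
    also have "(\<Sum>j. if j = ?n then \<bar>a ?n ?n\<bar> else 0) = \<bar>a ?n ?n\<bar>"
      by (subst suminf_finite[of "{?n}"]) auto
    finally show ?thesis
      using gs r(1)[of "Suc k"] by linarith
  qed
  have "(\<lambda>n. \<Sum>j. s j * a n j) \<longlonglongrightarrow> 0"
    by (rule null[OF s1])
  from LIMSEQ_Suc[OF LIMSEQ_subseq_LIMSEQ[OF this mono]]
  have "(\<lambda>k. \<bar>\<Sum>j. s j * a (r (Suc k)) j\<bar>) \<longlonglongrightarrow> 0"
    by (intro tendsto_rabs_zero) (simp add: o_def)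
  then have "\<forall>\<^sub>F k in sequentially. \<bar>\<Sum>j. s j * a (r (Suc k)) j\<bar> < \<delta> / 2"
    by (rule order_tendstoD(2)) (use \<delta> in simp)
  then show False
    using big unfolding eventually_sequentially by (meson le_refl not_less)
qed

section \<open>Souslin sets and trees\<close>

text \<open>The analytic sets: projections along \<open>q\<close> of a closed subset of the product
  of two Baire spaces, where the closed set is given by the relation \<open>r\<close> on pairs of
  initial segments.\<close>

definition souslin :: "(nat \<Rightarrow> nat) set \<Rightarrow> bool" where
  "souslin M \<longleftrightarrow> (\<exists>r. M = {u. \<exists>q::nat \<Rightarrow> nat. \<forall>n. r (map u [0..<n]) (map q [0..<n])})"

lemma souslin_coordinate: "souslin {u. u i \<in> A}"
  unfolding souslin_def
proof (intro exI[of _ "\<lambda>us qs. i < length us \<longrightarrow> us ! i \<in> A"] set_eqI iffI)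
  fix u :: "nat \<Rightarrow> nat"
  assume "u \<in> {u. \<exists>q::nat \<Rightarrow> nat. \<forall>n. i < length (map u [0..<n]) \<longrightarrow> map u [0..<n] ! i \<in> A}"
  then have "i < length (map u [0..<Suc i]) \<longrightarrow> map u [0..<Suc i] ! i \<in> A" by blast
  then show "u \<in> {u. u i \<in> A}" by (simp del: upt_Suc)
qed auto

text \<open>The first entry of the witness chooses the index and the rest is a witness for the
  chosen set; \<open>u\<close> is cut by one entry to keep the two segments equally long.\<close>

lemma souslin_UN:
  assumes "\<And>i::nat. souslin (M i)"
  shows "souslin (\<Union>i. M i)"
proof -
  have "\<forall>i. \<exists>r. M i = {u. \<exists>q::nat \<Rightarrow> nat. \<forall>n. r (map u [0..<n]) (map q [0..<n])}"
    using assms unfolding souslin_def by blast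
  from choice[OF this] obtain r
    where r: "\<And>i. M i = {u. \<exists>q::nat \<Rightarrow> nat. \<forall>n. r i (map u [0..<n]) (map q [0..<n])}"
    by blast
  have key: "map q [0..<Suc m] = q 0 # map (q \<circ> Suc) [0..<m]" for q :: "nat \<Rightarrow> nat" and m
    by (simp add: map_upt_Suc o_def del: upt_Suc)
  have tk: "take m (map u [0..<Suc m]) = map u [0..<m]" for u :: "nat \<Rightarrow> nat" and m
    by simp
  define R where "R us qs = (case qs of [] \<Rightarrow> True | i # qs' \<Rightarrow> r i (take (length qs') us) qs')" for us qs
  have RS: "R (map u [0..<Suc m]) (map q [0..<Suc m]) = r (q 0) (map u [0..<m]) (map (q \<circ> Suc) [0..<m])" for u q m
    unfolding R_def key[of q] by (simp add: tk del: upt_Suc)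
  have "(\<Union>i. M i) = {u. \<exists>q::nat \<Rightarrow> nat. \<forall>n. R (map u [0..<n]) (map q [0..<n])}"
  proof (intro set_eqI iffI)
    fix u assume "u \<in> (\<Union>i. M i)"
    then obtain i q where q: "\<And>n. r i (map u [0..<n]) (map q [0..<n])"
      unfolding r by blast
    have "R (map u [0..<n]) (map (case_nat i q) [0..<n])" for n
    proof (cases n)
      case 0 then show ?thesis by (simp add: R_def)
    next
      case (Suc m)
      then show ?thesis using q[of m] by (simp only: RS) (simp add: o_def)
    qed
    then show "u \<in> {u. \<exists>q::nat \<Rightarrow> nat. \<forall>n. R (map u [0..<n]) (map q [0..<n])}" by blast
  next
    fix u assume "u \<in> {u. \<exists>q::nat \<Rightarrow> nat. \<forall>n. R (map u [0..<n]) (map q [0..<n])}"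
    then obtain q where "\<And>n. R (map u [0..<n]) (map q [0..<n])" by blast
    then have "r (q 0) (map u [0..<m]) (map (q \<circ> Suc) [0..<m])" for m
      using RS by blast
    then show "u \<in> (\<Union>i. M i)" unfolding r by blast
  qed
  then show ?thesis unfolding souslin_def by blast
qed

text \<open>Witnesses for all sets are merged into one sequence through \<open>prod_encode\<close>;
  \<open>R\<close> checks every condition whose entries lie inside the given segments.\<close>

lemma souslin_INT:
  assumes "\<And>i::nat. souslin (M i)"
  shows "souslin (\<Inter>i. M i)"
proof -
  have "\<forall>i. \<exists>r. M i = {u. \<exists>q::nat \<Rightarrow> nat. \<forall>n. r (map u [0..<n]) (map q [0..<n])}"
    using assms unfolding souslin_def by blast
  from choice[OF this] obtain r
    where r: "\<And>i. M i = {u. \<exists>q::nat \<Rightarrow> nat. \<forall>n. r i (map u [0..<n]) (map q [0..<n])}"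
    by blast
  define R where "R us qs \<longleftrightarrow> (\<forall>i m. m \<le> length us \<and> (\<forall>j<m. prod_encode (i, j) < length qs) \<longrightarrow>
     r i (take m us) (map (\<lambda>j. qs ! prod_encode (i, j)) [0..<m]))" for us and qs :: "nat list"
  have "(\<Inter>i. M i) = {u. \<exists>q::nat \<Rightarrow> nat. \<forall>n. R (map u [0..<n]) (map q [0..<n])}"
  proof (intro set_eqI iffI)
    fix u assume "u \<in> (\<Inter>i. M i)"
    then have "\<forall>i. \<exists>q::nat \<Rightarrow> nat. \<forall>n. r i (map u [0..<n]) (map q [0..<n])"
      unfolding r by blast
    from choice[OF this] obtain q where q: "\<And>i n. r i (map u [0..<n]) (map (q i) [0..<n])"
      by blast
    define Q where "Q k = (case prod_decode k of (i, j) \<Rightarrow> q i j)" for k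
    have "R (map u [0..<n]) (map Q [0..<n])" for n
      unfolding R_def
    proof (intro allI impI)
      fix i m assume m: "m \<le> length (map u [0..<n]) \<and> (\<forall>j<m. prod_encode (i, j) < length (map Q [0..<n]))"
      then have "map (\<lambda>j. map Q [0..<n] ! prod_encode (i, j)) [0..<m] = map (q i) [0..<m]"
        by (auto simp: Q_def)
      moreover have "take m (map u [0..<n]) = map u [0..<m]"
        using m by (simp add: take_map)
      ultimately show "r i (take m (map u [0..<n])) (map (\<lambda>j. map Q [0..<n] ! prod_encode (i, j)) [0..<m])"
        using q by (simp only:)
    qed
    then show "u \<in> {u. \<exists>q::nat \<Rightarrow> nat. \<forall>n. R (map u [0..<n]) (map q [0..<n])}" by blast
  next
    fix u assume "u \<in> {u. \<exists>q::nat \<Rightarrow> nat. \<forall>n. R (map u [0..<n]) (map q [0..<n])}"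
    then obtain Q where Q: "\<And>n. R (map u [0..<n]) (map Q [0..<n])" by blast
    have "r i (map u [0..<m]) (map (\<lambda>j. Q (prod_encode (i, j))) [0..<m])" for i m
    proof -
      \<comment> \<open>Long enough to contain the first \<open>m\<close> entries of
        \<open>u\<close> and of the \<open>i\<close>-th witness.\<close>
      define n where "n = m + (\<Sum>j<m. Suc (prod_encode (i, j)))"
      have n: "prod_encode (i, j) < n" if "j < m" for j
      proof -
        have "Suc (prod_encode (i, j)) \<le> (\<Sum>j<m. Suc (prod_encode (i, j)))"
          using that by (intro member_le_sum) auto
        then show ?thesis by (simp add: n_def)
      qed
      have "m \<le> n" by (simp add: n_def)
      with n have "r i (take m (map u [0..<n])) (map (\<lambda>j. map Q [0..<n] ! prod_encode (i, j)) [0..<m])"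
        using Q[of n] unfolding R_def by auto
      moreover have "map (\<lambda>j. map Q [0..<n] ! prod_encode (i, j)) [0..<m] = map (\<lambda>j. Q (prod_encode (i, j))) [0..<m]"
        using n by auto
      ultimately show ?thesis using \<open>m \<le> n\<close> by (simp add: take_map)
    qed
    then show "u \<in> (\<Inter>i. M i)" unfolding r by blast
  qed
  then show ?thesis unfolding souslin_def by blast
qed

abbreviation baire :: "(nat \<Rightarrow> nat) measure" where
  "baire \<equiv> Pi\<^sub>M UNIV (\<lambda>_. count_space UNIV)"

text \<open>Souslin sets are not closed under complements, so the induction carries \<open>M\<close>
  and \<open>- M\<close> together; countable unions and intersections then exchange their
  roles.\<close>

lemma sets_baire_souslin:
  assumes "M \<in> sets baire"
  shows "souslin M"
proof -
  have "souslin M \<and> souslin (- M)"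
    using assms unfolding sets_PiM_single
  proof (induction rule: sigma_sets.induct)
    case (Basic a)
    then obtain i A where "a = {u. u i \<in> A}" by auto
    moreover from this have "- a = {u. u i \<in> - A}" by auto
    ultimately show ?case by (simp only: souslin_coordinate)
  next
    case Empty
    have "{} = {u. (u::nat \<Rightarrow> nat) 0 \<in> {}}" "- {} = {u. (u::nat \<Rightarrow> nat) 0 \<in> UNIV}" by auto
    then show ?case by (metis souslin_coordinate)
  next
    case (Compl a)
    then show ?case by (simp add: Compl_eq_Diff_UNIV[symmetric])
  next
    case (Union a)
    then show ?case by (auto simp: Compl_UN intro: souslin_UN souslin_INT)
  qed
  then show ?thesis ..
qed

section \<open>Trees coded by points of the Baire space\<close>

definition has_branch :: "nat list set \<Rightarrow> bool" where
  "has_branch T \<longleftrightarrow> (\<exists>\<beta>. \<forall>n. map \<beta> [0..<n] \<in> T)"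

text \<open>The odd entries have room for the data of a factorization belonging to \<open>T\<close>.
  Projecting them away is what turns a Borel set of codes into a Souslin set of trees.\<close>

definition mix :: "nat list set \<Rightarrow> (nat \<Rightarrow> nat) \<Rightarrow> nat \<Rightarrow> nat" where
  "mix T p i = (if even i then of_bool (list_decode (i div 2) \<in> T) else p (i div 2))"

definition tree_part :: "(nat \<Rightarrow> nat) \<Rightarrow> nat list set" where
  "tree_part u = {l. u (2 * list_encode l) \<noteq> 0}"

lemma tree_part_mix [simp]: "tree_part (mix T p) = T"
  by (auto simp: tree_part_def mix_def)

text \<open>This makes the recursive definition of the self-referential tree legitimate: the first
  \<open>m\<close> entries of a code of a tree only ask about lists of length less than
  \<open>m\<close>.\<close>

lemma length_le_list_encode: "length l \<le> list_encode l"
proof (induction l)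
  case (Cons x l)
  then show ?case
    using le_prod_encode_2[of "list_encode l" x] by simp
qed simp

text \<open>The tree \<open>T\<close> below consists of the finite attempts to verify that \<open>T\<close> itself has
  a code in \<open>M\<close>; it has a branch if and only if it has such a code.\<close>

lemma no_measurable_wellfounded_codes:
  assumes meas: "M \<in> sets baire"
    and M: "\<And>u. u \<in> M \<Longrightarrow> \<not> has_branch (tree_part u)"
    and wf: "\<And>T. \<not> has_branch T \<Longrightarrow> \<exists>p. mix T p \<in> M"
  shows False
proof -
  obtain r where r: "M = {u. \<exists>q::nat \<Rightarrow> nat. \<forall>n. r (map u [0..<n]) (map q [0..<n])}"
    using sets_baire_souslin[OF meas] unfolding souslin_def by blast
  \<comment> \<open>A node interleaves candidate data \<open>p\<close> (even places) with a Souslin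
    witness \<open>q\<close> (odd places); \<open>G\<close> tests the part of the verification that
    these entries determine.\<close>
  define G where "G T s \<longleftrightarrow> (\<forall>m. 2 * m \<le> length s \<longrightarrow>
     r (map (mix T (\<lambda>i. s ! (2 * i))) [0..<m]) (map (\<lambda>i. s ! (2 * i + 1)) [0..<m]))" for T s
  have G_cong: "G T s = G T' s" if "\<And>l. length l < length s \<Longrightarrow> l \<in> T \<longleftrightarrow> l \<in> T'" for T T' s
  proof -
    have "map (mix T (\<lambda>i. s ! (2 * i))) [0..<m] = map (mix T' (\<lambda>i. s ! (2 * i))) [0..<m]"
      if m: "2 * m \<le> length s" for m
    proof (rule map_cong)
      fix i assume "i \<in> set [0..<m]"
      moreover have "length (list_decode (i div 2)) \<le> i div 2"
        using length_le_list_encode[of "list_decode (i div 2)"] by simp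
      ultimately have "length (list_decode (i div 2)) < length s"
        using m by auto
      then show "mix T (\<lambda>i. s ! (2 * i)) i = mix T' (\<lambda>i. s ! (2 * i)) i"
        using \<open>\<And>l. length l < length s \<Longrightarrow> l \<in> T \<longleftrightarrow> l \<in> T'\<close> by (simp add: mix_def)
    qed simp
    then show ?thesis unfolding G_def by (intro all_cong1 imp_cong refl) (simp only:)
  qed
  \<comment> \<open>\<open>G T s\<close> looks at \<open>T\<close> only on lists shorter than
    \<open>s\<close>. So the iteration, started at \<open>{}\<close>, has settled the membership of
    \<open>s\<close> after \<open>Suc (length s)\<close> rounds.\<close>
  define A where "A n = ((\<lambda>T. {s. G T s}) ^^ n) {}" for n
  define T where "T = {s. s \<in> A (Suc (length s))}"
  have A_Suc: "A (Suc n) = {s. G (A n) s}" for n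
    by (simp add: A_def)
  have stable: "s \<in> A n \<longleftrightarrow> s \<in> T" if "length s < n" for s n
    using that
  proof (induction "length s" arbitrary: s n rule: less_induct)
    case less
    obtain m where n: "n = Suc m" using less.prems by (cases n) auto
    have "G (A m) s = G (A (length s)) s"
    proof (rule G_cong)
      fix l :: "nat list" assume l: "length l < length s"
      then show "l \<in> A m \<longleftrightarrow> l \<in> A (length s)"
        using less.hyps[OF l, of m] less.hyps[OF l, of "length s"] less.prems n by simp
    qed
    then show ?case by (simp add: n T_def A_Suc)
  qed
  have T: "s \<in> T \<longleftrightarrow> G T s" for s
  proof -
    have "s \<in> T \<longleftrightarrow> G (A (length s)) s" by (simp add: T_def A_Suc)
    also have "\<dots> \<longleftrightarrow> G T s" by (rule G_cong) (simp add: stable)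
    finally show ?thesis .
  qed
  have mem: "G T (map \<beta> [0..<n]) \<longleftrightarrow> (\<forall>m. 2 * m \<le> n \<longrightarrow>
      r (map (mix T (\<lambda>i. \<beta> (2 * i))) [0..<m]) (map (\<lambda>i. \<beta> (2 * i + 1)) [0..<m]))" for \<beta> n
  proof -
    have "map (mix T (\<lambda>i. map \<beta> [0..<n] ! (2 * i))) [0..<m] = map (mix T (\<lambda>i. \<beta> (2 * i))) [0..<m]"
      "map (\<lambda>i. map \<beta> [0..<n] ! (2 * i + 1)) [0..<m] = map (\<lambda>i. \<beta> (2 * i + 1)) [0..<m]"
      if "2 * m \<le> n" for m
      using that by (auto simp: mix_def)
    then show ?thesis unfolding G_def by (intro all_cong1 imp_cong) (simp, simp only:)
  qed
  \<comment> \<open>A branch of \<open>T\<close> would be a complete verification of a code of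
    \<open>T\<close> in \<open>M\<close>, but \<open>M\<close> only contains codes of trees without
    branches.\<close>
  have nb: "\<not> has_branch T"
  proof
    assume "has_branch T"
    then obtain \<beta> where "\<And>n. G T (map \<beta> [0..<n])"
      unfolding has_branch_def T by blast
    then have "r (map (mix T (\<lambda>i. \<beta> (2 * i))) [0..<m]) (map (\<lambda>i. \<beta> (2 * i + 1)) [0..<m])" for m
      using mem[of \<beta> "2 * m"] by blast
    then have "mix T (\<lambda>i. \<beta> (2 * i)) \<in> M"
      unfolding r by blast
    then show False
      using M[of "mix T (\<lambda>i. \<beta> (2 * i))"] \<open>has_branch T\<close> by simp
  qed
  then obtain p where "mix T p \<in> M" using wf by blast
  then obtain q :: "nat \<Rightarrow> nat" where q: "\<And>n. r (map (mix T p) [0..<n]) (map q [0..<n])"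
    unfolding r by blast
  \<comment> \<open>Conversely, a code of \<open>T\<close> in \<open>M\<close> interleaved with its
    Souslin witness is a branch of \<open>T\<close>.\<close>
  define \<beta> where "\<beta> i = (if even i then p (i div 2) else q (i div 2))" for i
  have "(\<lambda>i. \<beta> (2 * i)) = p" "(\<lambda>i. \<beta> (2 * i + 1)) = q"
    by (auto simp: \<beta>_def)
  then have "map \<beta> [0..<n] \<in> T" for n
    unfolding T mem by (simp add: q)
  then show False using nb unfolding has_branch_def by blast
qed

section \<open>Finite combinations in normed spaces\<close>

text \<open>Lists with possibly repeated indices take the place of finitely supported families:
  appending lists adds the combinations, and the lists with rational coefficients form a countable
  type.\<close>

definition vcomb :: "'a nspace \<Rightarrow> (nat \<Rightarrow> 'a) \<Rightarrow> (real \<times> nat) list \<Rightarrow> 'a" where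
  "vcomb X x l = foldr (\<lambda>(q, i) v. vadd X (vscale X q (x i)) v) l (vzero X)"

definition rcomb :: "(nat \<Rightarrow> real) \<Rightarrow> (real \<times> nat) list \<Rightarrow> real" where
  "rcomb a l = (\<Sum>(q, i)\<leftarrow>l. q * a i)"

abbreviation rat_comb :: "(rat \<times> nat) list \<Rightarrow> (real \<times> nat) list" where
  "rat_comb l \<equiv> map (apfst of_rat) l"

lemma vcomb_simps [simp]:
  "vcomb X x [] = vzero X"
  "vcomb X x ((q, i) # l) = vadd X (vscale X q (x i)) (vcomb X x l)"
  by (simp_all add: vcomb_def)

lemma rcomb_simps [simp]:
  "rcomb a [] = 0"
  "rcomb a ((q, i) # l) = q * a i + rcomb a l"
  by (simp_all add: rcomb_def)

lemma vcomb_reindex: "vcomb X (\<lambda>n. x (r n)) l = vcomb X x (map (apsnd r) l)"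
  by (induction l) auto

lemma rcomb_reindex: "rcomb (\<lambda>n. a (r n)) l = rcomb a (map (apsnd r) l)"
  by (induction l) auto

lemma rcomb_append [simp]: "rcomb a (l @ l') = rcomb a l + rcomb a l'"
  by (induction l) auto

lemma rcomb_scale [simp]: "rcomb a (map (apfst ((*) c)) l) = c * rcomb a l"
  by (induction l) (auto simp: algebra_simps)

lemma rcomb_sum: "rcomb (\<lambda>n. \<Sum>j\<in>J. b j * a n j) l = (\<Sum>j\<in>J. b j * rcomb (\<lambda>n. a n j) l)"
  by (induction l) (auto simp: sum.distrib sum_distrib_left algebra_simps)

lemma rcomb_cmult: "rcomb (\<lambda>n. c * a n) l = c * rcomb a l"
  by (induction l) (auto simp: algebra_simps)

lemma rcomb_suminf:
  assumes "\<And>n. summable (\<lambda>j. a n j)"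
  shows "summable (\<lambda>j. rcomb (\<lambda>n. a n j) l) \<and> rcomb (\<lambda>n. \<Sum>j. a n j) l = (\<Sum>j. rcomb (\<lambda>n. a n j) l)"
proof (induction l)
  case (Cons p l)
  obtain q i where "p = (q, i)" by force
  then show ?case
    using Cons assms[of i] by (auto simp: suminf_add[symmetric] suminf_mult summable_add summable_mult)
qed simp

lemma dual_iff:
  "f \<in> vcarrier (dual_nspace X) \<longleftrightarrow> f \<in> extensional (vcarrier X) \<and>
     (\<forall>x\<in>vcarrier X. \<forall>y\<in>vcarrier X. f (vadd X x y) = f x + f y) \<and>
     (\<forall>c. \<forall>x\<in>vcarrier X. f (vscale X c x) = c * f x) \<and>
     (\<exists>K. \<forall>x\<in>vcarrier X. \<bar>f x\<bar> \<le> K * vnorm X x)"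
  by (simp add: dual_nspace_def bounded_operator_def subspace_nspace_def)

context normed_space
begin

lemmas closed [simp, intro] = add_closed zero_closed scale_closed

lemma scale_zero [simp]:
  assumes "x \<in> vcarrier X" shows "vscale X 0 x = vzero X"
  using scale_add_left[OF assms, of 1 "-1"] assms by (simp add: scale_one add_inverse)

lemma zero_add [simp]: "x \<in> vcarrier X \<Longrightarrow> vadd X (vzero X) x = x"
  using add_commute add_zero by (metis zero_closed)

lemmas add_zero' [simp] = add_zero
lemmas scale_one' [simp] = scale_one

lemma scale_vzero [simp]: "vscale X c (vzero X) = vzero X"
  using scale_scale[of "vzero X" c 0] by simp

lemma norm_zero [simp]: "vnorm X (vzero X) = 0"
  by (simp add: norm_eq_zero)

lemma add_left_commute:
  assumes "x \<in> vcarrier X" "y \<in> vcarrier X" "z \<in> vcarrier X"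
  shows "vadd X x (vadd X y z) = vadd X y (vadd X x z)"
  using assms by (metis add_assoc add_commute)

lemmas add_ac = add_assoc add_commute add_left_commute

lemma add_inverse_left: "x \<in> vcarrier X \<Longrightarrow> vadd X (vscale X (-1) x) x = vzero X"
  by (simp add: add_commute add_inverse)

lemma add_cancel_left:
  assumes "x \<in> vcarrier X" "y \<in> vcarrier X"
  shows "vadd X x (vadd X (vscale X (-1) x) y) = y" "vadd X (vscale X (-1) x) (vadd X x y) = y"
  using assms by (simp_all flip: add_assoc add: add_inverse add_inverse_left)

lemma add_minus_cancel:
  assumes "x \<in> vcarrier X" "y \<in> vcarrier X"
  shows "vadd X (vadd X x y) (vscale X (-1) x) = y"
  using assms by (simp add: add_commute[of x y] add_assoc add_inverse)

lemma diff_closed [simp]: "x \<in> vcarrier X \<Longrightarrow> y \<in> vcarrier X \<Longrightarrow> vdiff X x y \<in> vcarrier X"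
  by (simp add: vdiff_def)

lemma vcomb_closed [simp]: "(\<And>n. x n \<in> vcarrier X) \<Longrightarrow> vcomb X x l \<in> vcarrier X"
  by (induction l) auto

lemma vcomb_append:
  assumes "\<And>n. x n \<in> vcarrier X"
  shows "vcomb X x (l @ l') = vadd X (vcomb X x l) (vcomb X x l')"
  using assms by (induction l) (auto simp: add_assoc)

lemma vcomb_scale:
  assumes "\<And>n. x n \<in> vcarrier X"
  shows "vcomb X x (map (apfst ((*) c)) l) = vscale X c (vcomb X x l)"
  using assms by (induction l) (auto simp: scale_add_right scale_scale)

lemma norm_diff_triangle:
  assumes "x \<in> vcarrier X" "y \<in> vcarrier X"
  shows "vnorm X x \<le> vnorm X y + vnorm X (vdiff X x y)"
proof -
  have "vadd X y (vdiff X x y) = x"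
    using assms unfolding vdiff_def by (metis add_cancel_left(1) add_commute scale_closed)
  then show ?thesis using norm_triangle[of y "vdiff X x y"] assms by simp
qed

lemma norm_minus: "x \<in> vcarrier X \<Longrightarrow> vnorm X (vscale X (-1) x) = vnorm X x"
  by (simp add: norm_scale)

lemma norm_diff_commute:
  assumes "x \<in> vcarrier X" "y \<in> vcarrier X"
  shows "vnorm X (vdiff X x y) = vnorm X (vdiff X y x)"
proof -
  have "vscale X (-1) (vdiff X x y) = vdiff X y x"
    using assms by (simp add: vdiff_def scale_add_right scale_scale add_commute)
  then show ?thesis using norm_minus[of "vdiff X x y"] assms by simp
qed

lemma diff_add_add:
  assumes "x \<in> vcarrier X" "y \<in> vcarrier X" "x' \<in> vcarrier X" "y' \<in> vcarrier X"
  shows "vdiff X (vadd X x y) (vadd X x' y') = vadd X (vdiff X x x') (vdiff X y y')"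
  using assms by (simp add: vdiff_def scale_add_right add_ac)

lemma diff_scale:
  assumes "x \<in> vcarrier X" "y \<in> vcarrier X"
  shows "vdiff X (vscale X c x) (vscale X c y) = vscale X c (vdiff X x y)"
  using assms by (simp add: vdiff_def scale_add_right scale_scale)

lemma diff_scale_left:
  assumes "x \<in> vcarrier X"
  shows "vdiff X (vscale X c x) (vscale X c' x) = vscale X (c - c') x"
  using assms scale_add_left[of x c "- c'"] by (simp add: vdiff_def scale_scale)

section \<open>The norm of the dual space\<close>

lemma dual_eval_le:
  assumes f: "f \<in> vcarrier (dual_nspace X)" and x: "x \<in> vcarrier X" "vnorm X x \<le> 1"
  shows "\<bar>f x\<bar> \<le> vnorm (dual_nspace X) f"
proof -
  obtain K where K: "\<And>x. x \<in> vcarrier X \<Longrightarrow> \<bar>f x\<bar> \<le> K * vnorm X x"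
    using f unfolding dual_iff by blast
  have "bdd_above ((\<lambda>x. \<bar>f x\<bar>) ` {x \<in> vcarrier X. vnorm X x \<le> 1})"
  proof (rule bdd_aboveI2)
    fix x assume "x \<in> {x \<in> vcarrier X. vnorm X x \<le> 1}"
    then show "\<bar>f x\<bar> \<le> max 0 K"
      using K[of x] norm_nonneg[of x] mult_mono[of K "max 0 K" "vnorm X x" 1] by auto
  qed
  then show ?thesis
    unfolding dual_nspace_def using x by (auto intro: cSUP_upper)
qed

lemma dual_normI:
  assumes "f \<in> vcarrier (dual_nspace X)" "x \<in> vcarrier X"
  shows "\<bar>f x\<bar> \<le> vnorm (dual_nspace X) f * vnorm X x"
proof (cases "vnorm X x = 0")
  case True
  then have "vscale X 0 x = x" using assms norm_eq_zero by simp
  then have "f x = 0 * f x" using assms unfolding dual_iff by metis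
  then show ?thesis using True by simp
next
  case False
  then have pos: "vnorm X x > 0" using norm_nonneg[OF assms(2)] by simp
  let ?y = "vscale X (1 / vnorm X x) x"
  have y: "?y \<in> vcarrier X" "vnorm X ?y = 1"
    using assms pos by (simp_all add: norm_scale)
  have fy: "f ?y = f x / vnorm X x"
    using assms unfolding dual_iff by simp
  have "\<bar>f ?y\<bar> \<le> vnorm (dual_nspace X) f"
    using y by (intro dual_eval_le[OF assms(1)]) simp_all
  then show ?thesis using fy pos by (simp add: field_simps)
qed

lemma dual_norm_le:
  assumes "0 \<le> K" "\<And>x. x \<in> vcarrier X \<Longrightarrow> \<bar>f x\<bar> \<le> K * vnorm X x"
  shows "vnorm (dual_nspace X) f \<le> K"
  unfolding dual_nspace_def nspace.simps
proof (rule cSUP_least)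
  show "{x \<in> vcarrier X. vnorm X x \<le> 1} \<noteq> {}" using zero_closed by force
  show "\<bar>f x\<bar> \<le> K" if "x \<in> {x \<in> vcarrier X. vnorm X x \<le> 1}" for x
    using that assms(2)[of x] mult_left_mono[of "vnorm X x" 1 K] assms(1) by simp
qed

lemma dual_norm_nonneg: "f \<in> vcarrier (dual_nspace X) \<Longrightarrow> 0 \<le> vnorm (dual_nspace X) f"
  using dual_eval_le[of f "vzero X"] by simp

end

section \<open>Extension of functionals\<close>

context normed_space
begin

text \<open>Of positive homogeneity only one inequality is demanded, the form that passes directly
  to infima; applied to \<open>1 / c\<close> as well, it gives equality.\<close>

definition sublinear :: "('a \<Rightarrow> real) \<Rightarrow> bool" where
  "sublinear f \<longleftrightarrow> (\<forall>x\<in>vcarrier X. \<forall>y\<in>vcarrier X. f (vadd X x y) \<le> f x + f y) \<and>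
     (\<forall>c>0. \<forall>x\<in>vcarrier X. f (vscale X c x) \<le> c * f x)"

lemma sublinear_zero: "sublinear f \<Longrightarrow> f (vzero X) = 0"
proof -
  assume f: "sublinear f"
  have "f (vscale X 2 (vzero X)) \<le> 2 * f (vzero X)" "f (vscale X (1/2) (vzero X)) \<le> 1/2 * f (vzero X)"
    using f unfolding sublinear_def by (meson zero_closed zero_less_numeral half_gt_zero zero_less_one)+
  then show ?thesis by simp
qed

lemma sublinear_scale:
  assumes "sublinear f" "c \<ge> 0" "x \<in> vcarrier X"
  shows "f (vscale X c x) = c * f x"
proof (cases "c = 0")
  case True
  then show ?thesis using assms sublinear_zero by simp
next
  case False
  then have c: "c > 0" using assms by simp
  have "f (vscale X (1 / c) (vscale X c x)) \<le> 1 / c * f (vscale X c x)"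
    using assms c unfolding sublinear_def by (meson scale_closed zero_less_divide_1_iff)
  then have "c * f x \<le> f (vscale X c x)"
    using c assms by (simp add: scale_scale field_simps)
  moreover have "f (vscale X c x) \<le> c * f x"
    using assms c unfolding sublinear_def by blast
  ultimately show ?thesis by simp
qed

lemma sublinear_minus:
  assumes "sublinear f" "x \<in> vcarrier X"
  shows "- f (vscale X (-1) x) \<le> f x"
proof -
  have "f (vadd X x (vscale X (-1) x)) \<le> f x + f (vscale X (-1) x)"
    using assms unfolding sublinear_def by blast
  then show ?thesis using assms sublinear_zero[of f] by (simp add: add_inverse)
qed

text \<open>The infimum \<open>g\<close> over \<open>t \<ge> 0\<close> of the values of
  \<open>m\<close> at \<open>x + t y\<close>, diminished by \<open>t * m y\<close>, is sublinear and
  below \<open>m\<close>, hence equal to \<open>m\<close>; its term for \<open>t = 1\<close> is the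
  missing inequality. This takes the place of the extension by one dimension in the Hahn-Banach
  theorem.\<close>

lemma minimal_sublinear_additive:
  assumes m: "sublinear m"
    and min: "\<And>g. sublinear g \<Longrightarrow> (\<And>x. x \<in> vcarrier X \<Longrightarrow> g x \<le> m x) \<Longrightarrow> (\<And>x. x \<in> vcarrier X \<Longrightarrow> g x = m x)"
    and xy: "x \<in> vcarrier X" "y \<in> vcarrier X"
  shows "m (vadd X x y) = m x + m y"
proof -
  define g where "g x = (INF t\<in>{0..}. m (vadd X x (vscale X t y)) - t * m y)" for x
  have bdd: "bdd_below ((\<lambda>t. m (vadd X x (vscale X t y)) - t * m y) ` {0..})" if x: "x \<in> vcarrier X" for x
  proof (rule bdd_belowI2)
    fix t :: real assume t: "t \<in> {0..}"
    have "m (vadd X (vadd X x (vscale X t y)) (vscale X (-1) x)) \<le> m (vadd X x (vscale X t y)) + m (vscale X (-1) x)"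
      using m x xy unfolding sublinear_def by simp
    moreover have "vadd X (vadd X x (vscale X t y)) (vscale X (-1) x) = vscale X t y"
      using x xy by (intro add_minus_cancel) auto
    ultimately show "- m (vscale X (-1) x) \<le> m (vadd X x (vscale X t y)) - t * m y"
      using sublinear_scale[OF m, of t y] t xy by simp
  qed
  have g_le: "g x \<le> m (vadd X x (vscale X t y)) - t * m y" if "x \<in> vcarrier X" "t \<ge> 0" for x t
    unfolding g_def using bdd[OF that(1)] that by (intro cINF_lower) auto
  have "sublinear g"
    unfolding sublinear_def
  proof (intro conjI ballI allI impI)
    fix u v assume u: "u \<in> vcarrier X" and v: "v \<in> vcarrier X"
    have le2: "g (vadd X u v) \<le> (m (vadd X u (vscale X t y)) - t * m y) + (m (vadd X v (vscale X t' y)) - t' * m y)"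
      if "t \<ge> 0" "t' \<ge> 0" for t t'
    proof -
      have "vadd X (vadd X u v) (vscale X (t + t') y) = vadd X (vadd X u (vscale X t y)) (vadd X v (vscale X t' y))"
        using u v xy by (simp add: scale_add_left add_ac)
      moreover have "m (vadd X (vadd X u (vscale X t y)) (vadd X v (vscale X t' y))) \<le> m (vadd X u (vscale X t y)) + m (vadd X v (vscale X t' y))"
        using m u v xy unfolding sublinear_def by simp
      ultimately show ?thesis
        using g_le[of "vadd X u v" "t + t'"] that u v by (simp add: algebra_simps)
    qed
    have "g (vadd X u v) - (m (vadd X u (vscale X t y)) - t * m y) \<le> g v" if "t \<ge> 0" for t
      unfolding g_def[of v]
    proof (rule cINF_greatest)
      fix t' :: real assume "t' \<in> {0..}"
      then show "g (vadd X u v) - (m (vadd X u (vscale X t y)) - t * m y) \<le> m (vadd X v (vscale X t' y)) - t' * m y"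
        using le2[OF that, of t'] by simp
    qed simp
    then have "g (vadd X u v) - g v \<le> m (vadd X u (vscale X t y)) - t * m y" if "t \<ge> 0" for t
      using that by (simp add: algebra_simps)
    then have "g (vadd X u v) - g v \<le> g u"
      unfolding g_def[of u] by (intro cINF_greatest) auto
    then show "g (vadd X u v) \<le> g u + g v" by simp
  next
    fix c :: real and u assume c: "c > 0" and u: "u \<in> vcarrier X"
    have "g (vscale X c u) / c \<le> m (vadd X u (vscale X t y)) - t * m y" if t: "t \<ge> 0" for t
    proof -
      have "vadd X (vscale X c u) (vscale X (c * t) y) = vscale X c (vadd X u (vscale X t y))"
        using u xy by (simp add: scale_add_right scale_scale)
      moreover have "m (vscale X c (vadd X u (vscale X t y))) = c * m (vadd X u (vscale X t y))"
        using u xy c by (intro sublinear_scale[OF m]) auto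
      ultimately show ?thesis
        using g_le[of "vscale X c u" "c * t"] c t u by (simp add: field_simps)
    qed
    then have "g (vscale X c u) / c \<le> g u"
      unfolding g_def[of u] by (intro cINF_greatest) auto
    then show "g (vscale X c u) \<le> c * g u" using c by (simp add: field_simps)
  qed
  moreover have "g u \<le> m u" if "u \<in> vcarrier X" for u
    using g_le[OF that, of 0] that xy by simp
  ultimately have "g x = m x" using min xy by blast
  then have "m x \<le> m (vadd X x y) - m y"
    using g_le[of x 1] xy by simp
  moreover have "m (vadd X x y) \<le> m x + m y"
    using m xy unfolding sublinear_def by blast
  ultimately show ?thesis by simp
qed

text \<open>The infima are finite because a sublinear \<open>f\<close> below \<open>p\<close>
  satisfies \<open>f x \<ge> - f (- x) \<ge> - p (- x)\<close>. For subadditivity, two members of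
  the chain are replaced by the smaller one.\<close>

lemma sublinear_INF_chain:
  assumes ne: "C \<noteq> {}" and sub: "\<And>f. f \<in> C \<Longrightarrow> sublinear f"
    and lower: "\<And>f x. f \<in> C \<Longrightarrow> x \<in> vcarrier X \<Longrightarrow> f x \<le> p x"
    and chain: "\<And>f g. f \<in> C \<Longrightarrow> g \<in> C \<Longrightarrow>
       (\<forall>x\<in>vcarrier X. f x \<le> g x) \<or> (\<forall>x\<in>vcarrier X. g x \<le> f x)"
  defines "u \<equiv> \<lambda>x\<in>vcarrier X. INF f\<in>C. f x"
  shows "sublinear u" "\<And>f x. f \<in> C \<Longrightarrow> x \<in> vcarrier X \<Longrightarrow> u x \<le> f x"
proof -
  have bdd: "bdd_below ((\<lambda>f. f x) ` C)" if x: "x \<in> vcarrier X" for x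
  proof (rule bdd_belowI2)
    fix f assume "f \<in> C"
    then show "- p (vscale X (-1) x) \<le> f x"
      using sublinear_minus[OF sub x] lower[of f "vscale X (-1) x"] x by fastforce
  qed
  show le: "u x \<le> f x" if "f \<in> C" "x \<in> vcarrier X" for f x
    unfolding u_def using bdd that by (auto intro: cINF_lower)
  have greatest: "c \<le> u x" if "x \<in> vcarrier X" "\<And>f. f \<in> C \<Longrightarrow> c \<le> f x" for c x
    unfolding u_def using that ne by (auto intro: cINF_greatest)
  show "sublinear u"
    unfolding sublinear_def
  proof (intro conjI ballI allI impI)
    fix x y assume x: "x \<in> vcarrier X" and y: "y \<in> vcarrier X"
    have le2: "u (vadd X x y) \<le> f x + g y" if f: "f \<in> C" and g: "g \<in> C" for f g
    proof -
      obtain h where h: "h \<in> C" "h x \<le> f x" "h y \<le> g y"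
        using chain[OF f g] f g x y by blast
      then have "u (vadd X x y) \<le> h x + h y"
        using le[of h "vadd X x y"] sub[of h] x y unfolding sublinear_def by (meson add_closed order_trans)
      then show ?thesis using h by simp
    qed
    have "u (vadd X x y) - f x \<le> u y" if "f \<in> C" for f
    proof (rule greatest[OF y])
      fix g assume "g \<in> C"
      from le2[OF that this] show "u (vadd X x y) - f x \<le> g y" by linarith
    qed
    then have "u (vadd X x y) - u y \<le> u x"
      by (intro greatest x) (simp add: algebra_simps)
    then show "u (vadd X x y) \<le> u x + u y" by simp
  next
    fix c :: real and x assume c: "c > 0" and x: "x \<in> vcarrier X"
    have "u (vscale X c x) / c \<le> u x"
    proof (rule greatest[OF x])
      fix f assume f: "f \<in> C"
      then have "u (vscale X c x) \<le> c * f x"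
        using le[of f "vscale X c x"] sub[OF f] x c unfolding sublinear_def by (meson scale_closed order_trans)
      then show "u (vscale X c x) / c \<le> f x" using c by (simp add: field_simps)
    qed
    then show "u (vscale X c x) \<le> c * u x" using c by (simp add: field_simps)
  qed
qed

text \<open>Zorn's lemma for the reversed pointwise order yields a minimal sublinear functional
  below \<open>p\<close>, and minimality makes it linear. Extensionality makes the order
  antisymmetric.\<close>

lemma dominated_linear_functional:
  assumes p: "sublinear p"
  obtains f where "\<And>x y. x \<in> vcarrier X \<Longrightarrow> y \<in> vcarrier X \<Longrightarrow> f (vadd X x y) = f x + f y"
    "\<And>c x. x \<in> vcarrier X \<Longrightarrow> f (vscale X c x) = c * f x"
    "\<And>x. x \<in> vcarrier X \<Longrightarrow> f x \<le> p x" "f \<in> extensional (vcarrier X)"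
proof -
  define A where "A = {f \<in> extensional (vcarrier X). sublinear f \<and> (\<forall>x\<in>vcarrier X. f x \<le> p x)}"
  define P where "P f g \<longleftrightarrow> (\<forall>x\<in>vcarrier X. g x \<le> f x)" for f g :: "'a \<Rightarrow> real"
  have "\<exists>m\<in>A. \<forall>a\<in>A. P m a \<longrightarrow> a = m"
  proof (rule predicate_Zorn)
    show "partial_order_on A (relation_of P A)"
    proof (rule partial_order_on_relation_ofI)
      fix a b c
      show "P a a" by (simp add: P_def)
      show "P a b \<Longrightarrow> P b c \<Longrightarrow> P a c" by (auto simp: P_def intro: order_trans)
      show "a = b" if "a \<in> A" "b \<in> A" "P a b" "P b a"
        using that by (intro extensionalityI[of _ "vcarrier X"]) (auto simp: A_def P_def intro: antisym)
    qed
    fix C assume C: "C \<in> Chains (relation_of P A)"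
    then have CA: "C \<subseteq> A" by (auto simp: Chains_def relation_of_def)
    show "\<exists>u\<in>A. \<forall>a\<in>C. P a u"
    proof (cases "C = {}")
      case True
      have "restrict p (vcarrier X) \<in> A"
        using p by (auto simp: A_def sublinear_def)
      then show ?thesis using True by blast
    next
      case False
      have ch: "(\<forall>x\<in>vcarrier X. f x \<le> g x) \<or> (\<forall>x\<in>vcarrier X. g x \<le> f x)" if "f \<in> C" "g \<in> C" for f g
        using C that by (auto simp: Chains_def relation_of_def P_def)
      define u where "u = (\<lambda>x\<in>vcarrier X. INF f\<in>C. f x)"
      have u: "sublinear u" "\<And>f x. f \<in> C \<Longrightarrow> x \<in> vcarrier X \<Longrightarrow> u x \<le> f x"
        unfolding u_def using CA ch
        by (intro sublinear_INF_chain[OF False, of p]; force simp: A_def)+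
      obtain f where f: "f \<in> C" using False by blast
      have "u x \<le> p x" if "x \<in> vcarrier X" for x
        using u(2)[OF f that] f CA that by (force simp: A_def)
      moreover have "u \<in> extensional (vcarrier X)" by (simp add: u_def)
      ultimately have "u \<in> A"
        using u(1) by (simp add: A_def)
      then show ?thesis using u(2) by (auto simp: P_def)
    qed
  qed
  then obtain m where m: "m \<in> A" and min: "\<And>a. a \<in> A \<Longrightarrow> P m a \<Longrightarrow> a = m" by blast
  have sm: "sublinear m" using m by (simp add: A_def)
  have add: "m (vadd X x y) = m x + m y" if "x \<in> vcarrier X" "y \<in> vcarrier X" for x y
  proof (rule minimal_sublinear_additive[OF sm _ that])
    fix g x assume g: "sublinear g" "\<And>x. x \<in> vcarrier X \<Longrightarrow> g x \<le> m x" and x: "x \<in> vcarrier X"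
    have "restrict g (vcarrier X) \<in> A"
      using g m by (force simp: A_def sublinear_def intro: order_trans)
    then have "restrict g (vcarrier X) = m"
      using g by (intro min) (auto simp: P_def)
    then show "g x = m x" using x by (metis restrict_apply')
  qed
  have scale: "m (vscale X c x) = c * m x" if x: "x \<in> vcarrier X" for c x
  proof (cases "c \<ge> 0")
    case True then show ?thesis using sublinear_scale[OF sm] x by blast
  next
    case False
    have "m (vadd X (vscale X c x) (vscale X (- c) x)) = m (vscale X c x) + m (vscale X (- c) x)"
      using x by (intro add) auto
    moreover have "vadd X (vscale X c x) (vscale X (- c) x) = vzero X"
      using x by (simp flip: scale_add_left)
    moreover have "m (vscale X (- c) x) = (- c) * m x"
      using False x by (intro sublinear_scale[OF sm]) auto
    ultimately show ?thesis using sublinear_zero[OF sm] by simp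
  qed
  show ?thesis
    using m by (intro that[of m] add scale) (auto simp: A_def)
qed

text \<open>Helly's form of the Hahn-Banach theorem. The infimum \<open>p\<close> is finite by the
  bound and at most \<open>k\<close> times the norm by the empty list; the lists with the single
  coefficient 1 or -1 make the distance term vanish and force the prescribed values.\<close>

lemma functional_with_values:
  assumes x: "\<And>n. x n \<in> vcarrier X" and k: "0 \<le> k"
    and bound: "\<And>l. \<bar>rcomb a l\<bar> \<le> k * vnorm X (vcomb X x l)"
  obtains f where "f \<in> vcarrier (dual_nspace X)" "\<And>n. f (x n) = a n"
proof -
  define p where "p y = (INF l. k * vnorm X (vdiff X y (vcomb X x l)) + rcomb a l)" for y
  have bdd: "bdd_below (range (\<lambda>l. k * vnorm X (vdiff X y (vcomb X x l)) + rcomb a l))" if y: "y \<in> vcarrier X" for y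
  proof (rule bdd_belowI2)
    fix l
    have "vnorm X (vcomb X x l) \<le> vnorm X y + vnorm X (vdiff X y (vcomb X x l))"
      using norm_diff_triangle[of "vcomb X x l" y] norm_diff_commute[of "vcomb X x l" y] x y by simp
    then have "k * vnorm X (vcomb X x l) \<le> k * vnorm X y + k * vnorm X (vdiff X y (vcomb X x l))"
      using mult_left_mono[OF _ k] by (fastforce simp: algebra_simps)
    then show "- (k * vnorm X y) \<le> k * vnorm X (vdiff X y (vcomb X x l)) + rcomb a l"
      using bound[of l] by linarith
  qed
  have p_le: "p y \<le> k * vnorm X (vdiff X y (vcomb X x l)) + rcomb a l" if "y \<in> vcarrier X" for y l
    unfolding p_def using bdd[OF that] by (intro cINF_lower) auto
  have greatest: "c \<le> p y" if "\<And>l. c \<le> k * vnorm X (vdiff X y (vcomb X x l)) + rcomb a l" for c y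
    unfolding p_def using that by (intro cINF_greatest) auto
  have "sublinear p"
    unfolding sublinear_def
  proof (intro conjI ballI allI impI)
    fix u v assume u: "u \<in> vcarrier X" and v: "v \<in> vcarrier X"
    have le: "p (vadd X u v) \<le> (k * vnorm X (vdiff X u (vcomb X x l)) + rcomb a l) + (k * vnorm X (vdiff X v (vcomb X x l')) + rcomb a l')" for l l'
    proof -
      have "vnorm X (vdiff X (vadd X u v) (vcomb X x (l @ l'))) \<le> vnorm X (vdiff X u (vcomb X x l)) + vnorm X (vdiff X v (vcomb X x l'))"
        using u v x by (simp add: vcomb_append diff_add_add norm_triangle)
      from mult_left_mono[OF this k] show ?thesis
        using p_le[of "vadd X u v" "l @ l'"] u v by (simp add: algebra_simps)
    qed
    have "p (vadd X u v) - (k * vnorm X (vdiff X u (vcomb X x l)) + rcomb a l) \<le> p v" for l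
      using le[of l] by (intro greatest) (simp add: algebra_simps)
    then have "p (vadd X u v) - p v \<le> p u"
      by (intro greatest) (simp add: algebra_simps)
    then show "p (vadd X u v) \<le> p u + p v" by simp
  next
    fix c :: real and u assume c: "c > 0" and u: "u \<in> vcarrier X"
    have "p (vscale X c u) / c \<le> p u"
    proof (rule greatest)
      fix l
      have "p (vscale X c u) \<le> k * (c * vnorm X (vdiff X u (vcomb X x l))) + c * rcomb a l"
        using p_le[of "vscale X c u" "map (apfst ((*) c)) l"] c u x
        by (simp add: vcomb_scale diff_scale norm_scale)
      then show "p (vscale X c u) / c \<le> k * vnorm X (vdiff X u (vcomb X x l)) + rcomb a l"
        using c by (simp add: field_simps)
    qed
    then show "p (vscale X c u) \<le> c * p u" using c by (simp add: field_simps)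
  qed
  then obtain f where f: "\<And>x y. x \<in> vcarrier X \<Longrightarrow> y \<in> vcarrier X \<Longrightarrow> f (vadd X x y) = f x + f y"
    "\<And>c x. x \<in> vcarrier X \<Longrightarrow> f (vscale X c x) = c * f x"
    "\<And>x. x \<in> vcarrier X \<Longrightarrow> f x \<le> p x" "f \<in> extensional (vcarrier X)"
    using dominated_linear_functional by blast
  have fk: "f y \<le> k * vnorm X y" if "y \<in> vcarrier X" for y
    using f(3)[OF that] p_le[OF that, of "[]"] that by (simp add: vdiff_def)
  have "\<bar>f y\<bar> \<le> k * vnorm X y" if "y \<in> vcarrier X" for y
    using fk[OF that] fk[of "vscale X (-1) y"] f(2)[of y "-1"] that by (simp add: norm_scale)
  then have "f \<in> vcarrier (dual_nspace X)"
    unfolding dual_iff using f by blast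
  moreover have "f (x n) = a n" for n
  proof (rule antisym)
    have "vdiff X (x n) (x n) = vzero X" using x by (simp add: vdiff_def add_inverse)
    then show "f (x n) \<le> a n"
      using f(3)[of "x n"] p_le[of "x n" "[(1, n)]"] x by simp
    have "vdiff X (vscale X (-1) (x n)) (vscale X (-1) (x n)) = vzero X"
      using x diff_scale_left[of "x n" "-1" "-1"] by simp
    then show "a n \<le> f (x n)"
      using f(3)[of "vscale X (-1) (x n)"] p_le[of "vscale X (-1) (x n)" "[(-1, n)]"] f(2)[of "x n" "-1"] x by simp
  qed
  ultimately show ?thesis using that by blast
qed

text \<open>The bound says that sending \<open>x i\<close> to the sequence \<open>a i\<close>
  extends to a bounded operator from the span of the \<open>x i\<close> into l1. Each bounded
  multiplier therefore comes from a functional on \<open>X\<close>, and the rows inherit weak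
  nullity.\<close>

lemma weakly_null_diagonal:
  assumes w: "weakly_null X x" and k: "0 \<le> k"
    and bound: "\<And>l M. (\<Sum>m<M. \<bar>rcomb (\<lambda>i. a i m) l\<bar>) \<le> k * vnorm X (vcomb X x l)"
  shows "(\<lambda>n. a n n) \<longlonglongrightarrow> 0"
proof (rule diagonal_null[of a])
  have x: "x n \<in> vcarrier X" for n using w by (simp add: weakly_null_def)
  have sm: "summable (\<lambda>m. \<bar>rcomb (\<lambda>i. a i m) l\<bar>)" for l
    by (rule summableI_nonneg_bounded) (use bound in auto)
  from sm[of "[(1, n)]" for n] show sa: "summable (\<lambda>j. \<bar>a n j\<bar>)" for n
    by simp
  fix s :: "nat \<Rightarrow> real" assume s: "\<And>j. \<bar>s j\<bar> \<le> 1"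
  have sle: "\<bar>s j * r\<bar> \<le> \<bar>r\<bar>" for j r
    using s[of j] by (simp add: abs_mult mult_left_le_one_le)
  have ss: "summable (\<lambda>j. s j * a n j)" for n
    by (rule summable_comparison_test[OF _ sa[of n]]) (auto simp: sle)
  have "\<bar>rcomb (\<lambda>n. \<Sum>j. s j * a n j) l\<bar> \<le> k * vnorm X (vcomb X x l)" for l
  proof -
    have "rcomb (\<lambda>n. \<Sum>j. s j * a n j) l = (\<Sum>j. s j * rcomb (\<lambda>n. a n j) l)"
      using rcomb_suminf[of "\<lambda>n j. s j * a n j" l] ss by (simp add: rcomb_cmult)
    also have "\<bar>\<dots>\<bar> \<le> (\<Sum>j. \<bar>s j * rcomb (\<lambda>n. a n j) l\<bar>)"
      by (intro summable_rabs summable_comparison_test[OF _ sm[of l]]) (auto simp: sle)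
    also have "\<dots> \<le> (\<Sum>j. \<bar>rcomb (\<lambda>n. a n j) l\<bar>)"
      by (intro suminf_le sle sm summable_comparison_test[OF _ sm[of l]]) (auto simp: sle)
    also have "\<dots> \<le> k * vnorm X (vcomb X x l)"
      by (intro suminf_le_const sm bound)
    finally show ?thesis .
  qed
  then obtain f where "f \<in> vcarrier (dual_nspace X)" "\<And>n. f (x n) = (\<Sum>j. s j * a n j)"
    using functional_with_values[of x k "\<lambda>n. \<Sum>j. s j * a n j", OF x k] by blast
  then show "(\<lambda>n. \<Sum>j. s j * a n j) \<longlonglongrightarrow> 0"
    using w unfolding weakly_null_def by fastforce
qed

end

lemma filterlim_ge_id: "(\<And>n::nat. n \<le> r n) \<Longrightarrow> filterlim r sequentially sequentially"
  by (rule filterlim_at_top_mono[OF filterlim_ident]) auto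

text \<open>The indices may repeat or go back; \<open>n \<le> r n\<close> is what the choice
  arguments deliver and is enough for convergence.\<close>

lemma weakly_null_subseq:
  assumes "weakly_null X x" "\<And>n. n \<le> r n"
  shows "weakly_null X (\<lambda>n. x (r n))"
  using assms filterlim_compose[OF _ filterlim_ge_id[OF assms(2)]]
  unfolding weakly_null_def by blast

section \<open>Operators and complete continuity\<close>

lemma bounded_operatorD:
  assumes "bounded_operator X Y A"
  shows "x \<in> vcarrier X \<Longrightarrow> A x \<in> vcarrier Y"
    "x \<in> vcarrier X \<Longrightarrow> y \<in> vcarrier X \<Longrightarrow> A (vadd X x y) = vadd Y (A x) (A y)"
    "x \<in> vcarrier X \<Longrightarrow> A (vscale X c x) = vscale Y c (A x)"
  using assms unfolding bounded_operator_def by auto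

lemma bounded_operator_bound:
  assumes "bounded_operator X Y A" "normed_space X"
  obtains K where "K > 0" "\<And>x. x \<in> vcarrier X \<Longrightarrow> vnorm Y (A x) \<le> K * vnorm X x"
proof -
  obtain K where K: "\<And>x. x \<in> vcarrier X \<Longrightarrow> vnorm Y (A x) \<le> K * vnorm X x"
    using assms(1) unfolding bounded_operator_def by blast
  have "vnorm Y (A x) \<le> max K 1 * vnorm X x" if "x \<in> vcarrier X" for x
    using K[OF that] normed_space.norm_nonneg[OF assms(2) that] mult_right_mono[of K "max K 1" "vnorm X x"]
    by linarith
  then show ?thesis using that[of "max K 1"] by simp
qed

lemma bounded_operator_vcomb:
  assumes "bounded_operator X Y A" "normed_space X" "normed_space Y" "\<And>n. x n \<in> vcarrier X"
  shows "A (vcomb X x l) = vcomb Y (\<lambda>n. A (x n)) l"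
proof (induction l)
  case Nil
  have "A (vscale X 0 (vzero X)) = vscale Y 0 (A (vzero X))"
    using bounded_operatorD(3)[OF assms(1)] normed_space.zero_closed[OF assms(2)] by blast
  then show ?case
    using normed_space.zero_closed[OF assms(2)] bounded_operatorD(1)[OF assms(1)]
    by (simp add: normed_space.scale_zero[OF assms(2)] normed_space.scale_zero[OF assms(3)])
next
  case (Cons p l)
  obtain q i where p: "p = (q, i)" by force
  then show ?case
    using Cons bounded_operatorD[OF assms(1)] assms(4) normed_space.vcomb_closed[OF assms(2,4)]
      normed_space.scale_closed[OF assms(2)] by simp
qed

lemma bounded_operator_comp:
  assumes A: "bounded_operator X Y A" and B: "bounded_operator Y Z B" and X: "normed_space X" and Y: "normed_space Y"
  shows "bounded_operator X Z (B \<circ> A)"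
proof -
  obtain K L where K: "\<And>x. x \<in> vcarrier X \<Longrightarrow> vnorm Y (A x) \<le> K * vnorm X x"
    and L: "L > 0" "\<And>x. x \<in> vcarrier Y \<Longrightarrow> vnorm Z (B x) \<le> L * vnorm Y x"
    using bounded_operator_bound[OF A X] bounded_operator_bound[OF B Y] by metis
  have "vnorm Z (B (A x)) \<le> (L * K) * vnorm X x" if "x \<in> vcarrier X" for x
    using order_trans[OF L(2)[OF bounded_operatorD(1)[OF A that]] mult_left_mono[OF K[OF that], of L]] L(1)
    by (simp add: mult.assoc)
  then show ?thesis
    using bounded_operatorD[OF A] bounded_operatorD[OF B] unfolding bounded_operator_def by auto
qed

section \<open>Adjoints and dual spaces\<close>

lemma dual_comp:
  assumes A: "bounded_operator X Y A" and X: "normed_space X" and Y: "normed_space Y"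
    and f: "f \<in> vcarrier (dual_nspace Y)"
  shows "restrict (\<lambda>x. f (A x)) (vcarrier X) \<in> vcarrier (dual_nspace X)"
proof -
  obtain K where K: "\<And>x. x \<in> vcarrier X \<Longrightarrow> vnorm Y (A x) \<le> K * vnorm X x"
    using bounded_operator_bound[OF A X] by metis
  have "\<bar>f (A x)\<bar> \<le> (vnorm (dual_nspace Y) f * K) * vnorm X x" if "x \<in> vcarrier X" for x
    using normed_space.dual_normI[OF Y f bounded_operatorD(1)[OF A that]]
      mult_left_mono[OF K[OF that] normed_space.dual_norm_nonneg[OF Y f]] by simp
  then show ?thesis
    using f bounded_operatorD[OF A] normed_space.add_closed[OF X] normed_space.scale_closed[OF X]
    unfolding dual_iff by (auto intro!: exI[of _ "vnorm (dual_nspace Y) f * K"])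
qed

lemma weakly_null_operator:
  assumes A: "bounded_operator X Y A" and X: "normed_space X" and Y: "normed_space Y"
    and x: "weakly_null X x"
  shows "weakly_null Y (\<lambda>n. A (x n))"
  unfolding weakly_null_def
proof (intro conjI allI ballI)
  fix n show "A (x n) \<in> vcarrier Y"
    using x bounded_operatorD(1)[OF A] by (simp add: weakly_null_def)
next
  fix f assume "f \<in> vcarrier (dual_nspace Y)"
  then have "(\<lambda>n. restrict (\<lambda>x. f (A x)) (vcarrier X) (x n)) \<longlonglongrightarrow> 0"
    using x dual_comp[OF A X Y] unfolding weakly_null_def by blast
  then show "(\<lambda>n. f (A (x n))) \<longlonglongrightarrow> 0"
    using x by (simp add: weakly_null_def)
qed

lemma dual_simps:
  "vadd (dual_nspace X) f g = (\<lambda>x\<in>vcarrier X. f x + g x)"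
  "vscale (dual_nspace X) c f = (\<lambda>x\<in>vcarrier X. c * f x)"
  by (simp_all add: dual_nspace_def)

lemma normed_space_dual:
  assumes X: "normed_space X"
  shows "normed_space (dual_nspace X)"
proof -
  interpret normed_space X by fact
  have ext: "f \<in> extensional (vcarrier X)" if "f \<in> vcarrier (dual_nspace X)" for f
    using that unfolding dual_iff by blast
  have add: "vadd (dual_nspace X) f g \<in> vcarrier (dual_nspace X)"
    if f: "f \<in> vcarrier (dual_nspace X)" and g: "g \<in> vcarrier (dual_nspace X)" for f g
  proof -
    have "\<bar>f x + g x\<bar> \<le> (vnorm (dual_nspace X) f + vnorm (dual_nspace X) g) * vnorm X x"
      if "x \<in> vcarrier X" for x
      using dual_normI[OF f that] dual_normI[OF g that] by (simp add: algebra_simps)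
    then show ?thesis
      using f g unfolding dual_iff dual_simps
      by (auto simp: algebra_simps intro!: exI[of _ "vnorm (dual_nspace X) f + vnorm (dual_nspace X) g"])
  qed
  have scale: "vscale (dual_nspace X) c f \<in> vcarrier (dual_nspace X)"
    if f: "f \<in> vcarrier (dual_nspace X)" for f c
  proof -
    have "\<bar>c * f x\<bar> \<le> (\<bar>c\<bar> * vnorm (dual_nspace X) f) * vnorm X x" if "x \<in> vcarrier X" for x
      using mult_left_mono[OF dual_normI[OF f that], of "\<bar>c\<bar>"] by (simp add: abs_mult)
    then show ?thesis
      using f unfolding dual_iff dual_simps
      by (auto simp: algebra_simps intro!: exI[of _ "\<bar>c\<bar> * vnorm (dual_nspace X) f"])
  qed
  have zero: "vzero (dual_nspace X) = (\<lambda>x\<in>vcarrier X. 0)" "vzero (dual_nspace X) \<in> vcarrier (dual_nspace X)"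
    unfolding dual_iff by (auto simp: dual_nspace_def intro!: exI[of _ 0])
  have nsc: "vnorm (dual_nspace X) (vscale (dual_nspace X) c f) \<le> \<bar>c\<bar> * vnorm (dual_nspace X) f"
    if f: "f \<in> vcarrier (dual_nspace X)" for f c
  proof (rule dual_norm_le)
    show "0 \<le> \<bar>c\<bar> * vnorm (dual_nspace X) f" using dual_norm_nonneg[OF f] by simp
    show "\<bar>vscale (dual_nspace X) c f x\<bar> \<le> \<bar>c\<bar> * vnorm (dual_nspace X) f * vnorm X x"
      if "x \<in> vcarrier X" for x
      using mult_left_mono[OF dual_normI[OF f that], of "\<bar>c\<bar>"] that by (simp add: abs_mult dual_simps mult.assoc)
  qed
  show ?thesis
  proof
    fix f g h and b c :: real
    assume f: "f \<in> vcarrier (dual_nspace X)"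
    show "vscale (dual_nspace X) c f \<in> vcarrier (dual_nspace X)" by (rule scale[OF f])
    show "vadd (dual_nspace X) f (vzero (dual_nspace X)) = f"
      by (rule extensionalityI[of _ "vcarrier X"]) (auto simp: dual_simps zero ext f)
    show "vadd (dual_nspace X) f (vscale (dual_nspace X) (-1) f) = vzero (dual_nspace X)"
      by (auto simp: dual_simps zero)
    show "vscale (dual_nspace X) 1 f = f"
      by (rule extensionalityI[of _ "vcarrier X"]) (auto simp: dual_simps ext f)
    show "vscale (dual_nspace X) b (vscale (dual_nspace X) c f) = vscale (dual_nspace X) (b * c) f"
      by (auto simp: dual_simps)
    show "vscale (dual_nspace X) (b + c) f = vadd (dual_nspace X) (vscale (dual_nspace X) b f) (vscale (dual_nspace X) c f)"
      by (auto simp: dual_simps algebra_simps)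
    show "0 \<le> vnorm (dual_nspace X) f" by (rule dual_norm_nonneg[OF f])
    show "(vnorm (dual_nspace X) f = 0) = (f = vzero (dual_nspace X))"
    proof
      assume "vnorm (dual_nspace X) f = 0"
      then have "f x = 0" if "x \<in> vcarrier X" for x
        using dual_normI[OF f that] by simp
      then show "f = vzero (dual_nspace X)"
        by (intro extensionalityI[of _ "vcarrier X"]) (auto simp: zero(1) ext f)
    next
      assume "f = vzero (dual_nspace X)"
      then have "vnorm (dual_nspace X) f \<le> 0"
        by (intro dual_norm_le) (auto simp: zero)
      then show "vnorm (dual_nspace X) f = 0" using dual_norm_nonneg[OF f] by simp
    qed
    show "vnorm (dual_nspace X) (vscale (dual_nspace X) c f) = \<bar>c\<bar> * vnorm (dual_nspace X) f"
    proof (cases "c = 0")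
      case True
      then show ?thesis using nsc[OF f, of 0] dual_norm_nonneg[OF scale[OF f], of 0] by simp
    next
      case False
      have "vscale (dual_nspace X) (1 / c) (vscale (dual_nspace X) c f) = f"
        by (rule extensionalityI[of _ "vcarrier X"]) (use False in \<open>auto simp: dual_simps ext f\<close>)
      then have "vnorm (dual_nspace X) f \<le> \<bar>1 / c\<bar> * vnorm (dual_nspace X) (vscale (dual_nspace X) c f)"
        using nsc[OF scale[OF f, of c], of "1 / c"] by simp
      then show ?thesis using nsc[OF f, of c] False by (simp add: field_simps)
    qed
    assume g: "g \<in> vcarrier (dual_nspace X)"
    show "vadd (dual_nspace X) f g \<in> vcarrier (dual_nspace X)" by (rule add[OF f g])
    show "vadd (dual_nspace X) f g = vadd (dual_nspace X) g f"
      by (auto simp: dual_simps)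
    show "vscale (dual_nspace X) c (vadd (dual_nspace X) f g) = vadd (dual_nspace X) (vscale (dual_nspace X) c f) (vscale (dual_nspace X) c g)"
      by (auto simp: dual_simps algebra_simps)
    show "vnorm (dual_nspace X) (vadd (dual_nspace X) f g) \<le> vnorm (dual_nspace X) f + vnorm (dual_nspace X) g"
    proof (rule dual_norm_le)
      show "0 \<le> vnorm (dual_nspace X) f + vnorm (dual_nspace X) g"
        using dual_norm_nonneg f g by simp
      show "\<bar>vadd (dual_nspace X) f g x\<bar> \<le> (vnorm (dual_nspace X) f + vnorm (dual_nspace X) g) * vnorm X x"
        if "x \<in> vcarrier X" for x
        using dual_normI[OF f that] dual_normI[OF g that] that by (simp add: dual_simps algebra_simps)
    qed
    assume h: "h \<in> vcarrier (dual_nspace X)"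
    show "vadd (dual_nspace X) (vadd (dual_nspace X) f g) h = vadd (dual_nspace X) f (vadd (dual_nspace X) g h)"
      by (auto simp: dual_simps)
  next
    show "vzero (dual_nspace X) \<in> vcarrier (dual_nspace X)" by (rule zero)
  qed
qed

lemma bounded_operator_adjoint:
  assumes A: "bounded_operator X Y A" and X: "normed_space X" and Y: "normed_space Y"
  shows "bounded_operator (dual_nspace Y) (dual_nspace X) (\<lambda>f. restrict (\<lambda>x. f (A x)) (vcarrier X))"
proof -
  obtain K where K: "K > 0" "\<And>x. x \<in> vcarrier X \<Longrightarrow> vnorm Y (A x) \<le> K * vnorm X x"
    using bounded_operator_bound[OF A X] by metis
  have "vnorm (dual_nspace X) (restrict (\<lambda>x. f (A x)) (vcarrier X)) \<le> K * vnorm (dual_nspace Y) f"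
    if f: "f \<in> vcarrier (dual_nspace Y)" for f
  proof (rule normed_space.dual_norm_le[OF X])
    show "0 \<le> K * vnorm (dual_nspace Y) f"
      using K(1) normed_space.dual_norm_nonneg[OF Y f] by simp
    show "\<bar>restrict (\<lambda>x. f (A x)) (vcarrier X) x\<bar> \<le> K * vnorm (dual_nspace Y) f * vnorm X x"
      if x: "x \<in> vcarrier X" for x
      using normed_space.dual_normI[OF Y f bounded_operatorD(1)[OF A x]]
        mult_left_mono[OF K(2)[OF x] normed_space.dual_norm_nonneg[OF Y f]] x by (simp add: mult_ac)
  qed
  then show ?thesis
    using dual_comp[OF A X Y] bounded_operatorD(1)[OF A]
    unfolding bounded_operator_def by (auto simp: dual_simps)
qed

text \<open>The usual argument bounds the norms of the functionals by the uniform boundedness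
  principle. Here a subsequence with images of norm at most 2^-m is taken, and the matrix of the
  values \<open>f (r m) (v j)\<close> is submitted to \<open>diagonal_null\<close>.\<close>

lemma completely_continuous_imp_dunford_pettis:
  assumes X: "normed_space X" and Y: "normed_space Y" and A: "bounded_operator X Y A"
    and cc: "completely_continuous X Y A"
  shows "dunford_pettis X Y A"
  unfolding dunford_pettis_def
proof (intro allI impI, elim conjE, rule ccontr)
  fix x f
  assume x: "weakly_null X x" and f: "weakly_null (dual_nspace Y) f"
    and not: "\<not> (\<lambda>n. f n (A (x n))) \<longlonglongrightarrow> 0"
  obtain \<delta> where \<delta>: "\<delta> > 0" and ex: "\<And>N. \<exists>n\<ge>N. \<bar>f n (A (x n))\<bar> \<ge> \<delta>"
    using not unfolding LIMSEQ_iff by (auto simp: not_less)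
  have lim: "(\<lambda>n. vnorm Y (A (x n))) \<longlonglongrightarrow> 0"
    using cc x unfolding completely_continuous_def by blast
  have "\<forall>m. \<exists>n. n \<ge> m \<and> \<bar>f n (A (x n))\<bar> \<ge> \<delta> \<and> vnorm Y (A (x n)) \<le> (1/2) ^ m"
  proof
    fix m :: nat
    have "\<forall>\<^sub>F n in sequentially. vnorm Y (A (x n)) < (1/2) ^ m"
      by (rule order_tendstoD(2)[OF lim]) simp
    then obtain N where "\<And>n. n \<ge> N \<Longrightarrow> vnorm Y (A (x n)) < (1/2) ^ m"
      unfolding eventually_sequentially by blast
    moreover obtain n where "n \<ge> max m N" "\<bar>f n (A (x n))\<bar> \<ge> \<delta>" using ex by blast
    ultimately show "\<exists>n. n \<ge> m \<and> \<bar>f n (A (x n))\<bar> \<ge> \<delta> \<and> vnorm Y (A (x n)) \<le> (1/2) ^ m"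
      by (intro exI[of _ n]) (auto intro: less_imp_le)
  qed
  from choice[OF this] obtain r where r: "\<And>m. m \<le> r m" "\<And>m. \<bar>f (r m) (A (x (r m)))\<bar> \<ge> \<delta>"
    "\<And>m. vnorm Y (A (x (r m))) \<le> (1/2) ^ m" by blast
  define v where "v m = A (x (r m))" for m
  have v: "v m \<in> vcarrier Y" "vnorm Y (v m) \<le> (1/2) ^ m" for m
    using r(3) x bounded_operatorD(1)[OF A] by (auto simp: v_def weakly_null_def)
  have summable_half: "summable (\<lambda>m. c * (1/2::real) ^ m)" for c
    by (intro summable_mult summable_geometric) simp
  have bound: "\<bar>g (v m)\<bar> \<le> vnorm (dual_nspace Y) g * (1/2) ^ m" if g: "g \<in> vcarrier (dual_nspace Y)" for g m
    using normed_space.dual_normI[OF Y g v(1)[of m]] mult_left_mono[OF v(2)[of m] normed_space.dual_norm_nonneg[OF Y g]]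
    by linarith
  have sums: "summable (\<lambda>m. \<bar>g (v m)\<bar>)" if g: "g \<in> vcarrier (dual_nspace Y)" for g
    by (rule summable_comparison_test[OF _ summable_half]) (use bound[OF g] in auto)
  have fr: "weakly_null (dual_nspace Y) (\<lambda>m. f (r m))"
    by (rule weakly_null_subseq[OF f r(1)])
  have fin: "f n \<in> vcarrier (dual_nspace Y)" for n
    using f by (simp add: weakly_null_def)
  have "(\<lambda>m. f (r m) (v m)) \<longlonglongrightarrow> 0"
  proof (rule diagonal_null[of "\<lambda>m j. f (r m) (v j)"])
    show "summable (\<lambda>j. \<bar>f (r n) (v j)\<bar>)" for n by (rule sums[OF fin])
    fix s :: "nat \<Rightarrow> real" assume s: "\<And>j. \<bar>s j\<bar> \<le> 1"
    have sle: "\<bar>s j * t\<bar> \<le> \<bar>t\<bar>" for j t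
      using s[of j] by (simp add: abs_mult mult_left_le_one_le)
    have ss: "summable (\<lambda>j. \<bar>s j * g (v j)\<bar>)" if "g \<in> vcarrier (dual_nspace Y)" for g
      by (rule summable_comparison_test[OF _ sums[OF that]]) (auto simp: sle)
    have ss': "summable (\<lambda>j. s j * g (v j))" if "g \<in> vcarrier (dual_nspace Y)" for g
      by (rule summable_rabs_cancel[OF ss[OF that]])
    \<comment> \<open>The sum of the vectors \<open>s j\<close> times \<open>v j\<close>, formed in
      the bidual because \<open>Y\<close> need not be complete. Its norm is at most 2, the sum of
      the powers of 1/2.\<close>
    define \<Phi> where "\<Phi> = (\<lambda>g\<in>vcarrier (dual_nspace Y). \<Sum>j. s j * g (v j))"
    have "\<bar>\<Phi> g\<bar> \<le> 2 * vnorm (dual_nspace Y) g" if g: "g \<in> vcarrier (dual_nspace Y)" for g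
    proof -
      have "\<bar>\<Phi> g\<bar> \<le> (\<Sum>j. \<bar>s j * g (v j)\<bar>)"
        unfolding \<Phi>_def using g by (simp add: summable_rabs ss)
      also have "\<dots> \<le> (\<Sum>j. vnorm (dual_nspace Y) g * (1/2) ^ j)"
        by (intro suminf_le order_trans[OF sle bound[OF g]] ss[OF g] summable_half)
      also have "\<dots> = 2 * vnorm (dual_nspace Y) g"
        by (subst suminf_mult) (auto simp: suminf_geometric)
      finally show ?thesis .
    qed
    moreover have "\<Phi> (vadd (dual_nspace Y) g h) = \<Phi> g + \<Phi> h"
      if "g \<in> vcarrier (dual_nspace Y)" "h \<in> vcarrier (dual_nspace Y)" for g h
      using that normed_space.add_closed[OF normed_space_dual[OF Y] that] v ss'
      by (simp add: \<Phi>_def dual_simps suminf_add algebra_simps)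
    moreover have "\<Phi> (vscale (dual_nspace Y) c g) = c * \<Phi> g"
      if "g \<in> vcarrier (dual_nspace Y)" for g c
      using that normed_space.scale_closed[OF normed_space_dual[OF Y] that] v ss'
      by (simp add: \<Phi>_def dual_simps suminf_mult[symmetric] algebra_simps)
    ultimately have "\<Phi> \<in> vcarrier (dual_nspace (dual_nspace Y))"
      unfolding dual_iff[of \<Phi>] by (auto simp: \<Phi>_def)
    then have "(\<lambda>m. \<Phi> (f (r m))) \<longlonglongrightarrow> 0"
      using fr unfolding weakly_null_def by blast
    then show "(\<lambda>n. \<Sum>j. s j * f (r n) (v j)) \<longlonglongrightarrow> 0"
      by (simp add: \<Phi>_def fin)
  qed
  then have "(\<lambda>m. \<bar>f (r m) (v m)\<bar>) \<longlonglongrightarrow> 0" by (rule tendsto_rabs_zero)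
  then have "\<forall>\<^sub>F m in sequentially. \<bar>f (r m) (v m)\<bar> < \<delta>"
    by (rule order_tendstoD(2)) (rule \<delta>)
  then show False
    using r(2) unfolding v_def eventually_sequentially by (meson le_refl not_less)
qed

section \<open>Transport along injections\<close>

text \<open>Serves to place the tree operators, which live on \<open>cantor_fun\<close>, into the
  type of a hypothetical universal operator.\<close>

definition transport :: "('a \<Rightarrow> 'b) \<Rightarrow> 'a nspace \<Rightarrow> 'b nspace" where
  "transport h Z = \<lparr>vcarrier = h ` vcarrier Z, vadd = (\<lambda>a b. h (vadd Z (inv h a) (inv h b))),
     vzero = h (vzero Z), vscale = (\<lambda>c a. h (vscale Z c (inv h a))), vnorm = (\<lambda>a. vnorm Z (inv h a))\<rparr>"

lemma transport_simps:
  assumes "inj h"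
  shows "vcarrier (transport h Z) = h ` vcarrier Z"
    "vadd (transport h Z) (h x) (h y) = h (vadd Z x y)"
    "vzero (transport h Z) = h (vzero Z)"
    "vscale (transport h Z) c (h x) = h (vscale Z c x)"
    "vnorm (transport h Z) (h x) = vnorm Z x"
    "vdiff (transport h Z) (h x) (h y) = h (vdiff Z x y)"
  using assms by (simp_all add: transport_def vdiff_def)

lemma normed_space_transport:
  assumes h: "inj h" and Z: "normed_space Z"
  shows "normed_space (transport h Z)"
proof -
  interpret normed_space Z by fact
  show ?thesis
    by unfold_locales
      (auto simp: transport_simps[OF h] inj_eq[OF h] add_assoc add_inverse scale_scale
        scale_add_left scale_add_right norm_nonneg norm_eq_zero norm_scale norm_triangle
        intro: add_commute)
qed

lemma banach_space_transport:
  fixes h :: "'a \<Rightarrow> 'b"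
  assumes h: "inj h" and Z: "banach_space Z"
  shows "banach_space (transport h Z)"
proof -
  interpret banach_space Z by fact
  interpret T: normed_space "transport h Z"
    by (rule normed_space_transport[OF h]) unfold_locales
  show ?thesis
  proof
    fix s :: "nat \<Rightarrow> 'b" assume s: "\<And>n. s n \<in> vcarrier (transport h Z)"
      and C: "\<And>e. 0 < e \<Longrightarrow> \<exists>N. \<forall>m\<ge>N. \<forall>n\<ge>N. vnorm (transport h Z) (vdiff (transport h Z) (s m) (s n)) < e"
    have "\<forall>n. \<exists>t. t \<in> vcarrier Z \<and> s n = h t"
      using s by (auto simp: transport_simps[OF h])
    from choice[OF this] obtain t where t: "\<And>n. t n \<in> vcarrier Z" "\<And>n. s n = h (t n)" by blast
    have "\<exists>x\<in>vcarrier Z. (\<lambda>n. vnorm Z (vdiff Z (t n) x)) \<longlonglongrightarrow> 0"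
      by (rule complete) (use t C in \<open>auto simp: transport_simps[OF h]\<close>)
    then show "\<exists>x\<in>vcarrier (transport h Z). (\<lambda>n. vnorm (transport h Z) (vdiff (transport h Z) (s n) x)) \<longlonglongrightarrow> 0"
      by (auto simp: transport_simps[OF h] t(2))
  qed
qed

lemma bounded_operator_transport:
  assumes h: "inj h"
  shows "bounded_operator Z (transport h Z) h" "bounded_operator (transport h Z) Z (inv h)"
  using h by (auto simp: bounded_operator_def transport_simps[OF h] intro!: exI[of _ 1])

lemma bounded_operator_transported:
  assumes h: "inj h" and Z: "banach_space Z" and W: "banach_space W" and A: "bounded_operator Z W A"
  shows "bounded_operator (transport h Z) (transport h W) (h \<circ> A \<circ> inv h)"
proof -
  have n: "normed_space Z" "normed_space W" "normed_space (transport h Z)" "normed_space (transport h W)"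
    using Z W normed_space_transport[OF h] by (auto simp: banach_space_def)
  show ?thesis
    by (intro bounded_operator_comp[OF bounded_operator_transport(2)[OF h]]
        bounded_operator_comp[OF A bounded_operator_transport(1)[OF h]] n)
qed

lemma compl_dunford_pettis_transport:
  assumes h: "inj h" and c: "compl_class dunford_pettis Z W A"
  shows "compl_class dunford_pettis (transport h Z) (transport h W) (h \<circ> A \<circ> inv h)"
proof -
  have Z: "banach_space Z" and W: "banach_space W" and A: "bounded_operator Z W A"
    and not: "\<not> dunford_pettis Z W A"
    using c by (auto simp: compl_class_def)
  have n: "normed_space Z" "normed_space W" "normed_space (transport h Z)" "normed_space (transport h W)"
    using Z W normed_space_transport[OF h] by (auto simp: banach_space_def)
  have "\<not> dunford_pettis (transport h Z) (transport h W) (h \<circ> A \<circ> inv h)"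
  proof
    assume dp: "dunford_pettis (transport h Z) (transport h W) (h \<circ> A \<circ> inv h)"
    have "dunford_pettis Z W A"
      unfolding dunford_pettis_def
    proof (intro allI impI, elim conjE)
      fix x f assume x: "weakly_null Z x" and f: "weakly_null (dual_nspace W) f"
      have "weakly_null (transport h Z) (\<lambda>n. h (x n))"
        by (rule weakly_null_operator[OF bounded_operator_transport(1)[OF h] n(1,3) x])
      moreover have "weakly_null (dual_nspace (transport h W))
         (\<lambda>n. restrict (\<lambda>w. f n (inv h w)) (vcarrier (transport h W)))"
        by (rule weakly_null_operator[OF bounded_operator_adjoint[OF bounded_operator_transport(2)[OF h] n(4,2)]
              normed_space_dual[OF n(2)] normed_space_dual[OF n(4)] f])
      ultimately have "(\<lambda>n. restrict (\<lambda>w. f n (inv h w)) (vcarrier (transport h W))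
          ((h \<circ> A \<circ> inv h) (h (x n)))) \<longlonglongrightarrow> 0"
        using dp unfolding dunford_pettis_def by blast
      moreover have "A (x n) \<in> vcarrier W" for n
        using x bounded_operatorD(1)[OF A] by (simp add: weakly_null_def)
      ultimately show "(\<lambda>n. f n (A (x n))) \<longlonglongrightarrow> 0"
        by (simp add: transport_simps[OF h] inv_f_f[OF h])
    qed
    then show False using not by blast
  qed
  then show ?thesis
    using Z W A by (simp add: compl_class_def banach_space_transport[OF h] bounded_operator_transported[OF h])
qed

section \<open>Closed subspaces\<close>

lemma subspace_nspace_simps [simp]:
  "vcarrier (subspace_nspace S) = S" "vadd (subspace_nspace S) = (+)" "vzero (subspace_nspace S) = 0"
  "vscale (subspace_nspace S) = (*\<^sub>R)" "vnorm (subspace_nspace S) = norm" "vdiff (subspace_nspace S) = (-)"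
  by (auto simp: subspace_nspace_def vdiff_def fun_eq_iff)

lemma normed_space_subspace:
  assumes "subspace S"
  shows "normed_space (subspace_nspace S)"
  using assms
  by unfold_locales (auto simp: subspace_add subspace_0 subspace_scale algebra_simps norm_triangle_ineq)

lemma banach_space_subspace:
  fixes S :: "'a::real_normed_vector set"
  assumes S: "subspace S" "complete S"
  shows "banach_space (subspace_nspace S)"
proof -
  interpret normed_space "subspace_nspace S" by (rule normed_space_subspace[OF S(1)])
  show ?thesis
  proof
    fix s :: "nat \<Rightarrow> 'a" assume s: "\<And>n. s n \<in> vcarrier (subspace_nspace S)"
      and C: "\<And>e. 0 < e \<Longrightarrow> \<exists>N. \<forall>m\<ge>N. \<forall>n\<ge>N. vnorm (subspace_nspace S) (vdiff (subspace_nspace S) (s m) (s n)) < e"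
    have "Cauchy s"
      using C by (simp add: Cauchy_iff)
    then obtain x where "x \<in> S" "s \<longlonglongrightarrow> x"
      using s S(2) unfolding complete_def by auto
    then show "\<exists>x\<in>vcarrier (subspace_nspace S). (\<lambda>n. vnorm (subspace_nspace S) (vdiff (subspace_nspace S) (s n) x)) \<longlonglongrightarrow> 0"
      by (auto intro!: bexI[of _ x] simp: LIM_zero_iff tendsto_norm_zero_iff)
  qed
qed

lemma complete_cantor_fun:
  fixes S :: "cantor_fun set"
  assumes "closed S" shows "complete S"
proof -
  have "complete (UNIV :: cantor_fun set)"
    unfolding complete_def
  proof (intro allI impI)
    fix f :: "nat \<Rightarrow> cantor_fun"
    assume "(\<forall>n. f n \<in> UNIV) \<and> Cauchy f"
    then obtain g where "uniform_limit UNIV f g sequentially"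
      using uniformly_convergent_eq_cauchy[of "\<lambda>_. True" f]
      unfolding Cauchy_def uniform_limit_sequentially_iff
      by (metis dist_fun_lt_imp_dist_val_lt)
    then obtain l where "g = apply_bcontfun l" "f \<longlonglongrightarrow> l"
      by (rule uniform_limit_bcontfunE[OF _ sequentially_bot])
    then show "\<exists>l\<in>UNIV. f \<longlonglongrightarrow> l" by (intro bexI[of _ l] UNIV_I)
  qed
  then show ?thesis using complete_closed_subset[OF assms subset_UNIV] by blast
qed

lemma ex_rat_sequence:
  obtains q :: "nat \<Rightarrow> rat" where "(\<lambda>n. real_of_rat (q n)) \<longlonglongrightarrow> c"
proof -
  have "\<forall>n. \<exists>q::rat. c < of_rat q \<and> of_rat q < c + 1 / real (Suc n)"
    by (intro allI of_rat_dense) simp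
  from choice[OF this] obtain q :: "nat \<Rightarrow> rat"
    where q: "\<And>n. c < of_rat (q n)" "\<And>n. of_rat (q n) < c + 1 / real (Suc n)" by blast
  have "(\<lambda>n. c + 1 / real (Suc n)) \<longlonglongrightarrow> c + 0"
    by (intro tendsto_add tendsto_const LIMSEQ_Suc[OF lim_1_over_n])
  then have "(\<lambda>n. c + 1 / real (Suc n)) \<longlonglongrightarrow> c" by simp
  then have "(\<lambda>n. real_of_rat (q n)) \<longlonglongrightarrow> c"
    by (rule tendsto_sandwich[OF _ _ tendsto_const, rotated 2])
      (use q in \<open>auto intro!: always_eventually less_imp_le\<close>)
  then show ?thesis by (rule that)
qed

text \<open>Real multiples are limits of rational ones, so the closure of a countable set of
  rational combinations qualifies.\<close>

lemma subspace_closureI: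
  fixes G :: "'a::real_normed_vector set"
  assumes zero: "0 \<in> G" and add: "\<And>x y. x \<in> G \<Longrightarrow> y \<in> G \<Longrightarrow> x + y \<in> G"
    and scale: "\<And>(q::rat) x. x \<in> G \<Longrightarrow> of_rat q *\<^sub>R x \<in> G"
  shows "subspace (closure G)"
proof (rule subspaceI)
  show "0 \<in> closure G" using zero closure_subset by blast
next
  fix x y assume "x \<in> closure G" "y \<in> closure G"
  then obtain u v where "\<And>n. u n \<in> G" "u \<longlonglongrightarrow> x" "\<And>n. v n \<in> G" "v \<longlonglongrightarrow> y"
    unfolding closure_sequential by blast
  then have "(\<lambda>n. u n + v n) \<longlonglongrightarrow> x + y" "\<And>n. u n + v n \<in> G"
    using add by (auto intro: tendsto_add)
  then show "x + y \<in> closure G" unfolding closure_sequential by (intro exI[of _ "\<lambda>n. u n + v n"]) blast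
next
  fix c :: real and x assume "x \<in> closure G"
  then obtain u where u: "\<And>n. u n \<in> G" "u \<longlonglongrightarrow> x"
    unfolding closure_sequential by blast
  obtain q :: "nat \<Rightarrow> rat" where "(\<lambda>n. real_of_rat (q n)) \<longlonglongrightarrow> c"
    by (rule ex_rat_sequence)
  then have "(\<lambda>n. real_of_rat (q n) *\<^sub>R u n) \<longlonglongrightarrow> c *\<^sub>R x"
    using u(2) by (rule tendsto_scaleR)
  then show "c *\<^sub>R x \<in> closure G"
    unfolding closure_sequential using scale[OF u(1)] by (intro exI[of _ "\<lambda>n. of_rat (q n) *\<^sub>R u n"]) blast
qed

lemma vcomb_subspace [simp]:
  "vcomb (subspace_nspace S) x l = (\<Sum>(q, i)\<leftarrow>l. q *\<^sub>R x i)"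
  by (induction l) auto

section \<open>Families of finite sets attached to trees\<close>

text \<open>For an increasing list \<open>ns\<close>, \<open>fam T [] ns\<close> means that \<open>ns\<close> dominates entry by entry a node of \<open>T\<close>
  whose initial segments are nodes as well. Because of the domination, a single branch
  of \<open>T\<close> produces sequences all of whose finite parts belong to the family inside every infinite set.
  In \<open>adm\<close> the parameter \<open>\<kappa> = 0\<close> selects this family and \<open>\<kappa> > 0\<close> a bound on the cardinality;
  the lower bound on the elements only serves the coding by points of the Cantor set.\<close>

fun fam :: "nat list set \<Rightarrow> nat list \<Rightarrow> nat list \<Rightarrow> bool" where
  "fam T t [] \<longleftrightarrow> t \<in> T"
| "fam T t (n # ns) \<longleftrightarrow> t \<in> T \<and> (\<exists>j\<le>n. fam T (t @ [j]) ns)"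

definition adm :: "nat list set \<Rightarrow> nat \<Rightarrow> nat list \<Rightarrow> bool" where
  "adm T \<kappa> ns \<longleftrightarrow> sorted_wrt (<) ns \<and> (\<forall>j\<in>set ns. \<kappa> \<le> Suc j) \<and>
     (if \<kappa> = 0 then fam T [] ns else length ns \<le> 16 ^ \<kappa>)"

lemma fam_mem: "fam T t ns \<Longrightarrow> t \<in> T"
  by (cases ns) auto

text \<open>The entries of the branch witness the existential quantifiers in \<open>fam\<close>; the
  starting point \<open>s\<close> is general for the sake of the induction on
  \<open>m\<close>.\<close>

lemma fam_branch:
  assumes "\<And>n. map \<beta> [0..<n] \<in> T" "\<And>i. \<beta> i \<le> r i"
  shows "fam T (map \<beta> [0..<s]) (map r [s..<s + m])"
proof (induction m arbitrary: s)
  case 0 then show ?case using assms by simp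
next
  case (Suc m)
  have "[s..<s + Suc m] = s # [Suc s..<Suc s + m]" by (simp add: upt_conv_Cons)
  moreover have "fam T (map \<beta> [0..<s] @ [\<beta> s]) (map r [Suc s..<Suc s + m])"
    using Suc[of "Suc s"] by simp
  ultimately show ?case
    using assms(1)[of s] assms(2)[of s] by (simp only: list.map fam.simps) blast
qed

section \<open>The gliding hump along a branch\<close>

lemma not_null_bounded_below:
  assumes "(a :: nat \<Rightarrow> real) \<longlonglongrightarrow> 0" "\<And>n. \<delta> \<le> \<bar>a n\<bar>" "0 < \<delta>"
  shows False
proof -
  have "\<forall>\<^sub>F n in sequentially. \<bar>a n\<bar> < \<delta>"
    by (rule order_tendstoD(2)[OF tendsto_rabs_zero[OF assms(1)] assms(3)])
  then show False using assms(2) unfolding eventually_sequentially by (meson le_refl not_less)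
qed

text \<open>Both sides depend continuously on the coefficients. The countable condition
  \<open>relaxed\<close> speaks about rational combinations, the extension of functionals about real
  ones.\<close>

lemma (in normed_space) real_comb_bound:
  assumes x: "\<And>n. x n \<in> vcarrier X" and k: "0 \<le> k"
    and bound: "\<And>l. c * (\<Sum>j\<in>J. \<bar>rcomb (\<lambda>i. z i j) (rat_comb l)\<bar>) \<le> k * vnorm X (vcomb X x (rat_comb l))"
  shows "c * (\<Sum>j\<in>J. \<bar>rcomb (\<lambda>i. z i j) l\<bar>) \<le> k * vnorm X (vcomb X x l)"
proof -
  let ?d = "\<lambda>l l'. vnorm X (vdiff X (vcomb X x l) (vcomb X x l'))"
  \<comment> \<open>The approximation is built one coefficient at a time, with one choice of
    rationals that serves all coordinates and the norm.\<close>
  have "\<exists>L. (\<forall>j. (\<lambda>m. rcomb (\<lambda>i. z i j) (rat_comb (L m))) \<longlonglongrightarrow> rcomb (\<lambda>i. z i j) l) \<and> (\<lambda>m. ?d (rat_comb (L m)) l) \<longlonglongrightarrow> 0"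
  proof (induction l)
    case Nil
    show ?case by (rule exI[of _ "\<lambda>_. []"]) (simp add: vdiff_def)
  next
    case (Cons p l)
    then obtain L where L: "\<And>j. (\<lambda>m. rcomb (\<lambda>i. z i j) (rat_comb (L m))) \<longlonglongrightarrow> rcomb (\<lambda>i. z i j) l"
      "(\<lambda>m. ?d (rat_comb (L m)) l) \<longlonglongrightarrow> 0" by blast
    obtain q i where p: "p = (q, i)" by force
    obtain r where r: "(\<lambda>n. real_of_rat (r n)) \<longlonglongrightarrow> q" by (rule ex_rat_sequence)
    have "?d (rat_comb ((r m, i) # L m)) (p # l) \<le> \<bar>of_rat (r m) - q\<bar> * vnorm X (x i) + ?d (rat_comb (L m)) l" for m
      using x norm_triangle[of "vscale X (of_rat (r m) - q) (x i)" "vdiff X (vcomb X x (rat_comb (L m))) (vcomb X x l)"]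
      by (simp add: p diff_add_add diff_scale_left norm_scale)
    then have "\<bar>?d (rat_comb ((r m, i) # L m)) (p # l)\<bar> \<le> \<bar>of_rat (r m) - q\<bar> * vnorm X (x i) + ?d (rat_comb (L m)) l" for m
      using norm_nonneg[OF diff_closed[OF vcomb_closed[OF x] vcomb_closed[OF x]]] by (simp only: abs_of_nonneg)
    moreover have "(\<lambda>m. \<bar>of_rat (r m) - q\<bar> * vnorm X (x i) + ?d (rat_comb (L m)) l) \<longlonglongrightarrow> \<bar>q - q\<bar> * vnorm X (x i) + 0"
      by (intro tendsto_intros r L)
    then have "(\<lambda>m. \<bar>of_rat (r m) - q\<bar> * vnorm X (x i) + ?d (rat_comb (L m)) l) \<longlonglongrightarrow> 0" by simp
    ultimately have "(\<lambda>m. ?d (rat_comb ((r m, i) # L m)) (p # l)) \<longlonglongrightarrow> 0"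
      by (elim Lim_null_comparison[rotated]) (intro always_eventually allI, simp only: real_norm_def)
    moreover have "(\<lambda>m. rcomb (\<lambda>i. z i j) (rat_comb ((r m, i) # L m))) \<longlonglongrightarrow> rcomb (\<lambda>i. z i j) (p # l)" for j
      by (simp add: p) (intro tendsto_intros r L)
    ultimately show ?case by (intro exI[of _ "\<lambda>m. (r m, i) # L m"]) blast
  qed
  then obtain L where L: "\<And>j. (\<lambda>m. rcomb (\<lambda>i. z i j) (rat_comb (L m))) \<longlonglongrightarrow> rcomb (\<lambda>i. z i j) l"
    "(\<lambda>m. ?d (rat_comb (L m)) l) \<longlonglongrightarrow> 0" by blast
  have "(\<lambda>m. c * (\<Sum>j\<in>J. \<bar>rcomb (\<lambda>i. z i j) (rat_comb (L m))\<bar>)) \<longlonglongrightarrow> c * (\<Sum>j\<in>J. \<bar>rcomb (\<lambda>i. z i j) l\<bar>)"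
    "(\<lambda>m. k * (vnorm X (vcomb X x l) + ?d (rat_comb (L m)) l)) \<longlonglongrightarrow> k * (vnorm X (vcomb X x l) + 0)"
    by (intro tendsto_intros L)+
  note lim = this
  have le: "c * (\<Sum>j\<in>J. \<bar>rcomb (\<lambda>i. z i j) (rat_comb l')\<bar>) \<le> k * (vnorm X (vcomb X x l) + ?d (rat_comb l') l)" for l'
    by (rule order_trans[OF bound mult_left_mono[OF norm_diff_triangle k]]) (use x in simp_all)
  have "c * (\<Sum>j\<in>J. \<bar>rcomb (\<lambda>i. z i j) l\<bar>) \<le> k * (vnorm X (vcomb X x l) + 0)"
    by (rule LIMSEQ_le[OF lim]) (use le in blast)
  then show ?thesis by simp
qed

text \<open>Here \<open>z i\<close> are the coordinates of the image of \<open>x i\<close> in the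
  space of \<open>T\<close>; the claim is that the norms in the second space tend to 0. Otherwise
  either large sums occur for arbitrarily late \<open>n\<close> at bounded indices
  \<open>\<kappa>\<close>, and then large single coordinates can be collected above the branch, or
  the indices tend to infinity, and then the quotient of the two weights gives summability.\<close>

lemma (in normed_space) branch_null:
  assumes T: "has_branch T" and x: "weakly_null X x" and k: "0 \<le> k"
    and bound: "\<And>l \<kappa> ns. adm T \<kappa> ns \<Longrightarrow>
      (1/2) ^ \<kappa> * (\<Sum>j\<in>set ns. \<bar>rcomb (\<lambda>i. z i j) l\<bar>) \<le> k * vnorm X (vcomb X x l)"
    and \<epsilon>: "0 < \<epsilon>"
  shows "\<exists>N. \<forall>n\<ge>N. \<forall>\<kappa>\<ge>1. \<forall>ns. adm T \<kappa> ns \<longrightarrow> (1/4) ^ \<kappa> * (\<Sum>j\<in>set ns. \<bar>z n j\<bar>) < \<epsilon>"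
proof (rule ccontr)
  assume "\<not> ?thesis"
  then have bad: "\<exists>n\<ge>N. \<exists>\<kappa>\<ge>1. \<exists>ns. adm T \<kappa> ns \<and> \<epsilon> \<le> (1/4) ^ \<kappa> * (\<Sum>j\<in>set ns. \<bar>z n j\<bar>)" for N
    by (metis not_le)
  have xc: "x n \<in> vcarrier X" for n using x by (simp add: weakly_null_def)
  show False
  proof (cases "\<exists>K. \<forall>N. \<exists>n\<ge>N. \<exists>\<kappa>\<ge>1. \<kappa> \<le> K \<and> (\<exists>ns. adm T \<kappa> ns \<and> \<epsilon> \<le> (1/4) ^ \<kappa> * (\<Sum>j\<in>set ns. \<bar>z n j\<bar>))")
    case True
    then obtain K where K: "\<And>N. \<exists>n\<ge>N. \<exists>\<kappa>\<ge>1. \<kappa> \<le> K \<and> (\<exists>ns. adm T \<kappa> ns \<and> \<epsilon> \<le> (1/4) ^ \<kappa> * (\<Sum>j\<in>set ns. \<bar>z n j\<bar>))"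
      by blast
    \<comment> \<open>A sum of size \<open>\<epsilon>\<close> over at most \<open>16 ^ K\<close>
      elements has a term of at least this size.\<close>
    define \<delta> where "\<delta> = \<epsilon> / 16 ^ K"
    have \<delta>: "\<delta> > 0" using \<epsilon> by (simp add: \<delta>_def)
    have large: "\<exists>n\<ge>N. \<exists>j. \<delta> \<le> \<bar>z n j\<bar>" for N
    proof -
      obtain n \<kappa> ns where n: "n \<ge> N" "\<kappa> \<ge> 1" "\<kappa> \<le> K" "adm T \<kappa> ns" "\<epsilon> \<le> (1/4) ^ \<kappa> * (\<Sum>j\<in>set ns. \<bar>z n j\<bar>)"
        using K by blast
      have "\<exists>j. \<delta> \<le> \<bar>z n j\<bar>"
      proof (rule ccontr)
        assume "\<not> (\<exists>j. \<delta> \<le> \<bar>z n j\<bar>)"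
        then have lt: "\<bar>z n j\<bar> < \<delta>" for j by (simp add: not_le)
        have ns0: "ns \<noteq> []" using n(5) \<epsilon> by auto
        have "(\<Sum>j\<in>set ns. \<bar>z n j\<bar>) < of_nat (card (set ns)) * \<delta>"
          using ns0 lt sum_strict_mono[of "set ns" "\<lambda>j. \<bar>z n j\<bar>" "\<lambda>_. \<delta>"] by simp
        also have "card (set ns) \<le> 16 ^ \<kappa>"
          using n(2,4) card_length[of ns] unfolding adm_def by (simp split: if_splits)
        then have "card (set ns) \<le> 16 ^ K"
          using power_increasing[OF n(3), of "16::nat"] by linarith
        then have "real (card (set ns)) \<le> real (16 ^ K)"
          by (simp only: of_nat_le_iff)
        then have "of_nat (card (set ns)) * \<delta> \<le> 16 ^ K * \<delta>"
          using \<delta> by (intro mult_right_mono) auto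
        also have "\<dots> = \<epsilon>" by (simp add: \<delta>_def)
        finally have "(\<Sum>j\<in>set ns. \<bar>z n j\<bar>) < \<epsilon>" .
        moreover have "(1/4::real) ^ \<kappa> * (\<Sum>j\<in>set ns. \<bar>z n j\<bar>) \<le> 1 * (\<Sum>j\<in>set ns. \<bar>z n j\<bar>)"
          by (intro mult_right_mono) (auto simp: power_le_one sum_nonneg)
        ultimately show False using n(5) by simp
      qed
      then show ?thesis using n(1) by blast
    qed
    \<comment> \<open>Singletons are admissible for \<open>\<kappa> = 1\<close> whatever the tree
      is, so every coordinate is a bounded functional; the factor 2 undoes the weight 1/2. Hence
      large entries must move to late positions.\<close>
    have col: "(\<lambda>n. z n j) \<longlonglongrightarrow> 0" for j
    proof -
      have "\<bar>rcomb (\<lambda>i. z i j) l\<bar> \<le> (2 * k) * vnorm X (vcomb X x l)" for l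
        using bound[of 1 "[j]" l] by (simp add: adm_def)
      then obtain f where "f \<in> vcarrier (dual_nspace X)" "\<And>n. f (x n) = z n j"
        using functional_with_values[of x "2 * k" "\<lambda>i. z i j", OF xc] k by auto
      then show ?thesis using x unfolding weakly_null_def by fastforce
    qed
    have step: "\<exists>n\<ge>N. \<exists>j\<ge>B. \<delta> \<le> \<bar>z n j\<bar>" for N B
    proof -
      have "\<forall>\<^sub>F n in sequentially. \<forall>j\<in>{..<B}. \<bar>z n j\<bar> < \<delta>"
        using order_tendstoD(2)[OF tendsto_rabs_zero[OF col] \<delta>]
        by (intro eventually_ball_finite) auto
      then obtain N' where N': "\<And>n j. n \<ge> N' \<Longrightarrow> j < B \<Longrightarrow> \<bar>z n j\<bar> < \<delta>"
        unfolding eventually_sequentially by blast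
      obtain n j where "n \<ge> max N N'" "\<delta> \<le> \<bar>z n j\<bar>" using large by blast
      moreover from this have "B \<le> j" using N'[of n j] by (cases "j < B") auto
      ultimately show ?thesis by (intro exI[of _ n]) auto
    qed
    obtain \<beta> where \<beta>: "\<And>n. map \<beta> [0..<n] \<in> T"
      using T unfolding has_branch_def by blast
    \<comment> \<open>The positions increase and dominate the branch, so the first \<open>M\<close>
      of them form a set of the family for every \<open>M\<close>. With \<open>\<kappa> = 0\<close>
      the hypothesis bounds the sums over all of them without loss of weight.\<close>
    have "\<exists>p. \<forall>m. (m \<le> fst (p m) \<and> \<beta> m \<le> snd (p m) \<and> \<delta> \<le> \<bar>z (fst (p m)) (snd (p m))\<bar>) \<and> snd (p m) < snd (p (Suc m))"
    proof (rule dependent_nat_choice)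
      show "\<exists>p. 0 \<le> fst p \<and> \<beta> 0 \<le> snd p \<and> \<delta> \<le> \<bar>z (fst p) (snd p)\<bar>"
        using step[of 0 "\<beta> 0"] by auto
      show "\<exists>p'. (Suc m \<le> fst p' \<and> \<beta> (Suc m) \<le> snd p' \<and> \<delta> \<le> \<bar>z (fst p') (snd p')\<bar>) \<and> snd p < snd p'" for p m
      proof -
        obtain n j where "n \<ge> Suc m" "j \<ge> max (\<beta> (Suc m)) (Suc (snd p))" "\<delta> \<le> \<bar>z n j\<bar>"
          using step by blast
        then show ?thesis by (intro exI[of _ "(n, j)"]) auto
      qed
    qed
    then obtain p where p: "\<And>m. m \<le> fst (p m)" "\<And>m. \<beta> m \<le> snd (p m)" "\<And>m. \<delta> \<le> \<bar>z (fst (p m)) (snd (p m))\<bar>"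
      "\<And>m. snd (p m) < snd (p (Suc m))" by blast
    define n j where "n m = fst (p m)" and "j m = snd (p m)" for m
    have mono: "strict_mono j" using p(4) by (simp add: strict_mono_Suc_iff j_def)
    have "(\<lambda>m. z (n m) (j m)) \<longlonglongrightarrow> 0"
    proof (rule weakly_null_diagonal[of "\<lambda>m. x (n m)" k "\<lambda>i m. z (n i) (j m)"])
      show "weakly_null X (\<lambda>m. x (n m))"
        using weakly_null_subseq[OF x, of n] p(1) by (simp add: n_def)
      show "0 \<le> k" by fact
      fix l M
      have "fam T (map \<beta> [0..<0]) (map j [0..<0 + M])"
        by (rule fam_branch[OF \<beta>]) (simp add: j_def p)
      moreover have "sorted_wrt (<) (map j [0..<M])"
        using mono by (simp add: sorted_wrt_iff_nth_less strict_mono_less)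
      ultimately have "adm T 0 (map j [0..<M])" by (simp add: adm_def)
      from bound[OF this, of "map (apsnd n) l"]
      have "(\<Sum>j\<in>j ` {..<M}. \<bar>rcomb (\<lambda>i. z (n i) j) l\<bar>) \<le> k * vnorm X (vcomb X (\<lambda>m. x (n m)) l)"
        by (simp add: vcomb_reindex rcomb_reindex[of "\<lambda>i. z i _" n] atLeast0LessThan)
      then show "(\<Sum>m<M. \<bar>rcomb (\<lambda>i. z (n i) (j m)) l\<bar>) \<le> k * vnorm X (vcomb X (\<lambda>m. x (n m)) l)"
        by (subst (asm) sum.reindex) (auto simp: strict_mono_imp_inj_on[OF mono])
    qed
    then show False
      by (rule not_null_bounded_below[of _ \<delta>]) (use p(3) \<delta> in \<open>auto simp: n_def j_def\<close>)
  next
    case False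
    \<comment> \<open>As no bound on the index is met arbitrarily late, beyond a suitable
      \<open>N\<close> all offending indices exceed \<open>m\<close>.\<close>
    have "\<forall>m. \<exists>p. m \<le> fst p \<and> m \<le> fst (snd p) \<and> adm T (fst (snd p)) (snd (snd p)) \<and>
       \<epsilon> \<le> (1/4) ^ fst (snd p) * (\<Sum>j\<in>set (snd (snd p)). \<bar>z (fst p) j\<bar>)"
    proof
      fix m :: nat
      obtain N where N: "\<And>n \<kappa> ns. n \<ge> N \<Longrightarrow> \<kappa> \<ge> 1 \<Longrightarrow> \<kappa> \<le> m \<Longrightarrow> adm T \<kappa> ns \<Longrightarrow> \<not> \<epsilon> \<le> (1/4) ^ \<kappa> * (\<Sum>j\<in>set ns. \<bar>z n j\<bar>)"
        using False by blast
      obtain n \<kappa> ns where n: "n \<ge> max m N" "\<kappa> \<ge> 1" "adm T \<kappa> ns" "\<epsilon> \<le> (1/4) ^ \<kappa> * (\<Sum>j\<in>set ns. \<bar>z n j\<bar>)"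
        using bad by blast
      then have "m \<le> \<kappa>" using N[of n \<kappa> ns] by (cases "\<kappa> \<le> m") auto
      then show "\<exists>p. m \<le> fst p \<and> m \<le> fst (snd p) \<and> adm T (fst (snd p)) (snd (snd p)) \<and>
         \<epsilon> \<le> (1/4) ^ fst (snd p) * (\<Sum>j\<in>set (snd (snd p)). \<bar>z (fst p) j\<bar>)"
        using n by (intro exI[of _ "(n, \<kappa>, ns)"]) auto
    qed
    from choice[OF this] obtain p where p: "\<forall>m. m \<le> fst (p m) \<and> m \<le> fst (snd (p m)) \<and> adm T (fst (snd (p m))) (snd (snd (p m))) \<and>
       \<epsilon> \<le> (1/4) ^ fst (snd (p m)) * (\<Sum>j\<in>set (snd (snd (p m))). \<bar>z (fst (p m)) j\<bar>)" by blast
    define n \<kappa> ns where "n m = fst (p m)" and "\<kappa> m = fst (snd (p m))" and "ns m = snd (snd (p m))" for m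
    have n: "m \<le> n m" "m \<le> \<kappa> m" "adm T (\<kappa> m) (ns m)" "\<epsilon> \<le> (1/4) ^ \<kappa> m * (\<Sum>j\<in>set (ns m). \<bar>z (n m) j\<bar>)" for m
      using p by (auto simp: n_def \<kappa>_def ns_def)
    \<comment> \<open>The \<open>m\<close>-th column norms the \<open>m\<close>-th vector, so the
      diagonal stays above \<open>\<epsilon>\<close>. Of the weight
      \<open>(1/4) ^ \<kappa> m\<close> one factor \<open>(1/2) ^ \<kappa> m\<close> is consumed by
      the hypothesis; the other is at most \<open>(1/2) ^ m\<close>, and the sum of these gives the
      constant \<open>2 * k\<close>.\<close>
    define a where "a i m = (\<Sum>j\<in>set (ns m). ((1/4) ^ \<kappa> m * sgn (z (n m) j)) * z (n i) j)" for i m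
    have "(\<lambda>m. a m m) \<longlonglongrightarrow> 0"
    proof (rule weakly_null_diagonal[of "\<lambda>m. x (n m)" "2 * k" a])
      show "weakly_null X (\<lambda>m. x (n m))"
        using weakly_null_subseq[OF x, of n] n(1) by simp
      show "0 \<le> 2 * k" using k by simp
      fix l M
      let ?R = "k * vnorm X (vcomb X (\<lambda>m. x (n m)) l)"
      have R0: "0 \<le> ?R" using k xc by (intro mult_nonneg_nonneg norm_nonneg) auto
      have "\<bar>rcomb (\<lambda>i. a i m) l\<bar> \<le> (1/2) ^ m * ?R" for m
      proof -
        have "\<bar>rcomb (\<lambda>i. a i m) l\<bar> \<le> (\<Sum>j\<in>set (ns m). \<bar>((1/4) ^ \<kappa> m * sgn (z (n m) j)) * rcomb (\<lambda>i. z (n i) j) l\<bar>)"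
          unfolding a_def rcomb_sum by (rule sum_abs)
        also have "\<dots> \<le> (\<Sum>j\<in>set (ns m). (1/4) ^ \<kappa> m * \<bar>rcomb (\<lambda>i. z (n i) j) l\<bar>)"
          by (intro sum_mono) (auto simp: abs_mult sgn_real_def)
        also have "\<dots> = (1/2) ^ \<kappa> m * ((1/2) ^ \<kappa> m * (\<Sum>j\<in>set (ns m). \<bar>rcomb (\<lambda>i. z (n i) j) l\<bar>))"
          by (simp add: sum_distrib_left[symmetric] mult.assoc[symmetric] power_mult_distrib[symmetric])
        also have "\<dots> \<le> (1/2) ^ \<kappa> m * ?R"
          using bound[OF n(3)[of m], of "map (apsnd n) l"]
          by (intro mult_left_mono) (simp_all add: vcomb_reindex rcomb_reindex[of "\<lambda>i. z i _" n])
        also have "\<dots> \<le> (1/2) ^ m * ?R"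
          by (intro mult_right_mono power_decreasing n R0) auto
        finally show ?thesis .
      qed
      then have "(\<Sum>m<M. \<bar>rcomb (\<lambda>i. a i m) l\<bar>) \<le> (\<Sum>m<M. (1/2) ^ m * ?R)"
        by (intro sum_mono)
      also have "\<dots> = (\<Sum>m<M. (1/2) ^ m) * ?R" by (simp add: sum_distrib_right)
      also have "(\<Sum>m<M. (1/2::real) ^ m) \<le> 2"
        by (simp add: sum_gp_strict)
      then have "(\<Sum>m<M. (1/2::real) ^ m) * ?R \<le> 2 * ?R"
        using R0 by (intro mult_right_mono)
      finally show "(\<Sum>m<M. \<bar>rcomb (\<lambda>i. a i m) l\<bar>) \<le> 2 * k * vnorm X (vcomb X (\<lambda>m. x (n m)) l)"
        by (simp add: mult.assoc)
    qed
    moreover have "a m m = (1/4) ^ \<kappa> m * (\<Sum>j\<in>set (ns m). \<bar>z (n m) j\<bar>)" for m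
      by (simp add: a_def sum_distrib_left mult.assoc sgn_mult_self_eq abs_sgn[symmetric] mult.commute[of "sgn _"])
    ultimately show False
      by (elim not_null_bounded_below[of _ \<epsilon>]) (use n(4) \<epsilon> in \<open>force intro: order_trans[OF _ abs_ge_self]\<close>)+
  qed
qed

section \<open>Small convex combinations on well-founded families\<close>

text \<open>Ptak's lemma. Its conclusion is required in every convex set of probability vectors with
  members supported arbitrarily far out, because in this form it passes to finite
  unions of families, which the induction along the tree needs.\<close>

definition prob_vec :: "(nat \<Rightarrow> real) \<Rightarrow> bool" where
  "prob_vec b \<longleftrightarrow> (\<forall>n. 0 \<le> b n) \<and> finite {n. b n \<noteq> 0} \<and> (\<Sum>n | b n \<noteq> 0. b n) = 1"

definition rich :: "(nat \<Rightarrow> real) set \<Rightarrow> bool" where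
  "rich K \<longleftrightarrow> (\<forall>b\<in>K. prob_vec b) \<and>
     (\<forall>b\<in>K. \<forall>b'\<in>K. \<forall>t\<in>{0..1}. (\<lambda>n. t * b n + (1 - t) * b' n) \<in> K) \<and>
     (\<forall>m. \<exists>b\<in>K. \<forall>n<m. b n = 0)"

definition small_on :: "(nat list \<Rightarrow> bool) \<Rightarrow> real \<Rightarrow> (nat \<Rightarrow> real) \<Rightarrow> bool" where
  "small_on P \<epsilon> b \<longleftrightarrow> (\<forall>ns. sorted_wrt (<) ns \<and> P ns \<longrightarrow> (\<Sum>n\<in>set ns. b n) \<le> \<epsilon>)"

definition good :: "(nat list \<Rightarrow> bool) \<Rightarrow> bool" where
  "good P \<longleftrightarrow> (\<forall>K \<epsilon>. rich K \<and> 0 < \<epsilon> \<longrightarrow> (\<exists>b\<in>K. small_on P \<epsilon> b))"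

lemma prob_vec_sum_le:
  assumes "prob_vec b" "finite A"
  shows "(\<Sum>n\<in>A. b n) \<le> 1"
proof -
  have "(\<Sum>n\<in>A. b n) = (\<Sum>n\<in>A \<inter> {n. b n \<noteq> 0}. b n)"
    using assms(2) by (intro sum.mono_neutral_right) auto
  also have "\<dots> \<le> (\<Sum>n | b n \<noteq> 0. b n)"
    using assms by (intro sum_mono2) (auto simp: prob_vec_def)
  finally show ?thesis using assms(1) by (simp add: prob_vec_def)
qed

lemma rich_tail:
  assumes "rich K" shows "rich {b \<in> K. \<forall>n<m. b n = 0}"
  unfolding rich_def
proof (intro conjI ballI allI)
  fix m'
  obtain b where "b \<in> K" "\<forall>n<max m m'. b n = 0" using assms unfolding rich_def by blast
  then show "\<exists>b\<in>{b \<in> K. \<forall>n<m. b n = 0}. \<forall>n<m'. b n = 0" by (intro bexI[of _ b]) auto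
qed (use assms in \<open>auto simp: rich_def\<close>)

text \<open>Smallness is a convex condition, and goodness applied to the tails of \<open>K\<close>
  supplies small members arbitrarily far out. So a second family can be treated inside the vectors
  that are small on the first.\<close>

lemma rich_small:
  assumes K: "rich K" and P: "good P" and \<epsilon>: "0 < \<epsilon>"
  shows "rich {b \<in> K. small_on P \<epsilon> b}"
  unfolding rich_def
proof (intro conjI ballI allI)
  fix b b' :: "nat \<Rightarrow> real" and t :: real
  assume b: "b \<in> {b \<in> K. small_on P \<epsilon> b}" "b' \<in> {b \<in> K. small_on P \<epsilon> b}" and t: "t \<in> {0..1}"
  have "small_on P \<epsilon> (\<lambda>n. t * b n + (1 - t) * b' n)"
    unfolding small_on_def
  proof (intro allI impI)
    fix ns assume ns: "sorted_wrt (<) ns \<and> P ns"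
    have "(\<Sum>n\<in>set ns. t * b n + (1 - t) * b' n) = t * (\<Sum>n\<in>set ns. b n) + (1 - t) * (\<Sum>n\<in>set ns. b' n)"
      by (simp add: sum.distrib sum_distrib_left)
    also have "\<dots> \<le> \<epsilon>"
      using b t ns by (intro convex_bound_le) (auto simp: small_on_def)
    finally show "(\<Sum>n\<in>set ns. t * b n + (1 - t) * b' n) \<le> \<epsilon>" .
  qed
  then show "(\<lambda>n. t * b n + (1 - t) * b' n) \<in> {b \<in> K. small_on P \<epsilon> b}"
    using K b t unfolding rich_def by auto
next
  fix m
  show "\<exists>b\<in>{b \<in> K. small_on P \<epsilon> b}. \<forall>n<m. b n = 0"
    using P rich_tail[OF K, of m] \<epsilon> unfolding good_def by blast
qed (use K in \<open>auto simp: rich_def\<close>)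

lemma small_on_disj: "small_on P \<epsilon> b \<Longrightarrow> small_on Q \<epsilon> b \<Longrightarrow> small_on (\<lambda>ns. P ns \<or> Q ns) \<epsilon> b"
  by (auto simp: small_on_def)

lemma good_disj:
  assumes P: "good P" and Q: "good Q" shows "good (\<lambda>ns. P ns \<or> Q ns)"
  unfolding good_def
proof (intro allI impI)
  fix K and \<epsilon> :: real assume "rich K \<and> 0 < \<epsilon>"
  then obtain b where "b \<in> K" "small_on P \<epsilon> b" "small_on Q \<epsilon> b"
    using rich_small[OF _ P, of K \<epsilon>] Q unfolding good_def by blast
  then show "\<exists>b\<in>K. small_on (\<lambda>ns. P ns \<or> Q ns) \<epsilon> b" by (auto intro: small_on_disj)
qed

lemma good_finite_union:
  assumes "\<And>i::nat. good (P i)" shows "good (\<lambda>ns. \<exists>i\<le>m. P i ns)"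
proof (induction m)
  case 0 then show ?case using assms by simp
next
  case (Suc m)
  have "(\<lambda>ns. \<exists>i\<le>Suc m. P i ns) = (\<lambda>ns. (\<exists>i\<le>m. P i ns) \<or> P (Suc m) ns)"
    by (auto simp: le_Suc_eq)
  then show ?case using good_disj[OF Suc assms[of "Suc m"]] by simp
qed

lemma rich_average:
  assumes K: "rich K" and a: "\<And>i. a i \<in> K"
  shows "(\<lambda>n. (\<Sum>i<Suc N. a i n) / real (Suc N)) \<in> K"
proof (induction N)
  case 0 then show ?case using a by simp
next
  case (Suc N)
  define t where "t = real (Suc N) / real (Suc (Suc N))"
  have conv: "(\<lambda>n. t * b n + (1 - t) * b' n) \<in> K" if "b \<in> K" "b' \<in> K" "t \<in> {0..1}" for b b' t
    using K that unfolding rich_def by auto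
  have t: "t \<in> {0..1}" "1 - t = 1 / real (Suc (Suc N))" by (auto simp: t_def field_simps)
  have "(\<lambda>n. t * ((\<Sum>i<Suc N. a i n) / real (Suc N)) + (1 - t) * a (Suc N) n) \<in> K"
    by (rule conv[OF Suc a t(1)])
  moreover have "t * ((\<Sum>i<Suc N. a i n) / real (Suc N)) + (1 - t) * a (Suc N) n = (\<Sum>i<Suc (Suc N). a i n) / real (Suc (Suc N))" for n
    unfolding t(2) sum.lessThan_Suc[of _ "Suc N"] add_divide_distrib by (simp add: t_def del: sum.lessThan_Suc)
  ultimately show ?case by (simp only:)
qed

text \<open>Average many vectors with successive supports, each small on the families of the
  children up to the end of the preceding support. A list starting with \<open>n\<close> belongs to
  a child \<open>j \<le> n\<close>: vectors ending at or before \<open>n\<close> vanish on it, the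
  first one reaching beyond \<open>n\<close> contributes at most 1, and all later ones are small
  since \<open>j\<close> is among the children they were chosen for.\<close>

lemma good_node:
  assumes child: "\<And>j. good (fam T (t @ [j]))"
  shows "good (fam T t)"
  unfolding good_def
proof (intro allI impI, elim conjE)
  fix K and \<epsilon> :: real assume K: "rich K" and \<epsilon>: "0 < \<epsilon>"
  define Q where "Q m ns \<longleftrightarrow> (\<exists>j\<le>m. fam T (t @ [j]) ns)" for m :: nat and ns
  have Q: "good (Q m)" for m
    unfolding Q_def by (rule good_finite_union[OF child])
  have ex_bound: "\<exists>m'\<ge>m. \<forall>n\<ge>m'. b n = 0" if b: "b \<in> K" for b and m :: nat
  proof -
    have "finite {n. b n \<noteq> 0}" using K b by (auto simp: rich_def prob_vec_def)
    then obtain B where "\<forall>n\<in>{n. b n \<noteq> 0}. n < B" using finite_nat_set_iff_bounded by blast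
    then show ?thesis by (intro exI[of _ "max m B"]) force
  qed
  \<comment> \<open>\<open>snd (p i)\<close> bounds the support of the \<open>i\<close>-th vector
    and at the same time the children taken into account for the next one.\<close>
  have "\<exists>p. \<forall>i. (fst (p i) \<in> K \<and> (\<forall>n\<ge>snd (p i). fst (p i) n = 0)) \<and>
     (snd (p i) \<le> snd (p (Suc i)) \<and> (\<forall>n<snd (p i). fst (p (Suc i)) n = 0) \<and> small_on (Q (snd (p i))) (\<epsilon> / 2) (fst (p (Suc i))))"
  proof (rule dependent_nat_choice)
    obtain b where b: "b \<in> K" using K unfolding rich_def by blast
    obtain m' where "\<forall>n\<ge>m'. b n = 0" using ex_bound[OF b] by blast
    with b show "\<exists>p. fst p \<in> K \<and> (\<forall>n\<ge>snd p. fst p n = 0)"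
      by (intro exI[of _ "(b, m')"]) simp
  next
    fix p :: "(nat \<Rightarrow> real) \<times> nat" and i :: nat
    obtain b where b: "b \<in> K" "\<forall>n<snd p. b n = 0" "small_on (Q (snd p)) (\<epsilon> / 2) b"
      using Q[of "snd p", unfolded good_def, rule_format, of "{b \<in> K. \<forall>n<snd p. b n = 0}" "\<epsilon> / 2"]
        rich_tail[OF K, of "snd p"] \<epsilon> by auto
    obtain m' where "m' \<ge> snd p" "\<forall>n\<ge>m'. b n = 0" using ex_bound[OF b(1)] by blast
    then show "\<exists>p'. (fst p' \<in> K \<and> (\<forall>n\<ge>snd p'. fst p' n = 0)) \<and>
      (snd p \<le> snd p' \<and> (\<forall>n<snd p. fst p' n = 0) \<and> small_on (Q (snd p)) (\<epsilon> / 2) (fst p'))"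
      using b by (intro exI[of _ "(b, m')"]) auto
  qed
  then obtain p where p: "\<forall>i. (fst (p i) \<in> K \<and> (\<forall>n\<ge>snd (p i). fst (p i) n = 0)) \<and>
     (snd (p i) \<le> snd (p (Suc i)) \<and> (\<forall>n<snd (p i). fst (p (Suc i)) n = 0) \<and> small_on (Q (snd (p i))) (\<epsilon> / 2) (fst (p (Suc i))))"
    by blast
  define a m where "a i = fst (p i)" and "m i = snd (p i)" for i
  have a: "a i \<in> K" "\<And>n. n \<ge> m i \<Longrightarrow> a i n = 0" "\<And>n. n < m i \<Longrightarrow> a (Suc i) n = 0"
    "small_on (Q (m i)) (\<epsilon> / 2) (a (Suc i))" "m i \<le> m (Suc i)" for i
    using p by (auto simp: a_def m_def)
  have mono: "i \<le> i' \<Longrightarrow> m i \<le> m i'" for i i'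
    using a(5) by (rule lift_Suc_mono_le)
  have pv: "prob_vec (a i)" for i using a(1) K by (auto simp: rich_def)
  obtain N where N: "1 / real (Suc N) < \<epsilon> / 2"
    using nat_approx_posE[of "\<epsilon> / 2"] \<epsilon> by auto
  define b where "b n = (\<Sum>i<Suc N. a i n) / real (Suc N)" for n
  have "b \<in> K" unfolding b_def by (rule rich_average[OF K a(1)])
  moreover have "small_on (fam T t) \<epsilon> b"
    unfolding small_on_def
  proof (intro allI impI, elim conjE)
    fix ns assume sorted: "sorted_wrt (<) ns" and f: "fam T t ns"
    show "(\<Sum>n\<in>set ns. b n) \<le> \<epsilon>"
    proof (cases ns)
      case Nil then show ?thesis using \<epsilon> by simp
    next
      case (Cons n ns')
      then obtain j where j: "j \<le> n" "fam T (t @ [j]) ns'" using f by auto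
      have gt: "n < n'" if "n' \<in> set ns'" for n' using sorted Cons that by simp
      have sorted': "sorted_wrt (<) ns'" using sorted Cons by simp
      \<comment> \<open>The one vector without a useful estimate. It costs 1 in the sum, hence less
        than \<open>\<epsilon> / 2\<close> in the average. If no vector reaches beyond
        \<open>n\<close>, the value of \<open>i0\<close> is irrelevant.\<close>
      define i0 where "i0 = (LEAST i. n < m i)"
      have le: "(\<Sum>n\<in>set ns. a i n) \<le> \<epsilon> / 2 + (if i = i0 then 1 else 0)" for i
      proof (cases "n < m i")
        case False
        have "a i n' = 0" if "n' \<in> set ns" for n'
          using a(2)[of i n'] False gt[of n'] that Cons by auto
        then show ?thesis using \<epsilon> by simp
      next
        case True
        show ?thesis
        proof (cases "i = i0")
          case True
          then show ?thesis using prob_vec_sum_le[OF pv, of "set ns" i] \<epsilon> by simp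
        next
          case False
          have i0: "n < m i0" "i0 \<le> i" unfolding i0_def using True by (auto intro: LeastI Least_le)
          with False obtain i' where i': "i = Suc i'" "i0 \<le> i'" by (cases i) auto
          have n: "n < m i'" using i0(1) mono[OF i'(2)] by simp
          then have "a i n = 0" using a(3) i' by simp
          moreover have "n \<notin> set ns'" using gt by blast
          ultimately have "(\<Sum>n\<in>set ns. a i n) = (\<Sum>n\<in>set ns'. a i n)" using Cons by simp
          also have "\<dots> \<le> \<epsilon> / 2"
            using a(4)[of i'] sorted' j n i' unfolding small_on_def Q_def by (meson le_trans less_imp_le)
          finally show ?thesis using False by simp
        qed
      qed
      have "(\<Sum>n\<in>set ns. b n) = (\<Sum>i<Suc N. \<Sum>n\<in>set ns. a i n) / real (Suc N)"
        unfolding b_def sum_divide_distrib[symmetric] by (subst sum.swap) simp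
      also have "\<dots> \<le> (\<Sum>i<Suc N. \<epsilon> / 2 + (if i = i0 then 1 else 0)) / real (Suc N)"
        by (intro divide_right_mono sum_mono le) auto
      also have "(\<Sum>i<Suc N. \<epsilon> / 2 + (if i = i0 then 1 else 0)) \<le> real (Suc N) * (\<epsilon> / 2) + 1"
        by (subst sum.distrib) (simp add: sum.delta del: sum.lessThan_Suc)
      then have "(\<Sum>i<Suc N. \<epsilon> / 2 + (if i = i0 then 1 else 0)) / real (Suc N) \<le> (real (Suc N) * (\<epsilon> / 2) + 1) / real (Suc N)"
        by (intro divide_right_mono) auto
      also have "\<dots> = \<epsilon> / 2 + 1 / real (Suc N)" by (simp add: field_simps)
      also have "\<dots> \<le> \<epsilon>" using N by simp
      finally show ?thesis .
    qed
  qed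
  ultimately show "\<exists>b\<in>K. small_on (fam T t) \<epsilon> b" by blast
qed

text \<open>Induction along the tree in contrapositive form: a bad node has a bad child, and
  following bad children gives a branch. A bad node belongs to \<open>T\<close>, since outside
  \<open>T\<close> its family is empty and every vector is small on it.\<close>

lemma good_wellfounded:
  assumes "\<not> has_branch T" shows "good (fam T [])"
proof (rule ccontr)
  assume not: "\<not> good (fam T [])"
  have "\<exists>t. \<forall>n. (\<not> good (fam T (t n)) \<and> length (t n) = n) \<and> (\<exists>j. t (Suc n) = t n @ [j])"
  proof (rule dependent_nat_choice)
    show "\<exists>t. \<not> good (fam T t) \<and> length t = 0" using not by auto
    show "\<exists>t'. (\<not> good (fam T t') \<and> length t' = Suc n) \<and> (\<exists>j. t' = t @ [j])"
      if "\<not> good (fam T t) \<and> length t = n" for t n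
      using good_node[of T t] that by force
  qed
  then obtain t where t: "\<And>n. \<not> good (fam T (t n))" "\<And>n. length (t n) = n" "\<And>n. \<exists>j. t (Suc n) = t n @ [j]"
    by blast
  from t(3) have "\<forall>n. \<exists>j. t (Suc n) = t n @ [j]" by blast
  from choice[OF this] obtain \<beta> where \<beta>: "\<And>n. t (Suc n) = t n @ [\<beta> n]" by blast
  have "map \<beta> [0..<n] = t n" for n
    using t(2)[of 0] by (induction n) (auto simp: \<beta>)
  moreover have "t n \<in> T" for n
  proof (rule ccontr)
    assume "t n \<notin> T"
    then have "\<not> fam T (t n) ns" for ns using fam_mem by blast
    then have "good (fam T (t n))"
      unfolding good_def small_on_def rich_def by blast
    then show False using t(1) by blast
  qed
  ultimately have "map \<beta> [0..<n] \<in> T" for n by (simp only:)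
  then show False using assms unfolding has_branch_def by blast
qed

lemma fam_length: "fam {t. length t \<le> m} t ns \<longleftrightarrow> length t + length ns \<le> m"
proof (induction ns arbitrary: t)
  case (Cons n ns)
  show ?case by (auto simp: Cons)
qed simp

text \<open>The lists of length at most \<open>m\<close> themselves form a tree without branches,
  and its family consists of the sets of at most \<open>m\<close> elements; so cardinality bounds
  are a special case.\<close>

lemma good_length: "good (\<lambda>ns. length ns \<le> m)"
proof -
  have "\<not> has_branch {t. length t \<le> m}"
    unfolding has_branch_def by (auto intro!: exI[of _ "Suc m"])
  moreover have "fam {t. length t \<le> m} [] = (\<lambda>ns. length ns \<le> m)"
    by (intro ext) (simp add: fam_length)
  ultimately show ?thesis using good_wellfounded by force
qed

text \<open>The hypothesis \<open>bound\<close> is the upper estimate of the norm by admissible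
  sets. If a functional stays large on infinitely many unit vectors, Ptak's lemma on those indices
  gives a convex combination, with signs, of small norm on which the functional is still
  large.\<close>

lemma weakly_null_basis:
  fixes e :: "nat \<Rightarrow> 'v::real_normed_vector"
  assumes T: "\<not> has_branch T" and Z: "subspace Z" and e: "\<And>n. e n \<in> Z"
    and bound: "\<And>S c B. finite S \<Longrightarrow> 0 \<le> B \<Longrightarrow>
       (\<And>\<kappa> ns. adm T \<kappa> ns \<Longrightarrow> (1/2) ^ \<kappa> * (\<Sum>n\<in>set ns \<inter> S. \<bar>c n\<bar>) \<le> B) \<Longrightarrow>
       norm (\<Sum>n\<in>S. c n *\<^sub>R e n) \<le> B"
  shows "weakly_null (subspace_nspace Z) e"
  unfolding weakly_null_def
proof (intro conjI allI ballI)
  show "e n \<in> vcarrier (subspace_nspace Z)" for n using e by simp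
  interpret normed_space "subspace_nspace Z" by (rule normed_space_subspace[OF Z])
  fix f assume f: "f \<in> vcarrier (dual_nspace (subspace_nspace Z))"
  then have "\<exists>C. \<forall>x\<in>Z. \<bar>f x\<bar> \<le> C * norm x"
    unfolding dual_iff by auto
  then obtain C where C: "\<And>x. x \<in> Z \<Longrightarrow> \<bar>f x\<bar> \<le> C * norm x"
    by blast
  have fadd: "f (x + y) = f x + f y" if "x \<in> Z" "y \<in> Z" for x y
    using f that unfolding dual_iff by auto
  have fsc: "f (c *\<^sub>R x) = c * f x" if "x \<in> Z" for c x
    using f that unfolding dual_iff by auto
  show "(\<lambda>n. f (e n)) \<longlonglongrightarrow> 0"
  proof (rule ccontr)
    assume "\<not> (\<lambda>n. f (e n)) \<longlonglongrightarrow> 0"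
    then obtain \<delta> where \<delta>: "\<delta> > 0" and ex: "\<And>N. \<exists>n\<ge>N. \<bar>f (e n)\<bar> \<ge> \<delta>"
      unfolding LIMSEQ_iff by (auto simp: not_less)
    define K where "K = {b. prob_vec b \<and> (\<forall>n. b n \<noteq> 0 \<longrightarrow> \<delta> \<le> \<bar>f (e n)\<bar>)}"
    have rich: "rich K"
      unfolding rich_def
    proof (intro conjI ballI allI)
      show "prob_vec b" if "b \<in> K" for b using that by (simp add: K_def)
    next
      fix b b' and t :: real assume b: "b \<in> K" "b' \<in> K" and t: "t \<in> {0..1}"
      let ?S = "{n. b n \<noteq> 0} \<union> {n. b' n \<noteq> 0}" and ?c = "\<lambda>n. t * b n + (1 - t) * b' n"
      have S: "finite ?S" using b by (auto simp: K_def prob_vec_def)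
      have "(\<Sum>n | ?c n \<noteq> 0. ?c n) = (\<Sum>n\<in>?S. ?c n)"
        by (rule sum.mono_neutral_left[OF S]) auto
      also have "\<dots> = t * (\<Sum>n\<in>?S. b n) + (1 - t) * (\<Sum>n\<in>?S. b' n)"
        by (simp add: sum.distrib sum_distrib_left)
      also have "(\<Sum>n\<in>?S. b n) = (\<Sum>n | b n \<noteq> 0. b n)"
        by (rule sum.mono_neutral_right[OF S]) auto
      also have "(\<Sum>n\<in>?S. b' n) = (\<Sum>n | b' n \<noteq> 0. b' n)"
        by (rule sum.mono_neutral_right[OF S]) auto
      finally have "(\<Sum>n | ?c n \<noteq> 0. ?c n) = 1"
        using b by (simp add: K_def prob_vec_def)
      moreover have "finite {n. ?c n \<noteq> 0}"
        by (rule finite_subset[OF _ S]) auto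
      moreover have "\<delta> \<le> \<bar>f (e n)\<bar>" if "?c n \<noteq> 0" for n
        using b that by (cases "b n = 0") (auto simp: K_def)
      ultimately show "?c \<in> K"
        using b t by (auto simp: K_def prob_vec_def simp del: not_gr_zero)
    next
      fix m
      obtain n where n: "n \<ge> m" "\<bar>f (e n)\<bar> \<ge> \<delta>" using ex by blast
      have "(\<lambda>i. if i = n then 1 else 0) \<in> K"
        using n by (auto simp: K_def prob_vec_def)
      then show "\<exists>b\<in>K. \<forall>n<m. b n = 0"
        using n(1) by (intro bexI[of _ "\<lambda>i. if i = n then 1 else 0"]) auto
    qed
    define C' where "C' = max C 1"
    have C': "C' > 0" by (simp add: C'_def)
    have C'_bound: "\<bar>f x\<bar> \<le> C' * norm x" if "x \<in> Z" for x
      using order_trans[OF C[OF that] mult_right_mono[of C C' "norm x"]] by (simp add: C'_def)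
    \<comment> \<open>A vector of norm at most \<open>\<eta>\<close> has value at most
      \<open>\<delta> / 2\<close>, against at least \<open>\<delta>\<close> for the signed convex
      combination.\<close>
    define \<eta> where "\<eta> = \<delta> / (2 * C')"
    have \<eta>: "\<eta> > 0" using \<delta> C' by (simp add: \<eta>_def)
    \<comment> \<open>Indices beyond \<open>k\<close> are harmless by their weight alone; those up
      to \<open>k\<close> are covered by the family of \<open>T\<close> and the single cardinality
      bound \<open>16 ^ k\<close>.\<close>
    obtain k where k: "(1/2::real) ^ k < \<eta>" using real_arch_pow_inv[OF \<eta>, of "1/2"] by auto
    obtain b where b: "b \<in> K" and small: "small_on (\<lambda>ns. fam T [] ns \<or> length ns \<le> 16 ^ k) \<eta> b"
      using good_disj[OF good_wellfounded[OF T] good_length[of "16 ^ k"]] rich \<eta> unfolding good_def by blast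
    have pv: "prob_vec b" using b by (simp add: K_def)
    define S where "S = {n. b n \<noteq> 0}"
    have S: "finite S" "(\<Sum>n\<in>S. b n) = 1" "\<And>n. 0 \<le> b n" using pv by (auto simp: S_def prob_vec_def)
    define c where "c n = sgn (f (e n)) * b n" for n
    have sumZ: "(\<Sum>n\<in>F. c n *\<^sub>R e n) \<in> Z" "f (\<Sum>n\<in>F. c n *\<^sub>R e n) = (\<Sum>n\<in>F. c n * f (e n))" if "finite F" for F
    proof -
      show Zs: "(\<Sum>n\<in>F. c n *\<^sub>R e n) \<in> Z" for F
        using e Z by (intro subspace_sum subspace_scale) auto
      have f0: "f 0 = 0" using fsc[of 0 0] subspace_0[OF Z] by simp
      show "f (\<Sum>n\<in>F. c n *\<^sub>R e n) = (\<Sum>n\<in>F. c n * f (e n))"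
        using that e Z f0
        by (induction F rule: finite_induct) (auto simp: fadd fsc subspace_scale Zs)
    qed
    have "norm (\<Sum>n\<in>S. c n *\<^sub>R e n) \<le> \<eta>"
    proof (rule bound[OF S(1)])
      show "0 \<le> \<eta>" using \<eta> by simp
      fix \<kappa> ns assume ns: "adm T \<kappa> ns"
      have "(\<Sum>n\<in>set ns \<inter> S. \<bar>c n\<bar>) \<le> (\<Sum>n\<in>set ns \<inter> S. b n)"
        using S(3) by (intro sum_mono) (auto simp: c_def abs_mult sgn_real_def)
      also have "\<dots> \<le> (\<Sum>n\<in>set ns. b n)"
        using S(3) by (intro sum_mono2) auto
      finally have le: "(\<Sum>n\<in>set ns \<inter> S. \<bar>c n\<bar>) \<le> (\<Sum>n\<in>set ns. b n)" .
      have le1: "(1/2::real) ^ \<kappa> * (\<Sum>n\<in>set ns \<inter> S. \<bar>c n\<bar>) \<le> (1/2) ^ \<kappa> * (\<Sum>n\<in>set ns. b n)"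
        by (rule mult_left_mono[OF le]) simp
      show "(1/2::real) ^ \<kappa> * (\<Sum>n\<in>set ns \<inter> S. \<bar>c n\<bar>) \<le> \<eta>"
      proof (cases "\<kappa> \<le> k")
        case True
        have "fam T [] ns \<or> length ns \<le> 16 ^ k"
        proof (cases "\<kappa> = 0")
          case False
          have "length ns \<le> 16 ^ \<kappa>" using ns False by (simp add: adm_def)
          also have "\<dots> \<le> 16 ^ k" using True by (rule power_increasing) simp
          finally show ?thesis ..
        qed (use ns in \<open>simp add: adm_def\<close>)
        then have "(\<Sum>n\<in>set ns. b n) \<le> \<eta>"
          using small ns unfolding small_on_def adm_def by blast
        moreover have "(1/2::real) ^ \<kappa> * (\<Sum>n\<in>set ns. b n) \<le> 1 * (\<Sum>n\<in>set ns. b n)"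
          using S(3) by (intro mult_right_mono) (auto simp: power_le_one sum_nonneg)
        ultimately show ?thesis using le1 by linarith
      next
        case False
        have "(1/2::real) ^ \<kappa> * (\<Sum>n\<in>set ns. b n) \<le> (1/2) ^ k * 1"
          using False S(3) prob_vec_sum_le[OF pv, of "set ns"]
          by (intro mult_mono power_decreasing) (auto simp: sum_nonneg)
        then show ?thesis using le1 k by linarith
      qed
    qed
    then have "\<bar>f (\<Sum>n\<in>S. c n *\<^sub>R e n)\<bar> \<le> C' * \<eta>"
      using C'_bound[OF sumZ(1)[OF S(1)]] mult_left_mono[of "norm (\<Sum>n\<in>S. c n *\<^sub>R e n)" \<eta> C'] C' by linarith
    moreover have "\<delta> \<le> f (\<Sum>n\<in>S. c n *\<^sub>R e n)"
    proof -
      have "\<delta> = (\<Sum>n\<in>S. b n * \<delta>)" using S(2) by (simp flip: sum_distrib_right)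
      also have "\<dots> \<le> (\<Sum>n\<in>S. b n * \<bar>f (e n)\<bar>)"
        using b S(3) by (intro sum_mono mult_left_mono) (auto simp: S_def K_def)
      also have "\<dots> = (\<Sum>n\<in>S. c n * f (e n))"
        by (intro sum.cong) (auto simp: c_def abs_sgn mult_ac)
      finally show ?thesis using sumZ(2)[OF S(1)] by simp
    qed
    ultimately show False using \<delta> C' by (simp add: \<eta>_def)
  qed
qed

section \<open>The operators attached to trees\<close>

definition sg :: "(nat \<Rightarrow> bool) \<Rightarrow> nat \<Rightarrow> real" where
  "sg x i = (if x (3 * i) then if x (3 * i + 1) then 1 else -1 else 0)"

definition kap :: "(nat \<Rightarrow> bool) \<Rightarrow> nat" where
  "kap x = (LEAST j. x (3 * j + 2))"

definition supp :: "(nat \<Rightarrow> bool) \<Rightarrow> nat \<Rightarrow> nat list" where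
  "supp x i = filter (\<lambda>j. x (3 * j) \<and> kap x \<le> Suc j) [0..<Suc i]"

text \<open>Three interleaved bit streams of a point \<open>x\<close> of the Cantor set encode a functional on finitely
  supported sequences: a support, signs on it, and in unary a number \<open>kap x\<close>. The support is cut off
  as soon as it leaves the family admissible for \<open>kap x\<close>; because of the condition on \<open>j\<close>,
  the \<open>i\<close>-th coefficient depends on finitely many bits only.\<close>

definition theta :: "nat list set \<Rightarrow> nat \<Rightarrow> (nat \<Rightarrow> bool) \<Rightarrow> real" where
  "theta T i x = (if (\<exists>j\<le>Suc i. x (3 * j + 2)) \<and> adm T (kap x) (supp x i)
     then (1/2) ^ kap x * sg x i else 0)"

text \<open>The value 0 at points without a unary bit is the limit of the values
  \<open>(1/2) ^ kap x\<close>, as continuity requires.\<close>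

definition weight :: "(nat \<Rightarrow> bool) \<Rightarrow> real" where
  "weight x = (if (\<exists>j. x (3 * j + 2)) \<and> kap x \<noteq> 0 then (1/2) ^ kap x else 0)"

lemma continuous_on_cylinder:
  fixes g :: "(nat \<Rightarrow> bool) \<Rightarrow> 'b::topological_space"
  assumes "\<And>x y. (\<And>n. n < N \<Longrightarrow> x n = y n) \<Longrightarrow> g x = g y"
  shows "continuous_on UNIV g"
proof -
  have near: "\<forall>\<^sub>F y in nhds x. g y = g x" for x
  proof -
    have "\<forall>\<^sub>F y in nhds x. \<forall>n\<in>{..<N}. y n = x n"
    proof (intro eventually_ball_finite ballI)
      fix n
      have "open ((\<lambda>y::nat \<Rightarrow> bool. y n) -` {x n})"
        by (intro open_vimage open_discrete continuous_on_product_coordinates)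
      then show "\<forall>\<^sub>F y in nhds x. y n = x n"
        unfolding eventually_nhds by (intro exI[of _ "(\<lambda>y. y n) -` {x n}"]) auto
    qed simp
    then show ?thesis
      by (rule eventually_mono) (auto intro: assms)
  qed
  have "(g \<longlongrightarrow> g x) (at x)" for x
  proof (rule tendsto_eventually)
    show "\<forall>\<^sub>F y in at x. g y = g x"
      unfolding eventually_at_filter by (rule eventually_mono[OF near]) simp
  qed
  then show ?thesis by (simp add: continuous_on_def)
qed

lemma kap_eq:
  assumes "x (3 * j + 2)" "j \<le> m" "\<And>n. n < 3 * m + 3 \<Longrightarrow> x n = y n"
  shows "kap x = kap y"
  unfolding kap_def
proof (rule Least_equality[symmetric])
  let ?l = "LEAST j. x (3 * j + 2)"
  have l: "x (3 * ?l + 2)" "?l \<le> j"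
    using assms(1) by (auto intro: LeastI Least_le)
  then show "y (3 * ?l + 2)"
    using assms(2) assms(3)[of "3 * ?l + 2"] by simp
  show "?l \<le> i" if "y (3 * i + 2)" for i
  proof (cases "i \<le> m")
    case True
    then show ?thesis using that assms(3)[of "3 * i + 2"] by (auto intro: Least_le)
  qed (use l assms(2) in simp)
qed

lemma kap_le: "x (3 * j + 2) \<Longrightarrow> kap x \<le> j"
  unfolding kap_def by (rule Least_le)

text \<open>The last bit inspected is the unary bit number \<open>Suc i\<close>, at place
  \<open>3 * Suc i + 2 = 3 * i + 5\<close>. If no unary bit is set up to there, the coefficient is 0
  in any case.\<close>

lemma theta_cylinder:
  assumes "\<And>n. n < 3 * i + 6 \<Longrightarrow> x n = y n"
  shows "theta T i x = theta T i y"
proof (cases "\<exists>j\<le>Suc i. x (3 * j + 2)")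
  case True
  then obtain j where j: "j \<le> Suc i" "x (3 * j + 2)" by blast
  have k: "kap x = kap y" by (rule kap_eq[where j = j and m = "Suc i"]) (use j assms in auto)
  have "supp x i = supp y i"
    unfolding supp_def k by (intro filter_cong) (auto simp: assms)
  moreover have "y (3 * j + 2)" using j assms[of "3 * j + 2"] by simp
  moreover have "sg x i = sg y i" by (simp add: sg_def assms)
  ultimately show ?thesis using j by (auto simp: theta_def k)
next
  case False
  moreover have "\<not> (\<exists>j\<le>Suc i. y (3 * j + 2))"
  proof
    assume "\<exists>j\<le>Suc i. y (3 * j + 2)"
    then obtain j where "j \<le> Suc i" "y (3 * j + 2)" by blast
    then show False using False assms[of "3 * j + 2"] by auto
  qed
  ultimately show ?thesis by (auto simp: theta_def)
qed

lemma abs_theta_le: "\<bar>theta T i x\<bar> \<le> (1/2) ^ kap x"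
  by (auto simp: theta_def sg_def abs_mult)

lemma theta_nonzero:
  assumes "theta T i x \<noteq> 0"
  shows "adm T (kap x) (supp x i)" "x (3 * i)" "kap x \<le> Suc i"
  using assms kap_le[of x] by (auto simp: theta_def sg_def split: if_splits intro: order_trans)

text \<open>A nonzero coefficient certifies that the support up to its index is admissible, so the
  largest index of \<open>A\<close> takes care of the whole of \<open>A\<close>.\<close>

lemma theta_support:
  assumes "finite A" "A \<subseteq> {i. theta T i x \<noteq> 0}" "A \<noteq> {}"
  obtains ns where "adm T (kap x) ns" "A \<subseteq> set ns"
proof -
  have "Max A \<in> A" using assms Max_in by blast
  then have "adm T (kap x) (supp x (Max A))" using assms(2) theta_nonzero by blast
  moreover have "A \<subseteq> set (supp x (Max A))"
  proof
    fix i assume i: "i \<in> A"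
    then have "i \<le> Max A" "theta T i x \<noteq> 0" using assms by auto
    then show "i \<in> set (supp x (Max A))"
      using theta_nonzero(2,3)[of T i x] by (simp add: supp_def del: upt_Suc)
  qed
  ultimately show ?thesis using that by blast
qed

definition thetaC :: "nat list set \<Rightarrow> nat \<Rightarrow> cantor_fun" where
  "thetaC T i = Bcontfun (theta T i)"

lemma apply_thetaC [simp]: "apply_bcontfun (thetaC T i) = theta T i"
proof -
  have "\<bar>theta T i x\<bar> \<le> 1" for x
    using abs_theta_le[of T i x] power_le_one[of "1/2::real" "kap x"] by simp
  moreover have "continuous_on UNIV (theta T i)"
    by (rule continuous_on_cylinder[of "3 * i + 6"]) (rule theta_cylinder)
  ultimately have "theta T i \<in> bcontfun"
    by (intro bcontfun_normI[of _ 1]) auto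
  then show ?thesis by (simp add: thetaC_def Bcontfun_inverse)
qed

lemma weight_le: "0 \<le> weight x" "weight x \<le> 1/2"
proof -
  show "0 \<le> weight x" by (simp add: weight_def)
  have "(1/2::real) ^ k \<le> 1/2" if "k \<noteq> 0" for k
    using power_decreasing[of 1 k "1/2::real"] that by simp
  then show "weight x \<le> 1/2" by (simp add: weight_def)
qed

text \<open>Truncations that look at the first \<open>N\<close> unary bits are locally constant.
  Where they differ from \<open>weight\<close>, no such bit is set, so \<open>kap x \<ge> N\<close>
  and the error is at most \<open>(1/2) ^ N\<close>.\<close>

lemma continuous_on_weight: "continuous_on UNIV weight"
proof (rule uniform_limit_theorem)
  let ?w = "\<lambda>N x. if (\<exists>j<N. x (3 * j + 2)) \<and> kap x \<noteq> 0 then (1/2) ^ kap x else 0 :: real"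
  show "\<forall>\<^sub>F N in sequentially. continuous_on UNIV (?w N)"
  proof (intro always_eventually allI continuous_on_cylinder)
    fix N :: nat and x y :: "nat \<Rightarrow> bool"
    assume eq: "\<And>n. n < 3 * N + 3 \<Longrightarrow> x n = y n"
    show "?w N x = ?w N y"
    proof (cases "\<exists>j<N. x (3 * j + 2)")
      case True
      then obtain j where j: "j < N" "x (3 * j + 2)" by blast
      have "kap x = kap y" by (rule kap_eq[where j = j and m = N]) (use j eq in auto)
      moreover have "y (3 * j + 2)" using j eq[of "3 * j + 2"] by simp
      ultimately show ?thesis using j by auto
    next
      case False
      moreover have "\<not> (\<exists>j<N. y (3 * j + 2))"
      proof
        assume "\<exists>j<N. y (3 * j + 2)"
        then obtain j where "j < N" "y (3 * j + 2)" by blast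
        then show False using False eq[of "3 * j + 2"] by auto
      qed
      ultimately show ?thesis by simp
    qed
  qed
  have "\<bar>?w N x - weight x\<bar> \<le> (1/2) ^ N" for N x
  proof (cases "(\<exists>j. x (3 * j + 2)) \<and> \<not> (\<exists>j<N. x (3 * j + 2))")
    case True
    then obtain j where "x (3 * j + 2)" by blast
    then have "x (3 * kap x + 2)" unfolding kap_def by (rule LeastI)
    then have "N \<le> kap x" using True by (auto simp: not_less)
    then show ?thesis using True power_decreasing[of N "kap x" "1/2::real"] by (simp add: weight_def)
  qed (auto simp: weight_def)
  then show "uniform_limit UNIV ?w weight sequentially"
    unfolding uniform_limit_iff
  proof (intro allI impI)
    fix e :: real assume e: "e > 0"
    assume le: "\<And>N x. \<bar>?w N x - weight x\<bar> \<le> (1/2) ^ N"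
    have "\<forall>\<^sub>F N in sequentially. (1/2::real) ^ N < e"
      using order_tendstoD(2)[OF LIMSEQ_realpow_zero[of "1/2"] e] by simp
    then show "\<forall>\<^sub>F N in sequentially. \<forall>x\<in>UNIV. dist (?w N x) (weight x) < e"
    proof (rule eventually_mono, intro ballI)
      fix N :: nat and x assume "(1/2::real) ^ N < e"
      from le_less_trans[OF le this] show "dist (?w N x) (weight x) < e"
        by (simp only: dist_real_def)
    qed
  qed
qed simp

lemma apply_bcontfun_le: "\<bar>apply_bcontfun g x\<bar> \<le> norm g" for g :: cantor_fun
  using norm_bounded[of g x] by simp

text \<open>Multiplication by \<open>weight\<close> turns the coefficients \<open>2^-\<kappa>\<close> of the coded functionals into \<open>4^-\<kappa>\<close> and
  kills those with \<open>\<kappa> = 0\<close>, the only ones that depend on the tree. So it is the formal inclusion of a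
  space depending on \<open>T\<close> into a fixed one.\<close>

definition mulw :: "cantor_fun \<Rightarrow> cantor_fun" where
  "mulw g = Bcontfun (\<lambda>x. weight x * apply_bcontfun g x)"

lemma apply_mulw [simp]: "apply_bcontfun (mulw g) = (\<lambda>x. weight x * apply_bcontfun g x)"
proof -
  have "(\<lambda>x. weight x * apply_bcontfun g x) \<in> bcontfun"
  proof (rule bcontfun_normI)
    show "continuous_on UNIV (\<lambda>x. weight x * apply_bcontfun g x)"
      by (intro continuous_on_mult continuous_on_weight continuous_on_apply_bcontfun)
    show "norm (weight x * apply_bcontfun g x) \<le> 1/2 * norm g" for x
      using mult_mono[OF weight_le(2)[of x] apply_bcontfun_le[of g x]] weight_le(1)[of x]
      by (simp add: abs_mult)
  qed
  then show ?thesis by (simp add: mulw_def Bcontfun_inverse)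
qed

lemma bounded_linear_mulw: "bounded_linear mulw"
proof (rule bounded_linear_intro)
  show "mulw (g + h) = mulw g + mulw h" for g h
    by (rule bcontfun_eqI) (simp add: algebra_simps)
  show "mulw (c *\<^sub>R g) = c *\<^sub>R mulw g" for c g
    by (rule bcontfun_eqI) simp
  show "norm (mulw g) \<le> norm g * (1/2)" for g
  proof (rule norm_bound)
    show "norm (apply_bcontfun (mulw g) x) \<le> norm g * (1/2)" for x
      using mult_mono[OF weight_le(2)[of x] apply_bcontfun_le[of g x]] weight_le(1)[of x]
      by (simp add: abs_mult mult.commute)
  qed
qed

lemma bounded_linear_eval: "bounded_linear (\<lambda>g :: cantor_fun. apply_bcontfun g x)"
  by (rule bounded_linear_intro[of _ 1]) (use apply_bcontfun_le in auto)

definition treeZ :: "nat list set \<Rightarrow> cantor_fun set" where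
  "treeZ T = closure (span (range (thetaC T)))"

text \<open>The tree \<open>{}\<close> is a mere placeholder: by \<open>mulw_thetaC\<close> every
  tree gives the same generators.\<close>

definition treeW :: "cantor_fun set" where
  "treeW = closure (span (range (\<lambda>i. mulw (thetaC {} i))))"

lemma mulw_thetaC: "mulw (thetaC T i) = mulw (thetaC {} i)"
proof (rule bcontfun_eqI)
  fix x
  have "adm T k ns = adm {} k ns" if "k \<noteq> 0" for k ns using that by (simp add: adm_def)
  then show "apply_bcontfun (mulw (thetaC T i)) x = apply_bcontfun (mulw (thetaC {} i)) x"
    by (auto simp: weight_def theta_def)
qed

lemma subspace_treeZ: "subspace (treeZ T)" "closed (treeZ T)"
  unfolding treeZ_def by (auto intro!: subspace_closureI simp: span_zero span_add span_scale)

lemma subspace_treeW: "subspace treeW" "closed treeW"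
  unfolding treeW_def by (auto intro!: subspace_closureI simp: span_zero span_add span_scale)

lemma thetaC_in: "thetaC T i \<in> treeZ T"
  unfolding treeZ_def by (meson closure_subset rangeI span_base subsetD)

lemma mulw_in:
  assumes "g \<in> treeZ T" shows "mulw g \<in> treeW"
proof -
  interpret bounded_linear mulw by (rule bounded_linear_mulw)
  have "mulw ` closure (span (range (thetaC T))) \<subseteq> closure (mulw ` span (range (thetaC T)))"
    by (intro image_closure_subset closure_subset)
      (auto intro: continuous_on linear_continuous_on bounded_linear_axioms)
  also have "mulw ` span (range (thetaC T)) = span (mulw ` range (thetaC T))"
    by (rule linear_span_image[symmetric]) (rule linear_axioms)
  also have "mulw ` range (thetaC T) = range (\<lambda>i. mulw (thetaC {} i))"
    unfolding image_image by (rule image_cong[OF refl mulw_thetaC])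
  finally show ?thesis using assms by (auto simp: treeZ_def treeW_def)
qed

section \<open>Coordinates and norm estimates\<close>

lemma eq_on_closure_span:
  fixes f h :: "'a::real_normed_vector \<Rightarrow> 'b::real_normed_vector"
  assumes f: "bounded_linear f" and h: "bounded_linear h" and eq: "\<And>x. x \<in> S \<Longrightarrow> f x = h x"
    and x: "x \<in> closure (span S)"
  shows "f x = h x"
proof -
  have "closed {x. f x = h x}"
    using f h by (intro closed_Collect_eq linear_continuous_on)
  moreover have "span S \<subseteq> {x. f x = h x}"
    using linear_eq_on_span[OF bounded_linear.linear[OF f] bounded_linear.linear[OF h], of S] eq by auto
  ultimately have "closure (span S) \<subseteq> {x. f x = h x}" by (rule closure_minimal[rotated])
  then show ?thesis using x by auto
qed

text \<open>The inverse of the coding read by \<open>theta\<close>: support \<open>F\<close>, signs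
  \<open>s\<close>, and \<open>k\<close> in unary as a single bit at place \<open>k\<close> of the
  third stream.\<close>

definition point :: "nat \<Rightarrow> nat set \<Rightarrow> (nat \<Rightarrow> bool) \<Rightarrow> nat \<Rightarrow> bool" where
  "point k F s n = (if n mod 3 = 0 then n div 3 \<in> F else if n mod 3 = 1 then s (n div 3) else n div 3 = k)"

lemma point_simps [simp]:
  "point k F s (3 * j) \<longleftrightarrow> j \<in> F" "point k F s (Suc (3 * j)) \<longleftrightarrow> s j"
  "point k F s (Suc (Suc (3 * j))) \<longleftrightarrow> j = k"
proof -
  have "Suc (3 * j) mod 3 = 1" "Suc (3 * j) div 3 = j" "Suc (Suc (3 * j)) mod 3 = 2" "Suc (Suc (3 * j)) div 3 = j"
    by presburger+
  then show "point k F s (3 * j) \<longleftrightarrow> j \<in> F" "point k F s (Suc (3 * j)) \<longleftrightarrow> s j"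
    "point k F s (Suc (Suc (3 * j))) \<longleftrightarrow> j = k"
    by (simp_all add: point_def)
qed

lemma kap_point [simp]: "kap (point k F s) = k"
  by (auto simp: kap_def intro: Least_equality)

lemma weight_point: "k \<noteq> 0 \<Longrightarrow> weight (point k F s) = (1/2) ^ k"
  by (simp add: weight_def)

lemma fam_take: "fam T t ns \<Longrightarrow> fam T t (take m ns)"
proof (induction ns arbitrary: t m)
  case (Cons n ns)
  then show ?case by (cases m) auto
qed simp

lemma set_takeWhile_sorted:
  "sorted_wrt (<) ns \<Longrightarrow> set (takeWhile (\<lambda>j. j \<le> (i::nat)) ns) = {j \<in> set ns. j \<le> i}"
  by (induction ns) auto

lemma adm_take: "adm T k ns \<Longrightarrow> adm T k (take m ns)"
  by (auto simp: adm_def fam_take sorted_wrt_take dest: in_set_takeD)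

text \<open>The support cut at a member \<open>i\<close> of \<open>ns\<close> is an initial segment
  of \<open>ns\<close>. Initial segments of admissible lists are admissible, so no coefficient of an
  admissible set is suppressed.\<close>

lemma theta_point:
  assumes "adm T k ns"
  shows "theta T i (point k (set ns) s) = (if i \<in> set ns then (1/2) ^ k * (if s i then 1 else -1) else 0)"
proof (cases "i \<in> set ns")
  case True
  have sorted: "sorted_wrt (<) ns" and k: "\<And>j. j \<in> set ns \<Longrightarrow> k \<le> Suc j" using assms by (auto simp: adm_def)
  have "supp (point k (set ns) s) i = takeWhile (\<lambda>j. j \<le> i) ns"
  proof (rule sorted_distinct_set_unique)
    show "sorted (supp (point k (set ns) s) i)" "distinct (supp (point k (set ns) s) i)"
      unfolding supp_def by (intro sorted_wrt_filter sorted_upt distinct_filter distinct_upt)+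
    have "sorted_wrt (<) (takeWhile (\<lambda>j. j \<le> i) ns)"
      using sorted by (metis sorted_wrt_take takeWhile_eq_take)
    then show "sorted (takeWhile (\<lambda>j. j \<le> i) ns)" "distinct (takeWhile (\<lambda>j. j \<le> i) ns)"
      by (auto simp: strict_sorted_iff)
    show "set (supp (point k (set ns) s) i) = set (takeWhile (\<lambda>j. j \<le> i) ns)"
      using k by (auto simp: supp_def set_takeWhile_sorted[OF sorted] simp del: upt_Suc)
  qed
  then have "adm T k (supp (point k (set ns) s) i)"
    using adm_take[OF assms] by (metis takeWhile_eq_take)
  then show ?thesis
    using True k[OF True] by (auto simp: theta_def sg_def)
qed (auto simp: theta_def sg_def)

text \<open>The factor 2 undoes the weight 1/2 of the singleton, which is admissible for the index 1
  whatever the tree is.\<close>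

definition coord :: "cantor_fun \<Rightarrow> nat \<Rightarrow> real" where
  "coord g j = 2 * apply_bcontfun g (point 1 {j} (\<lambda>_. True))"

lemma bounded_linear_coord: "bounded_linear (\<lambda>g. coord g j)"
  unfolding coord_def by (rule bounded_linear_const_mult[OF bounded_linear_eval])

lemma adm_singleton: "adm T 1 [j]"
  by (simp add: adm_def)

lemma coord_thetaC: "coord (thetaC T i) j = (if i = j then 1 else 0)"
  using theta_point[OF adm_singleton[of T j], of i "\<lambda>_. True"] by (simp add: coord_def)

text \<open>For finite \<open>F\<close> both sides are bounded in \<open>g\<close>, so the formula
  passes from the generators to limits of their combinations.\<close>

lemma treeZ_eval:
  assumes g: "g \<in> treeZ T" and F: "finite F" "\<And>i. i \<notin> F \<Longrightarrow> theta T i x = 0"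
  shows "apply_bcontfun g x = (\<Sum>j\<in>F. theta T j x * coord g j)"
proof (rule eq_on_closure_span[OF bounded_linear_eval _ _ g[unfolded treeZ_def]])
  show "bounded_linear (\<lambda>g. \<Sum>j\<in>F. theta T j x * coord g j)"
    by (intro bounded_linear_sum bounded_linear_const_mult bounded_linear_coord)
  fix h assume "h \<in> range (thetaC T)"
  then obtain i where "h = thetaC T i" by auto
  then show "apply_bcontfun h x = (\<Sum>j\<in>F. theta T j x * coord h j)"
    using F by (cases "i \<in> F") (auto simp: coord_thetaC if_distrib[of "\<lambda>y. _ * y"] sum.delta cong: if_cong)
qed

text \<open>The value at the point with support \<open>ns\<close> and the signs of the
  coordinates.\<close>

lemma treeZ_lower:
  assumes g: "g \<in> treeZ T" and ns: "adm T k ns"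
  shows "(1/2) ^ k * (\<Sum>j\<in>set ns. \<bar>coord g j\<bar>) \<le> norm g"
proof -
  let ?x = "point k (set ns) (\<lambda>j. 0 \<le> coord g j)"
  have "apply_bcontfun g ?x = (\<Sum>j\<in>set ns. theta T j ?x * coord g j)"
    by (rule treeZ_eval[OF g]) (simp_all add: theta_point[OF ns])
  also have "\<dots> = (\<Sum>j\<in>set ns. (1/2) ^ k * \<bar>coord g j\<bar>)"
    by (intro sum.cong) (auto simp: theta_point[OF ns])
  also have "\<dots> = (1/2) ^ k * (\<Sum>j\<in>set ns. \<bar>coord g j\<bar>)"
    by (rule sum_distrib_left[symmetric])
  finally show ?thesis using apply_bcontfun_le[of g ?x] by linarith
qed

text \<open>Only points with a nonzero index \<open>kap x\<close> have positive weight, and at such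
  a point at most \<open>16 ^ kap x\<close> coefficients are nonzero. The value is then a finite sum
  over an admissible set, and \<open>weight\<close> squares the factor
  \<open>(1/2) ^ kap x\<close>.\<close>

lemma mulw_upper:
  assumes g: "g \<in> treeZ T"
    and r: "\<And>k ns. 1 \<le> k \<Longrightarrow> adm T k ns \<Longrightarrow> (1/4) ^ k * (\<Sum>j\<in>set ns. \<bar>coord g j\<bar>) \<le> r"
  shows "norm (mulw g) \<le> r"
proof (rule norm_bound)
  fix x
  have r0: "0 \<le> r" using r[of 1 "[]"] by (simp add: adm_def)
  show "norm (apply_bcontfun (mulw g) x) \<le> r"
  proof (cases "(\<exists>j. x (3 * j + 2)) \<and> kap x \<noteq> 0")
    case False
    then have "weight x = 0" by (auto simp: weight_def)
    then show ?thesis using r0 by simp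
  next
    case True
    define A where "A = {i. theta T i x \<noteq> 0}"
    \<comment> \<open>Admissible sets are only known to contain the finite subsets of the support;
      the common cardinality bound makes the support itself finite.\<close>
    have card: "card B \<le> 16 ^ kap x" if B: "B \<subseteq> A" "finite B" for B
    proof (cases "B = {}")
      case False
      then obtain ns where ns: "adm T (kap x) ns" "B \<subseteq> set ns"
        using theta_support[of B T x] B unfolding A_def by blast
      have "card B \<le> card (set ns)" by (rule card_mono[OF _ ns(2)]) simp
      also have "\<dots> \<le> length ns" by (rule card_length)
      also have "\<dots> \<le> 16 ^ kap x" using ns(1) True by (simp add: adm_def)
      finally show ?thesis .
    qed simp
    have fin: "finite A"
      using finite_if_finite_subsets_card_bdd[of A "16 ^ kap x"] card by blast
    obtain ns where ns: "adm T (kap x) ns" "A \<subseteq> set ns"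
    proof (cases "A = {}")
      case True
      then show ?thesis using that[of "[]"] \<open>(\<exists>j. x (3 * j + 2)) \<and> kap x \<noteq> 0\<close> by (simp add: adm_def)
    qed (use that theta_support[OF fin, of T x] in \<open>auto simp: A_def\<close>)
    have "apply_bcontfun g x = (\<Sum>j\<in>set ns. theta T j x * coord g j)"
      by (rule treeZ_eval[OF g]) (use ns(2) in \<open>auto simp: A_def\<close>)
    also have "\<bar>\<dots>\<bar> \<le> (\<Sum>j\<in>set ns. (1/2) ^ kap x * \<bar>coord g j\<bar>)"
      by (rule order_trans[OF sum_abs]) (auto simp: abs_mult intro!: sum_mono mult_right_mono abs_theta_le)
    finally have "\<bar>apply_bcontfun g x\<bar> \<le> (1/2) ^ kap x * (\<Sum>j\<in>set ns. \<bar>coord g j\<bar>)"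
      by (simp add: sum_distrib_left)
    then have "weight x * \<bar>apply_bcontfun g x\<bar> \<le> weight x * ((1/2) ^ kap x * (\<Sum>j\<in>set ns. \<bar>coord g j\<bar>))"
      by (rule mult_left_mono) (rule weight_le)
    also have "\<dots> = (1/4) ^ kap x * (\<Sum>j\<in>set ns. \<bar>coord g j\<bar>)"
      using True by (simp add: weight_def mult.assoc[symmetric] power_mult_distrib[symmetric])
    also have "\<dots> \<le> r" using True ns by (intro r) auto
    finally show ?thesis using weight_le[of x] by (simp add: abs_mult)
  qed
qed

section \<open>Weak nullity of the unit vectors and of the coordinate functionals\<close>

lemma weakly_null_thetaC:
  assumes "\<not> has_branch T"
  shows "weakly_null (subspace_nspace (treeZ T)) (thetaC T)"
proof (rule weakly_null_basis[OF assms subspace_treeZ(1) thetaC_in])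
  fix S :: "nat set" and c :: "nat \<Rightarrow> real" and B :: real
  assume S: "finite S" and B0: "0 \<le> B"
    and B: "\<And>\<kappa> ns. adm T \<kappa> ns \<Longrightarrow> (1/2) ^ \<kappa> * (\<Sum>n\<in>set ns \<inter> S. \<bar>c n\<bar>) \<le> B"
  have apply_sum: "apply_bcontfun (\<Sum>n\<in>S. c n *\<^sub>R thetaC T n) x = (\<Sum>n\<in>S. c n * theta T n x)" for x
    using S by (induction S rule: finite_induct) auto
  show "norm (\<Sum>n\<in>S. c n *\<^sub>R thetaC T n) \<le> B"
  proof (rule norm_bound)
    fix x
    define A where "A = {n \<in> S. theta T n x \<noteq> 0}"
    have A: "finite A" using S by (simp add: A_def)
    have eq: "(\<Sum>n\<in>S. c n * theta T n x) = (\<Sum>n\<in>A. c n * theta T n x)"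
      using S by (intro sum.mono_neutral_right) (auto simp: A_def)
    show "norm (apply_bcontfun (\<Sum>n\<in>S. c n *\<^sub>R thetaC T n) x) \<le> B"
    proof (cases "A = {}")
      case True then show ?thesis using eq B0 by (simp add: apply_sum)
    next
      case False
      then obtain ns where ns: "adm T (kap x) ns" "A \<subseteq> set ns"
        using theta_support[OF A, of T x] unfolding A_def by blast
      have "\<bar>\<Sum>n\<in>A. c n * theta T n x\<bar> \<le> (\<Sum>n\<in>A. (1/2) ^ kap x * \<bar>c n\<bar>)"
        by (rule order_trans[OF sum_abs])
          (auto simp: abs_mult mult.commute[of "\<bar>c _\<bar>"] intro!: sum_mono mult_right_mono abs_theta_le)
      also have "\<dots> \<le> (\<Sum>n\<in>set ns \<inter> S. (1/2) ^ kap x * \<bar>c n\<bar>)"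
        using ns(2) by (intro sum_mono2) (auto simp: A_def)
      also have "\<dots> \<le> B" using B[OF ns(1)] by (simp add: sum_distrib_left)
      finally show ?thesis by (simp add: apply_sum eq)
    qed
  qed
qed

lemma (in normed_space) dual_vcomb:
  assumes f: "f \<in> vcarrier (dual_nspace X)" and x: "\<And>n. x n \<in> vcarrier X"
  shows "f (vcomb X x l) = rcomb (\<lambda>n. f (x n)) l"
proof (induction l)
  case Nil
  have "f (vscale X 0 (vzero X)) = 0 * f (vzero X)"
    using f zero_closed unfolding dual_iff by blast
  then show ?case by simp
next
  case (Cons p l)
  obtain q i where p: "p = (q, i)" by force
  have "f (vadd X (vscale X q (x i)) (vcomb X x l)) = f (vscale X q (x i)) + f (vcomb X x l)"
    using f x unfolding dual_iff by auto
  moreover have "f (vscale X q (x i)) = q * f (x i)"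
    using f x unfolding dual_iff by auto
  ultimately show ?case using Cons p by simp
qed

lemma vcomb_dual_apply:
  assumes X: "normed_space X" and f: "\<And>n. f n \<in> vcarrier (dual_nspace X)" and x: "x \<in> vcarrier X"
  shows "vcomb (dual_nspace X) f l x = rcomb (\<lambda>n. f n x) l"
proof (induction l)
  case Nil then show ?case using x by (simp add: dual_nspace_def)
next
  case (Cons p l)
  obtain q i where "p = (q, i)" by force
  then show ?case using Cons x by (simp add: dual_simps)
qed

lemma rcomb_list: "distinct ns \<Longrightarrow> rcomb a (map (\<lambda>n. (c n, n)) ns) = (\<Sum>n\<in>set ns. c n * a n)"
  by (induction ns) auto

text \<open>Not normalized: the value at the \<open>n\<close>-th generator is 1/4, with one factor
  1/2 from \<open>theta\<close> and one from \<open>weight\<close>.\<close>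

definition coordW :: "nat \<Rightarrow> cantor_fun \<Rightarrow> real" where
  "coordW n = (\<lambda>w\<in>treeW. apply_bcontfun w (point 1 {n} (\<lambda>_. True)))"

lemma coordW_dual: "coordW n \<in> vcarrier (dual_nspace (subspace_nspace treeW))"
  unfolding dual_iff using subspace_treeW(1) apply_bcontfun_le
  by (auto simp: coordW_def subspace_add subspace_scale intro!: exI[of _ 1])

text \<open>A signed sum of up to \<open>16 ^ k\<close> coordinate functionals is a multiple of one
  point evaluation and so has norm at most \<open>4 ^ k / 4\<close>. The denominator 4 comes from
  the missing normalization of \<open>coordW\<close>.\<close>

lemma coordW_sum:
  assumes w: "w \<in> treeW" and ns: "adm {} k ns" and k: "k \<noteq> 0"
  shows "(\<Sum>n\<in>set ns. (if s n then 1 else -1) * coordW n w) = 4 ^ k / 4 * apply_bcontfun w (point k (set ns) s)"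
proof -
  have "(\<Sum>n\<in>set ns. (if s n then 1 else -1) * apply_bcontfun w (point 1 {n} (\<lambda>_. True))) =
      4 ^ k / 4 * apply_bcontfun w (point k (set ns) s)"
  proof (rule eq_on_closure_span[OF _ _ _ w[unfolded treeW_def]])
    show "bounded_linear (\<lambda>w::cantor_fun. \<Sum>n\<in>set ns. (if s n then 1 else -1) * apply_bcontfun w (point 1 {n} (\<lambda>_. True)))"
      by (intro bounded_linear_sum bounded_linear_const_mult bounded_linear_eval)
    show "bounded_linear (\<lambda>w::cantor_fun. 4 ^ k / 4 * apply_bcontfun w (point k (set ns) s))"
      by (intro bounded_linear_const_mult bounded_linear_eval)
    fix h assume "h \<in> range (\<lambda>i. mulw (thetaC {} i))"
    then obtain i where h: "h = mulw (thetaC {} i)" by auto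
    have p1: "apply_bcontfun h (point 1 {n} (\<lambda>_. True)) = (if i = n then 1/4 else 0)" for n
      using theta_point[OF adm_singleton[of "{}" n], of i "\<lambda>_. True"] by (simp add: h weight_point)
    have "apply_bcontfun h (point k (set ns) s) = (1/4) ^ k * (if i \<in> set ns then (if s i then 1 else -1) else 0)"
      by (simp add: h weight_point[OF k] theta_point[OF ns] power_mult_distrib[symmetric])
    moreover have "(4::real) ^ k * (1/4) ^ k = 1" by (simp add: power_mult_distrib[symmetric])
    ultimately show "(\<Sum>n\<in>set ns. (if s n then 1 else -1) * apply_bcontfun h (point 1 {n} (\<lambda>_. True))) =
      4 ^ k / 4 * apply_bcontfun h (point k (set ns) s)"
      unfolding p1 by (simp add: if_distrib[of "\<lambda>y. _ * y"] sum.delta mult.assoc[symmetric] cong: if_cong)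
  qed
  then show ?thesis using w by (simp add: coordW_def)
qed

text \<open>If an element \<open>\<phi>\<close> of the bidual were at least \<open>\<delta>\<close>
  in absolute value on \<open>16 ^ k'\<close> of them, then \<open>\<phi>\<close> would be at least
  \<open>16 ^ k' * \<delta>\<close> on a signed sum of norm at most \<open>4 ^ k' / 4\<close>, which
  is impossible once \<open>4 ^ k'\<close> exceeds \<open>C / \<delta>\<close>.\<close>

lemma weakly_null_coordW: "weakly_null (dual_nspace (subspace_nspace treeW)) coordW"
proof -
  let ?W = "subspace_nspace treeW"
  interpret W: normed_space ?W by (rule normed_space_subspace[OF subspace_treeW(1)])
  interpret D: normed_space "dual_nspace ?W" by (rule normed_space_dual) unfold_locales
  show ?thesis
    unfolding weakly_null_def
  proof (intro conjI allI ballI coordW_dual)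
    fix \<phi> assume \<phi>: "\<phi> \<in> vcarrier (dual_nspace (dual_nspace ?W))"
    show "(\<lambda>n. \<phi> (coordW n)) \<longlonglongrightarrow> 0"
    proof (rule ccontr)
      assume "\<not> (\<lambda>n. \<phi> (coordW n)) \<longlonglongrightarrow> 0"
      then obtain \<delta> where \<delta>: "\<delta> > 0" and ex: "\<And>N. \<exists>n\<ge>N. \<bar>\<phi> (coordW n)\<bar> \<ge> \<delta>"
        unfolding LIMSEQ_iff by (auto simp: not_less)
      define C where "C = vnorm (dual_nspace (dual_nspace ?W)) \<phi>"
      have C: "\<bar>\<phi> f\<bar> \<le> C * vnorm (dual_nspace ?W) f" if "f \<in> vcarrier (dual_nspace ?W)" for f
        unfolding C_def by (rule D.dual_normI[OF \<phi> that])
      have C0: "0 \<le> C" unfolding C_def by (rule D.dual_norm_nonneg[OF \<phi>])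
      obtain k where k: "C / \<delta> < 4 ^ k" using real_arch_pow[of 4 "C / \<delta>"] by auto
      define k' where "k' = Suc k"
      have "C / \<delta> < 4 * 4 ^ k" using k zero_less_power[of "4::real" k] by linarith
      then have k': "C / \<delta> < 4 ^ k'" "k' \<noteq> 0" by (simp_all add: k'_def)
      \<comment> \<open>The condition \<open>k' \<le> n\<close> provides the lower bound on elements
        that \<open>adm\<close> asks for.\<close>
      define M where "M = {n. k' \<le> n \<and> \<delta> \<le> \<bar>\<phi> (coordW n)\<bar>}"
      have "infinite M"
        unfolding infinite_nat_iff_unbounded_le
      proof
        fix m show "\<exists>n\<ge>m. n \<in> M" using ex[of "max m k'"] by (auto simp: M_def)
      qed
      then obtain F where F: "F \<subseteq> M" "card F = 16 ^ k'" "finite F"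
        using infinite_arbitrarily_large by blast
      define ns where "ns = sorted_list_of_set F"
      have ns: "set ns = F" "distinct ns" "length ns = 16 ^ k'" "sorted_wrt (<) ns"
        using F by (auto simp: ns_def)
      have adm: "adm {} k' ns"
        using F ns k'(2) by (auto simp: adm_def M_def)
      define s where "s n \<longleftrightarrow> 0 \<le> \<phi> (coordW n)" for n
      define l where "l = map (\<lambda>n. (if s n then 1 else -1 :: real, n)) ns"
      define g where "g = vcomb (dual_nspace ?W) coordW l"
      have g: "g \<in> vcarrier (dual_nspace ?W)"
        unfolding g_def by (rule D.vcomb_closed) (rule coordW_dual)
      have "vnorm (dual_nspace ?W) g \<le> 4 ^ k' / 4"
      proof (rule W.dual_norm_le)
        fix w assume w: "w \<in> vcarrier ?W"
        have "g w = 4 ^ k' / 4 * apply_bcontfun w (point k' (set ns) s)"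
          unfolding g_def vcomb_dual_apply[OF W.normed_space_axioms coordW_dual w] l_def rcomb_list[OF ns(2)]
          using coordW_sum[OF _ adm k'(2)] w by simp
        then have "\<bar>g w\<bar> = 4 ^ k' / 4 * \<bar>apply_bcontfun w (point k' (set ns) s)\<bar>"
          by (simp only: abs_mult) simp
        also have "\<dots> \<le> 4 ^ k' / 4 * norm w"
          by (intro mult_left_mono apply_bcontfun_le) simp
        finally show "\<bar>g w\<bar> \<le> 4 ^ k' / 4 * vnorm ?W w" by simp
      qed simp
      then have "\<bar>\<phi> g\<bar> \<le> C * (4 ^ k' / 4)"
        using C[OF g] mult_left_mono[OF _ C0] by (meson order_trans)
      moreover have "\<phi> g = (\<Sum>n\<in>F. \<bar>\<phi> (coordW n)\<bar>)"
        unfolding g_def D.dual_vcomb[OF \<phi> coordW_dual] l_def rcomb_list[OF ns(2)] ns(1)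
        by (intro sum.cong) (auto simp: s_def)
      moreover have "16 ^ k' * \<delta> \<le> (\<Sum>n\<in>F. \<bar>\<phi> (coordW n)\<bar>)"
        using sum_bounded_below[of F \<delta> "\<lambda>n. \<bar>\<phi> (coordW n)\<bar>"] F by (auto simp: M_def)
      ultimately have le: "16 ^ k' * \<delta> \<le> C * (4 ^ k' / 4)" by linarith
      have "C < 4 ^ k' * \<delta>" using k'(1) \<delta> by (simp add: field_simps)
      then have "C * 4 ^ k' < (4 ^ k' * \<delta>) * 4 ^ k'"
        by (rule mult_strict_right_mono) simp
      also have "\<dots> = 16 ^ k' * \<delta>" by (simp flip: power_mult_distrib add: mult.assoc mult.left_commute[of \<delta>])
      finally have "C * 4 ^ k' < 16 ^ k' * \<delta>" .
      moreover have "C * (4 ^ k' / 4) \<le> C * 4 ^ k'" using C0 by (simp add: mult_left_mono)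
      ultimately show False using le by linarith
    qed
  qed
qed

lemma bounded_operator_mulw: "bounded_operator (subspace_nspace (treeZ T)) (subspace_nspace treeW) mulw"
proof -
  interpret bounded_linear mulw by (rule bounded_linear_mulw)
  show ?thesis
    using mulw_in bounded unfolding bounded_operator_def by (auto simp: add scaleR mult.commute)
qed

lemma coordW_mulw: "coordW n (mulw (thetaC T n)) = 1 / 4"
  using mulw_in[OF thetaC_in] theta_point[OF adm_singleton[of T n], of n "\<lambda>_. True"]
  by (simp add: coordW_def weight_point)

lemma not_dunford_pettis_mulw:
  assumes "\<not> has_branch T"
  shows "\<not> dunford_pettis (subspace_nspace (treeZ T)) (subspace_nspace treeW) mulw"
proof
  assume "dunford_pettis (subspace_nspace (treeZ T)) (subspace_nspace treeW) mulw"
  then have "(\<lambda>n. coordW n (mulw (thetaC T n))) \<longlonglongrightarrow> 0"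
    unfolding dunford_pettis_def using weakly_null_thetaC[OF assms] weakly_null_coordW by blast
  then show False by (simp add: coordW_mulw LIMSEQ_const_iff)
qed

lemma compl_class_mulw:
  assumes "\<not> has_branch T"
  shows "compl_class dunford_pettis (subspace_nspace (treeZ T)) (subspace_nspace treeW) mulw"
  using not_dunford_pettis_mulw[OF assms] bounded_operator_mulw
    banach_space_subspace[OF subspace_treeZ(1) complete_cantor_fun[OF subspace_treeZ(2)]]
    banach_space_subspace[OF subspace_treeW(1) complete_cantor_fun[OF subspace_treeW(2)]]
  unfolding compl_class_def by blast

section \<open>A countable form of factorization\<close>

text \<open>What remains of a factorization of an operator through the one attached to \<open>T\<close> if it is only tested on a
  sequence of vectors: \<open>\<nu>\<close> gives the norms of their rational combinations, \<open>\<mu>\<close> the norms of their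
  images, \<open>z\<close> the coordinates in the intermediate space. In contrast to the existence of a factorization, this is a
  Borel condition on all the data.\<close>

definition relaxed ::
  "nat list set \<Rightarrow> ((rat \<times> nat) list \<Rightarrow> real) \<Rightarrow> (nat \<Rightarrow> real) \<Rightarrow> (nat \<Rightarrow> nat \<Rightarrow> real) \<Rightarrow> nat \<Rightarrow> bool" where
  "relaxed T \<nu> \<mu> z k \<longleftrightarrow>
     (\<forall>l \<kappa> ns. adm T \<kappa> ns \<longrightarrow> (1/2) ^ \<kappa> * (\<Sum>j\<in>set ns. \<bar>rcomb (\<lambda>i. z i j) (rat_comb l)\<bar>) \<le> real k * \<nu> l) \<and>
     (\<forall>i (r::rat). (\<forall>\<kappa> ns. 1 \<le> \<kappa> \<longrightarrow> adm T \<kappa> ns \<longrightarrow> (1/4) ^ \<kappa> * (\<Sum>j\<in>set ns. \<bar>z i j\<bar>) \<le> of_rat r) \<longrightarrow>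
        \<mu> i \<le> real k * of_rat r)"

lemma linear_rcomb:
  fixes f :: "'v::real_vector \<Rightarrow> real"
  assumes "linear f"
  shows "f (\<Sum>(q, i)\<leftarrow>l. q *\<^sub>R x i) = rcomb (\<lambda>i. f (x i)) l"
proof (induction l)
  case Nil then show ?case using linear_0[OF assms] by simp
next
  case (Cons p l)
  then show ?case by (cases p) (simp add: linear_add[OF assms] linear_scale[OF assms])
qed

text \<open>The \<open>z\<close> are the coordinates of the vectors \<open>C (x i)\<close>. The
  first clause of \<open>relaxed\<close> is the bound on \<open>C\<close> seen through
  \<open>treeZ_lower\<close>, the second the bound on \<open>D\<close> seen through
  \<open>mulw_upper\<close>, with rational \<open>r\<close> standing for upper bounds of the norm in
  the second space.\<close>

lemma factors_imp_relaxed: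
  assumes X: "normed_space X" and Y: "normed_space Y" and x: "\<And>n. x n \<in> vcarrier X"
    and C: "bounded_operator X (subspace_nspace (treeZ T)) C"
    and D: "bounded_operator (subspace_nspace treeW) Y D"
    and U: "\<And>n. U (x n) = D (mulw (C (x n)))"
  shows "\<exists>z k. relaxed T (\<lambda>l. vnorm X (vcomb X x (rat_comb l))) (\<lambda>i. vnorm Y (U (x i))) z k"
proof -
  have Z: "normed_space (subspace_nspace (treeZ T))" and W: "normed_space (subspace_nspace treeW)"
    using subspace_treeZ(1) subspace_treeW(1) normed_space_subspace by blast+
  obtain K L where K: "\<And>x. x \<in> vcarrier X \<Longrightarrow> norm (C x) \<le> K * vnorm X x"
    and L: "L > 0" "\<And>w. w \<in> treeW \<Longrightarrow> vnorm Y (D w) \<le> L * norm w"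
    using bounded_operator_bound[OF C X] bounded_operator_bound[OF D W] by (metis subspace_nspace_simps(1,5))
  obtain k :: nat where k: "K \<le> real k" "L \<le> real k"
    using real_arch_simple[of "max K L"] by auto
  define z where "z i j = coord (C (x i)) j" for i j
  have CZ: "C v \<in> treeZ T" if "v \<in> vcarrier X" for v
    using bounded_operatorD(1)[OF C that] by simp
  have comb: "coord (C (vcomb X x l)) j = rcomb (\<lambda>i. z i j) l" for l j
    unfolding bounded_operator_vcomb[OF C X Z x] vcomb_subspace z_def
    by (rule linear_rcomb) (rule bounded_linear.linear[OF bounded_linear_coord])
  have "relaxed T (\<lambda>l. vnorm X (vcomb X x (rat_comb l))) (\<lambda>i. vnorm Y (U (x i))) z k"
    unfolding relaxed_def
  proof (intro conjI allI impI)
    fix l \<kappa> ns assume ns: "adm T \<kappa> ns"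
    have c: "vcomb X x (rat_comb l) \<in> vcarrier X" by (rule normed_space.vcomb_closed[OF X x])
    have "(1/2) ^ \<kappa> * (\<Sum>j\<in>set ns. \<bar>rcomb (\<lambda>i. z i j) (rat_comb l)\<bar>) \<le> norm (C (vcomb X x (rat_comb l)))"
      using treeZ_lower[OF CZ[OF c] ns] by (simp add: comb)
    also have "\<dots> \<le> K * vnorm X (vcomb X x (rat_comb l))" by (rule K[OF c])
    also have "\<dots> \<le> real k * vnorm X (vcomb X x (rat_comb l))"
      using k normed_space.norm_nonneg[OF X c] by (intro mult_right_mono)
    finally show "(1/2) ^ \<kappa> * (\<Sum>j\<in>set ns. \<bar>rcomb (\<lambda>i. z i j) (rat_comb l)\<bar>) \<le> real k * vnorm X (vcomb X x (rat_comb l))" .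
  next
    fix i and r :: rat
    assume r: "\<forall>\<kappa> ns. 1 \<le> \<kappa> \<longrightarrow> adm T \<kappa> ns \<longrightarrow> (1/4) ^ \<kappa> * (\<Sum>j\<in>set ns. \<bar>z i j\<bar>) \<le> of_rat r"
    have le: "norm (mulw (C (x i))) \<le> of_rat r"
      by (rule mulw_upper[OF CZ[OF x]]) (use r in \<open>auto simp: z_def\<close>)
    have "vnorm Y (U (x i)) \<le> L * norm (mulw (C (x i)))"
      unfolding U by (rule L(2)[OF mulw_in[OF CZ[OF x]]])
    also have "\<dots> \<le> real k * of_rat r"
      using le k L(1) by (intro mult_mono) auto
    finally show "vnorm Y (U (x i)) \<le> real k * of_rat r" .
  qed
  then show ?thesis by blast
qed

text \<open>The gliding hump uses nothing but the inequalities recorded in \<open>relaxed\<close>,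
  so it also applies to data that come from no factorization. The reindexing \<open>r\<close> allows
  weakly null sequences to be picked from a dense one.\<close>

lemma relaxed_branch_null:
  assumes X: "normed_space X" and x: "\<And>n. x n \<in> vcarrier X" and T: "has_branch T"
    and rel: "relaxed T (\<lambda>l. vnorm X (vcomb X x (rat_comb l))) \<mu> z k"
    and \<mu>: "\<And>i. 0 \<le> \<mu> i" and w: "weakly_null X (\<lambda>n. x (r n))"
  shows "(\<lambda>n. \<mu> (r n)) \<longlonglongrightarrow> 0"
proof -
  have bound: "(1/2) ^ \<kappa> * (\<Sum>j\<in>set ns. \<bar>rcomb (\<lambda>i. z (r i) j) l\<bar>) \<le> real k * vnorm X (vcomb X (\<lambda>n. x (r n)) l)"
    if "adm T \<kappa> ns" for l \<kappa> ns
  proof -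
    have "(1/2) ^ \<kappa> * (\<Sum>j\<in>set ns. \<bar>rcomb (\<lambda>i. z i j) (map (apsnd r) l)\<bar>) \<le> real k * vnorm X (vcomb X x (map (apsnd r) l))"
    proof (rule normed_space.real_comb_bound[OF X x])
      show "(1/2) ^ \<kappa> * (\<Sum>j\<in>set ns. \<bar>rcomb (\<lambda>i. z i j) (rat_comb l)\<bar>) \<le> real k * vnorm X (vcomb X x (rat_comb l))" for l
        using rel that unfolding relaxed_def by blast
    qed simp_all
    then show ?thesis
      by (simp add: vcomb_reindex rcomb_reindex[of "\<lambda>i. z i _" r])
  qed
  show ?thesis
  proof (rule LIMSEQ_I)
    fix e :: real assume e: "0 < e"
    obtain q :: rat where q: "0 < real_of_rat q" "real_of_rat q < e / (real k + 1)"
      using of_rat_dense[of 0 "e / (real k + 1)"] e by auto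
    obtain N where N: "\<And>n \<kappa> ns. n \<ge> N \<Longrightarrow> \<kappa> \<ge> 1 \<Longrightarrow> adm T \<kappa> ns \<Longrightarrow>
        (1/4) ^ \<kappa> * (\<Sum>j\<in>set ns. \<bar>z (r n) j\<bar>) < real_of_rat q"
      using normed_space.branch_null[OF X T w _ bound q(1)] by auto
    have "\<mu> (r n) < e" if "n \<ge> N" for n
    proof -
      have "\<mu> (r n) \<le> real k * of_rat q"
      proof (rule rel[unfolded relaxed_def, THEN conjunct2, rule_format])
        show "(1/4) ^ \<kappa> * (\<Sum>j\<in>set ns. \<bar>z (r n) j\<bar>) \<le> real_of_rat q" if "1 \<le> \<kappa>" "adm T \<kappa> ns" for \<kappa> ns
          using N[OF \<open>n \<ge> N\<close> that] by (rule less_imp_le)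
      qed
      also have "\<dots> \<le> (real k + 1) * of_rat q" using q(1) by (simp add: algebra_simps)
      also have "\<dots> < e" using q(2) by (simp add: field_simps)
      finally show ?thesis .
    qed
    then show "\<exists>N. \<forall>n\<ge>N. norm (\<mu> (r n) - 0) < e" using \<mu> by auto
  qed
qed

section \<open>Separability of the space of continuous functions on the Cantor set\<close>

lemma compact_cantor: "compact (UNIV :: (nat \<Rightarrow> bool) set)"
proof -
  have "compact_space (product_topology (\<lambda>_. euclidean :: bool topology) (UNIV :: nat set))"
    by (subst compact_space_product_topology) (auto simp: compact_space_def finite_imp_compact)
  then show ?thesis
    by (simp add: compact_space_def euclidean_product_topology)
qed

lemma cantor_cylinder_nhd:
  assumes "open U" "x \<in> U"
  obtains N where "\<And>y :: nat \<Rightarrow> bool. (\<And>n. n < N \<Longrightarrow> y n = x n) \<Longrightarrow> y \<in> U"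
proof -
  obtain V where V: "x \<in> (\<Pi>\<^sub>E i\<in>UNIV. V i)" "finite {i. V i \<noteq> UNIV}" "(\<Pi>\<^sub>E i\<in>UNIV. V i) \<subseteq> U"
    using assms product_topology_open_contains_basis[of "\<lambda>_. euclidean" UNIV U x]
    unfolding open_fun_def by auto
  obtain N where N: "\<forall>i\<in>{i. V i \<noteq> UNIV}. i < N"
    using V(2) finite_nat_set_iff_bounded by blast
  show ?thesis
  proof (rule that[of N])
    fix y :: "nat \<Rightarrow> bool" assume y: "\<And>n. n < N \<Longrightarrow> y n = x n"
    have "y i \<in> V i" for i
      using V(1) N y[of i] by (cases "V i = UNIV") (auto simp: PiE_iff)
    then show "y \<in> U" using V(3) by (auto simp: PiE_iff)
  qed
qed

lemma cantor_uniformly_continuous: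
  fixes f :: cantor_fun
  assumes "e > 0"
  obtains N where "\<And>x y. (\<And>n. n < N \<Longrightarrow> x n = y n) \<Longrightarrow> \<bar>apply_bcontfun f x - apply_bcontfun f y\<bar> < e"
proof -
  define C where "C N x = {y. \<forall>n<N. y n = x n}" for N :: nat and x :: "nat \<Rightarrow> bool"
  have "\<exists>N. \<forall>y\<in>C N x. \<bar>apply_bcontfun f y - apply_bcontfun f x\<bar> < e / 2" for x
  proof -
    have "open (apply_bcontfun f -` ball (apply_bcontfun f x) (e / 2))"
      by (intro open_vimage open_ball continuous_on_apply_bcontfun)
    moreover have "x \<in> apply_bcontfun f -` ball (apply_bcontfun f x) (e / 2)" using assms by simp
    ultimately obtain N where
      "\<And>y. (\<And>n. n < N \<Longrightarrow> y n = x n) \<Longrightarrow> y \<in> apply_bcontfun f -` ball (apply_bcontfun f x) (e / 2)"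
      by (rule cantor_cylinder_nhd) blast
    then show ?thesis
      by (intro exI[of _ N]) (auto simp: C_def dist_real_def abs_minus_commute)
  qed
  then have "\<forall>x. \<exists>N. \<forall>y\<in>C N x. \<bar>apply_bcontfun f y - apply_bcontfun f x\<bar> < e / 2" by blast
  from choice[OF this] obtain N where N: "\<And>x y. y \<in> C (N x) x \<Longrightarrow> \<bar>apply_bcontfun f y - apply_bcontfun f x\<bar> < e / 2"
    by blast
  have "open (C n x)" for n x
  proof -
    have "C n x = (\<Inter>i\<in>{..<n}. (\<lambda>y. y i) -` {x i})" by (auto simp: C_def)
    moreover have "open ((\<lambda>y::nat \<Rightarrow> bool. y i) -` {x i})" for i
      by (intro open_vimage open_discrete continuous_on_product_coordinates)
    ultimately show ?thesis by (simp add: open_INT)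
  qed
  moreover have "UNIV \<subseteq> (\<Union>x\<in>UNIV. C (N x) x)" by (auto simp: C_def)
  ultimately obtain F where F: "F \<subseteq> UNIV" "finite F" "UNIV \<subseteq> (\<Union>x\<in>F. C (N x) x)"
    by (rule compactE_image[OF compact_cantor])
  define M where "M = (\<Sum>x\<in>F. N x)"
  show ?thesis
  proof (rule that[of M])
    fix x y :: "nat \<Rightarrow> bool" assume eq: "\<And>n. n < M \<Longrightarrow> x n = y n"
    obtain a where a: "a \<in> F" "x \<in> C (N a) a" using F(3) by blast
    have "N a \<le> M" unfolding M_def using F(2) a(1) by (intro member_le_sum) auto
    then have "y \<in> C (N a) a" using a(2) eq by (auto simp: C_def)
    then show "\<bar>apply_bcontfun f x - apply_bcontfun f y\<bar> < e"
      using N[OF a(2)] N[of y a] by linarith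
  qed
qed

text \<open>By uniform continuity, functions with rational values that depend on the first
  \<open>N\<close> bits are dense; an association list from bit strings to rationals codes such a
  function.\<close>

lemma cantor_fun_separable:
  obtains c :: "nat \<Rightarrow> cantor_fun" where "closure (range c) = UNIV"
proof -
  define v where "v N ps x = (case map_of ps (map x [0..<N]) of None \<Rightarrow> 0 | Some r \<Rightarrow> real_of_rat r)"
    for N and ps :: "(bool list \<times> rat) list" and x :: "nat \<Rightarrow> bool"
  have cont: "continuous_on UNIV (v N ps)" for N ps
  proof (rule continuous_on_cylinder[of N])
    fix x y :: "nat \<Rightarrow> bool" assume "\<And>n. n < N \<Longrightarrow> x n = y n"
    then have "map x [0..<N] = map y [0..<N]" by simp
    then show "v N ps x = v N ps y" by (simp only: v_def)
  qed
  have bounded: "norm (v N ps x) \<le> (\<Sum>r\<in>snd ` set ps. \<bar>real_of_rat r\<bar>)" for N ps x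
  proof (cases "map_of ps (map x [0..<N])")
    case None then show ?thesis by (simp add: v_def sum_nonneg)
  next
    case (Some r)
    then have "r \<in> snd ` set ps" by (force dest: map_of_SomeD)
    then have "\<bar>real_of_rat r\<bar> \<le> (\<Sum>r\<in>snd ` set ps. \<bar>real_of_rat r\<bar>)"
      by (intro member_le_sum) auto
    then show ?thesis using Some by (simp add: v_def)
  qed
  have bc: "v N ps \<in> bcontfun" for N ps
    by (rule bcontfun_normI[OF cont bounded])
  define c where "c n = (case from_nat n of (N, ps) \<Rightarrow> Bcontfun (v N ps))" for n
  have "f \<in> closure (range c)" for f
    unfolding closure_approachable
  proof (intro allI impI)
    fix e :: real assume e: "e > 0"
    obtain N where N: "\<And>x y. (\<And>n. n < N \<Longrightarrow> x n = y n) \<Longrightarrow> \<bar>apply_bcontfun f x - apply_bcontfun f y\<bar> < e / 4"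
      using cantor_uniformly_continuous[of "e / 4" f] e by auto
    define ext where "ext bs i \<longleftrightarrow> i < N \<and> bs ! i" for bs :: "bool list" and i
    have "\<forall>bs. \<exists>q::rat. \<bar>apply_bcontfun f (ext bs) - of_rat q\<bar> < e / 4"
    proof
      fix bs
      obtain q :: rat where "apply_bcontfun f (ext bs) < of_rat q" "of_rat q < apply_bcontfun f (ext bs) + e / 4"
        using of_rat_dense[of "apply_bcontfun f (ext bs)" "apply_bcontfun f (ext bs) + e / 4"] e by auto
      then show "\<exists>q::rat. \<bar>apply_bcontfun f (ext bs) - of_rat q\<bar> < e / 4"
        by (intro exI[of _ q]) simp
    qed
    from choice[OF this] obtain q :: "bool list \<Rightarrow> rat"
      where q: "\<And>bs. \<bar>apply_bcontfun f (ext bs) - of_rat (q bs)\<bar> < e / 4" by blast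
    have "finite {bs :: bool list. length bs = N}"
      using finite_lists_length_eq[of "UNIV :: bool set" N] by simp
    then obtain bl where bl: "set bl = {bs :: bool list. length bs = N}"
      using finite_list by blast
    define ps where "ps = map (\<lambda>bs. (bs, q bs)) bl"
    have vps: "v N ps x = of_rat (q (map x [0..<N]))" for x
      by (simp add: v_def ps_def map_of_map_restrict bl)
    have "dist (Bcontfun (v N ps)) f \<le> e / 2"
    proof (rule dist_bound)
      fix x
      have "\<bar>apply_bcontfun f x - apply_bcontfun f (ext (map x [0..<N]))\<bar> < e / 4"
        by (rule N) (simp add: ext_def)
      then have "\<bar>of_rat (q (map x [0..<N])) - apply_bcontfun f x\<bar> \<le> e / 2"
        using q[of "map x [0..<N]"] by linarith
      then show "dist (apply_bcontfun (Bcontfun (v N ps)) x) (apply_bcontfun f x) \<le> e / 2"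
        by (simp add: Bcontfun_inverse[OF bc] vps dist_real_def)
    qed
    then have "dist (c (to_nat (N, ps))) f < e" using e by (simp add: c_def)
    then show "\<exists>y\<in>range c. dist y f < e" by blast
  qed
  then show ?thesis by (intro that[of c]) auto
qed

text \<open>A function on the Cantor set is determined by the balls of radius
  \<open>inverse (real (Suc k))\<close> around the dense sequence that contain it, hence by a set of
  natural numbers, hence by a real; the multiples of \<open>x\<close> give a copy of the reals in
  \<open>'a\<close>.\<close>

lemma ex_inj_cantor_fun:
  assumes X: "normed_space (X :: 'a nspace)" and x: "x \<in> vcarrier X" "vnorm X x \<noteq> 0"
  obtains h :: "cantor_fun \<Rightarrow> 'a" where "inj h"
proof -
  interpret normed_space X by fact
  obtain c :: "nat \<Rightarrow> cantor_fun" where c: "closure (range c) = UNIV"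
    by (rule cantor_fun_separable)
  define S where "S f = {p. \<exists>n k. p = prod_encode (n, k) \<and> dist (c n) f < inverse (real (Suc k))}" for f
  have "inj S"
  proof (rule injI, rule ccontr)
    fix f g assume eq: "S f = S g" and ne: "f \<noteq> g"
    obtain k where k: "inverse (real (Suc k)) < dist f g / 2"
      using reals_Archimedean[of "dist f g / 2"] ne by auto
    obtain n where n: "dist (c n) f < inverse (real (Suc k))"
      using c closure_approachable[of f "range c"]
      by (metis UNIV_I imageE inverse_positive_iff_positive of_nat_0_less_iff zero_less_Suc)
    then have "prod_encode (n, k) \<in> S g" unfolding eq[symmetric] by (auto simp: S_def)
    then have "dist (c n) g < inverse (real (Suc k))" by (auto simp: S_def)
    then have "dist f g < dist f g"
      using n k dist_triangle2[of f g "c n"] by (simp add: dist_commute)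
    then show False by simp
  qed
  moreover obtain s :: "nat set \<Rightarrow> real" where "inj s"
    using eqpoll_imp_lepoll[OF nat_sets_eqpoll_reals] unfolding lepoll_def by blast
  moreover have "inj (\<lambda>t. vscale X t x)"
  proof (rule injI)
    fix t t' assume "vscale X t x = vscale X t' x"
    then have "vdiff X (vscale X t x) (vscale X t' x) = vzero X"
      using x by (simp add: vdiff_def add_inverse)
    then have "\<bar>t - t'\<bar> * vnorm X x = 0"
      using x by (simp add: diff_scale_left flip: norm_scale)
    then show "t = t'" using x by simp
  qed
  ultimately have "inj ((\<lambda>t. vscale X t x) \<circ> s \<circ> S)"
    by (intro inj_compose)
  then show ?thesis by (rule that)
qed

section \<open>Measurability\<close>

text \<open>The dense sequence provides a countable base: the preimage of an open set is a countable
  union over pairs of balls whose sum lies in it.\<close>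

lemma borel_measurable_add_dense:
  fixes f g :: "'m \<Rightarrow> 'b::real_normed_vector" and c :: "nat \<Rightarrow> 'b"
  assumes c: "closure (range c) = UNIV" and f: "f \<in> borel_measurable M" and g: "g \<in> borel_measurable M"
  shows "(\<lambda>x. f x + g x) \<in> borel_measurable M"
proof (rule borel_measurableI)
  fix S :: "'b set" assume S: "open S"
  define P where "P = {(i, j, k). \<forall>u\<in>ball (c i) (inverse (real (Suc k))). \<forall>v\<in>ball (c j) (inverse (real (Suc k))). u + v \<in> S}"
  define A where "A = (\<lambda>(i, j, k). (f -` ball (c i) (inverse (real (Suc k))) \<inter> space M) \<inter>
     (g -` ball (c j) (inverse (real (Suc k))) \<inter> space M))"
  have "(\<lambda>x. f x + g x) -` S \<inter> space M = (\<Union>p\<in>P. A p)"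
  proof (intro set_eqI iffI)
    fix x assume x: "x \<in> (\<lambda>x. f x + g x) -` S \<inter> space M"
    then obtain e where e: "e > 0" "ball (f x + g x) e \<subseteq> S"
      using S open_contains_ball by blast
    obtain k where k: "inverse (real (Suc k)) < e / 4"
      using reals_Archimedean[of "e / 4"] e by auto
    have "\<exists>i. dist (c i) y < inverse (real (Suc k))" for y
      using c closure_approachable[of y "range c"]
      by (metis UNIV_I imageE inverse_positive_iff_positive of_nat_0_less_iff zero_less_Suc)
    then obtain i j where ij: "dist (c i) (f x) < inverse (real (Suc k))" "dist (c j) (g x) < inverse (real (Suc k))"
      by blast
    have "u + v \<in> S" if u: "dist (c i) u < inverse (real (Suc k))" and v: "dist (c j) v < inverse (real (Suc k))" for u v
    proof -
      have "dist (f x) u < e / 2"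
        using dist_triangle[of "f x" u "c i"] u ij(1) k by (simp add: dist_commute)
      moreover have "dist (g x) v < e / 2"
        using dist_triangle[of "g x" v "c j"] v ij(2) k by (simp add: dist_commute)
      moreover have "dist (f x + g x) (u + v) \<le> dist (f x) u + dist (g x) v"
        by (rule dist_triangle_add)
      ultimately show ?thesis using e(2) by (auto simp: subset_iff)
    qed
    then have "(i, j, k) \<in> P" by (auto simp: P_def)
    moreover have "x \<in> A (i, j, k)" using ij x by (auto simp: A_def)
    ultimately show "x \<in> (\<Union>p\<in>P. A p)" by blast
  qed (auto simp: A_def P_def)
  moreover have "(\<Union>p\<in>P. A p) \<in> sets M"
    using f g by (intro sets.countable_UN') (auto simp: A_def)
  ultimately show "(\<lambda>x. f x + g x) -` S \<inter> space M \<in> sets M" by simp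
qed

text \<open>Sequences of indices name vectors as limits of the dense sequence. The default value
  keeps the decoding total, and it is measurable since being Cauchy is a Borel condition.\<close>

definition dec :: "(nat \<Rightarrow> 'b::metric_space) \<Rightarrow> (nat \<Rightarrow> nat) \<Rightarrow> 'b" where
  "dec c s = (if Cauchy (\<lambda>m. c (s m)) then lim (\<lambda>m. c (s m)) else c 0)"

lemma ex_dec:
  assumes "closure (range c) = UNIV"
  shows "\<exists>s. dec c s = v"
proof -
  have "v \<in> closure (range c)" using assms by simp
  then obtain u where u: "\<And>n. u n \<in> range c" "u \<longlonglongrightarrow> v"
    unfolding closure_sequential by blast
  then have "\<forall>n. \<exists>i. u n = c i" by auto
  from choice[OF this] obtain s where s: "\<And>n. u n = c (s n)" by blast
  then have "(\<lambda>m. c (s m)) \<longlonglongrightarrow> v" using u(2) by (simp add: s[abs_def, symmetric])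
  then have "dec c s = v"
    using LIMSEQ_imp_Cauchy limI by (fastforce simp: dec_def)
  then show ?thesis by blast
qed

lemma measurable_dec:
  fixes c :: "nat \<Rightarrow> 'b::metric_space"
  assumes complete: "complete (UNIV :: 'b set)"
    and s: "\<And>m. (\<lambda>u. s u m) \<in> M \<rightarrow>\<^sub>M count_space (UNIV :: nat set)"
  shows "(\<lambda>u. dec c (s u)) \<in> borel_measurable M"
proof (rule borel_measurable_LIMSEQ_metric)
  have [measurable]: "(\<lambda>u. s u m) \<in> M \<rightarrow>\<^sub>M count_space (UNIV :: nat set)" for m by (rule s)
  have [measurable]: "Measurable.pred M (\<lambda>u. Cauchy (\<lambda>m. c (s u m)))"
    unfolding metric_Cauchy_iff2 by measurable
  have [measurable]: "c \<in> count_space UNIV \<rightarrow>\<^sub>M borel" by simp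
  show "(\<lambda>u. if Cauchy (\<lambda>m. c (s u m)) then c (s u i) else c 0) \<in> borel_measurable M" for i
    by measurable
  fix u
  show "(\<lambda>i. if Cauchy (\<lambda>m. c (s u m)) then c (s u i) else c 0) \<longlonglongrightarrow> dec c (s u)"
  proof (cases "Cauchy (\<lambda>m. c (s u m))")
    case True
    then obtain l where "(\<lambda>m. c (s u m)) \<longlonglongrightarrow> l"
      using complete unfolding complete_def by blast
    then show ?thesis using True limI by (fastforce simp: dec_def)
  qed (simp add: dec_def)
qed

lemma pred_fam:
  assumes [measurable]: "\<And>t. Measurable.pred M (\<lambda>u. t \<in> T u)"
  shows "Measurable.pred M (\<lambda>u. fam (T u) t ns)"
proof (induction ns arbitrary: t)
  case Nil then show ?case by simp
next
  case (Cons n ns)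
  note Cons[measurable]
  show ?case by simp
qed

lemma pred_adm:
  assumes "\<And>t. Measurable.pred M (\<lambda>u. t \<in> T u)"
  shows "Measurable.pred M (\<lambda>u. adm (T u) \<kappa> ns)"
  unfolding adm_def using pred_fam[where M = M and T = T, OF assms] by (cases "\<kappa> = 0") auto

lemma measurable_rcomb:
  assumes [measurable]: "\<And>i. (\<lambda>u. a u i) \<in> borel_measurable M"
  shows "(\<lambda>u. rcomb (a u) l) \<in> borel_measurable M"
  by (induction l) auto

text \<open>All quantifiers in \<open>relaxed\<close> range over countable types: natural numbers,
  rationals and lists of them.\<close>

lemma pred_relaxed:
  assumes T: "\<And>t. Measurable.pred M (\<lambda>u. t \<in> T u)"
    and [measurable]: "\<And>l. (\<lambda>u. \<nu> u l) \<in> borel_measurable M" "\<And>i. (\<lambda>u. \<mu> u i) \<in> borel_measurable M"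
      "\<And>i j. (\<lambda>u. z u i j) \<in> borel_measurable M" "k \<in> M \<rightarrow>\<^sub>M count_space UNIV"
  shows "Measurable.pred M (\<lambda>u. relaxed (T u) (\<nu> u) (\<mu> u) (z u) (k u))"
proof -
  note pred_adm[where M = M and T = T, OF T, measurable]
  have [measurable]: "(\<lambda>u. rcomb (\<lambda>i. z u i j) l) \<in> borel_measurable M" for j l
    by (rule measurable_rcomb) measurable
  show ?thesis unfolding relaxed_def by measurable
qed

section \<open>Coded operators\<close>

lemma bounded_operator_subspace:
  assumes "bounded_operator (subspace_nspace X) (subspace_nspace Y) A"
  shows "x \<in> X \<Longrightarrow> A x \<in> Y" "x \<in> X \<Longrightarrow> y \<in> X \<Longrightarrow> A (x + y) = A x + A y"
    "x \<in> X \<Longrightarrow> A (c *\<^sub>R x) = c *\<^sub>R A x"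
  using bounded_operatorD[OF assms] by simp_all

lemma bounded_operator_diff_bound:
  fixes X :: "'a::real_normed_vector set" and Y :: "'b::real_normed_vector set"
  assumes A: "bounded_operator (subspace_nspace X) (subspace_nspace Y) A" and X: "subspace X"
  obtains K where "K > 0" "\<And>x y. x \<in> X \<Longrightarrow> y \<in> X \<Longrightarrow> norm (A x - A y) \<le> K * norm (x - y)"
proof -
  obtain K where K: "K > 0" "\<And>x. x \<in> X \<Longrightarrow> norm (A x) \<le> K * norm x"
    using bounded_operator_bound[OF A normed_space_subspace[OF X]] by auto
  have "norm (A x - A y) \<le> K * norm (x - y)" if "x \<in> X" "y \<in> X" for x y
  proof -
    have "A (x + (-1) *\<^sub>R y) = A x + (-1) *\<^sub>R A y"
      using bounded_operator_subspace[OF A] that subspace_scale[OF X] by metis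
    then show ?thesis using K(2)[of "x - y"] subspace_diff[OF X that] by simp
  qed
  with K(1) show ?thesis by (rule that)
qed

lemma bounded_operator_tendsto:
  fixes X :: "'a::real_normed_vector set" and Y :: "'b::real_normed_vector set"
  assumes A: "bounded_operator (subspace_nspace X) (subspace_nspace Y) A" and X: "subspace X"
    and u: "\<And>n. u n \<in> X" "u \<longlonglongrightarrow> x" "x \<in> X"
  shows "(\<lambda>n. A (u n)) \<longlonglongrightarrow> A x"
proof -
  obtain K where K: "K > 0" "\<And>x y. x \<in> X \<Longrightarrow> y \<in> X \<Longrightarrow> norm (A x - A y) \<le> K * norm (x - y)"
    using bounded_operator_diff_bound[OF A X] by blast
  have "(\<lambda>n. K * norm (u n - x)) \<longlonglongrightarrow> K * 0"
    using u(2) by (intro tendsto_mult tendsto_const tendsto_norm_zero LIM_zero)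
  then have "(\<lambda>n. K * norm (u n - x)) \<longlonglongrightarrow> 0" by simp
  then have "(\<lambda>n. A (u n) - A x) \<longlonglongrightarrow> 0"
    by (rule Lim_null_comparison[rotated]) (intro always_eventually allI K(2) u)
  then show ?thesis by (rule LIM_zero_cancel)
qed

lemma dense_sequence:
  fixes e :: "nat \<Rightarrow> 'a::real_normed_vector"
  assumes "X \<subseteq> closure (range e)" "x \<in> X"
  obtains r :: "nat \<Rightarrow> nat" where "(\<lambda>n. e (r n)) \<longlonglongrightarrow> x"
proof -
  have "x \<in> closure (range e)" using assms by blast
  then obtain u where u: "\<And>n. u n \<in> range e" "u \<longlonglongrightarrow> x"
    unfolding closure_sequential by blast
  then have "\<forall>n. \<exists>i. u n = e i" by auto
  from choice[OF this] obtain r where "\<And>n. u n = e (r n)" by blast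
  then have "u = (\<lambda>n. e (r n))" by auto
  with u(2) show ?thesis by (intro that[of r]) simp
qed

lemma bounded_operator_unique:
  fixes X :: "'a::real_normed_vector set" and Y :: "'b::real_normed_vector set"
  assumes A: "bounded_operator (subspace_nspace X) (subspace_nspace Y) A"
    and B: "bounded_operator (subspace_nspace X) (subspace_nspace Y) B" and X: "subspace X"
    and e: "range (e :: nat \<Rightarrow> 'a) \<subseteq> X" "X \<subseteq> closure (range e)" and eq: "\<And>n. A (e n) = B (e n)" and x: "x \<in> X"
  shows "A x = B x"
proof -
  obtain r :: "nat \<Rightarrow> nat" where r: "(\<lambda>n. e (r n)) \<longlonglongrightarrow> x"
    using dense_sequence[OF e(2) x] by blast
  have eX: "e (r n) \<in> X" for n using e(1) by blast
  show ?thesis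
    using bounded_operator_tendsto[OF A X eX r x] bounded_operator_tendsto[OF B X eX r x]
    by (simp add: eq LIMSEQ_unique)
qed

lemma sum_three_coefficients:
  fixes v :: "nat \<Rightarrow> 'v::real_vector"
  shows "(\<Sum>m<Suc (i + j + l). real_of_rat ((if m = i then p else 0) + (if m = j then q else 0) + (if m = l then r else 0)) *\<^sub>R v m)
    = of_rat p *\<^sub>R v i + of_rat q *\<^sub>R v j + of_rat r *\<^sub>R v l"
proof -
  have "(\<Sum>m<Suc (i + j + l). real_of_rat (if m = n then t else 0) *\<^sub>R v m) = of_rat t *\<^sub>R v n"
    if "n \<le> i + j + l" for n t
    using that by (subst sum.remove[of _ n]) (auto simp del: sum.lessThan_Suc intro!: sum.neutral)
  from this[of i p] this[of j q] this[of l r] show ?thesis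
    unfolding of_rat_add scaleR_add_left sum.distrib by (simp del: sum.lessThan_Suc)
qed

text \<open>Three terms are what linearity of the extended operator asks for: an approximation of
  \<open>a x + b x'\<close> is compared with approximations of \<open>x\<close> and of
  \<open>x'\<close>.\<close>

lemma three_term_domination:
  fixes e :: "nat \<Rightarrow> 'a::real_normed_vector" and y :: "nat \<Rightarrow> 'b::real_normed_vector"
  assumes dom: "\<And>n (q :: nat \<Rightarrow> rat). norm (\<Sum>i<n. of_rat (q i) *\<^sub>R y i) \<le> k * norm (\<Sum>i<n. of_rat (q i) *\<^sub>R e i)"
  shows "norm (a *\<^sub>R y i + b *\<^sub>R y j + c *\<^sub>R y l) \<le> k * norm (a *\<^sub>R e i + b *\<^sub>R e j + c *\<^sub>R e l)"
proof -
  have rat: "norm (of_rat p *\<^sub>R y i + of_rat q *\<^sub>R y j + of_rat r *\<^sub>R y l) \<le>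
      k * norm (of_rat p *\<^sub>R e i + of_rat q *\<^sub>R e j + of_rat r *\<^sub>R e l)" for p q r
  proof -
    show ?thesis
      using dom[where n = "Suc (i + j + l)" and q = "\<lambda>m. (if m = i then p else 0) + (if m = j then q else 0) + (if m = l then r else 0)"]
      unfolding sum_three_coefficients .
  qed
  obtain p q r :: "nat \<Rightarrow> rat" where lim: "(\<lambda>n. real_of_rat (p n)) \<longlonglongrightarrow> a"
    "(\<lambda>n. real_of_rat (q n)) \<longlonglongrightarrow> b" "(\<lambda>n. real_of_rat (r n)) \<longlonglongrightarrow> c"
    using ex_rat_sequence by metis
  have "(\<lambda>n. norm (of_rat (p n) *\<^sub>R y i + of_rat (q n) *\<^sub>R y j + of_rat (r n) *\<^sub>R y l)) \<longlonglongrightarrow> norm (a *\<^sub>R y i + b *\<^sub>R y j + c *\<^sub>R y l)"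
    "(\<lambda>n. k * norm (of_rat (p n) *\<^sub>R e i + of_rat (q n) *\<^sub>R e j + of_rat (r n) *\<^sub>R e l)) \<longlonglongrightarrow> k * norm (a *\<^sub>R e i + b *\<^sub>R e j + c *\<^sub>R e l)"
    by (intro tendsto_intros lim)+
  then show ?thesis by (rule LIMSEQ_le) (use rat in blast)
qed

text \<open>Extension by continuity from a dense set that need not be closed under sums; linearity
  is therefore obtained in the limit, from the domination of three-term combinations.\<close>

lemma ex_bounded_operator:
  fixes X :: "'a::real_normed_vector set" and Y :: "'b::real_normed_vector set"
  assumes X: "subspace X" and Y: "complete Y"
    and e: "range e \<subseteq> X" "X \<subseteq> closure (range e)" and y: "\<And>n. y n \<in> Y"
    and dom: "\<And>n (q :: nat \<Rightarrow> rat). norm (\<Sum>i<n. of_rat (q i) *\<^sub>R y i) \<le> k * norm (\<Sum>i<n. of_rat (q i) *\<^sub>R e i)"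
  obtains A where "A \<in> extensional X" "bounded_operator (subspace_nspace X) (subspace_nspace Y) A"
    "\<And>n. A (e n) = y n"
proof -
  note three = three_term_domination[of y k e, OF dom]
  have diff: "norm (y i - y j) \<le> k * norm (e i - e j)" for i j
    using three[of 1 i "-1" j 0 0] by simp
  \<comment> \<open>One limit for all approximating sequences, so that the approximations of
    different vectors can later be chosen independently.\<close>
  have "\<exists>v\<in>Y. \<forall>r. (\<lambda>n. e (r n)) \<longlonglongrightarrow> x \<longrightarrow> (\<lambda>n. y (r n)) \<longlonglongrightarrow> v" if x: "x \<in> X" for x
  proof -
    obtain r :: "nat \<Rightarrow> nat" where r: "(\<lambda>n. e (r n)) \<longlonglongrightarrow> x"
      using dense_sequence[OF e(2) x] by blast
    have "Cauchy (\<lambda>n. y (r n))"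
    proof (rule CauchyI)
      fix \<epsilon> :: real assume \<epsilon>: "0 < \<epsilon>"
      define K where "K = max k 1"
      have K: "K > 0" by (simp add: K_def)
      obtain N where N: "\<And>m n. m \<ge> N \<Longrightarrow> n \<ge> N \<Longrightarrow> norm (e (r m) - e (r n)) < \<epsilon> / K"
        using CauchyD[OF LIMSEQ_imp_Cauchy[OF r], of "\<epsilon> / K"] \<epsilon> K by auto
      have "norm (y (r m) - y (r n)) < \<epsilon>" if "m \<ge> N" "n \<ge> N" for m n
      proof -
        have "k * norm (e (r m) - e (r n)) \<le> K * norm (e (r m) - e (r n))"
          by (intro mult_right_mono) (auto simp: K_def)
        also have "\<dots> < \<epsilon>" using N[OF that] K by (simp add: field_simps)
        finally show ?thesis using diff[of "r m" "r n"] by linarith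
      qed
      then show "\<exists>N. \<forall>m\<ge>N. \<forall>n\<ge>N. norm (y (r m) - y (r n)) < \<epsilon>" by blast
    qed
    then obtain v where v: "v \<in> Y" "(\<lambda>n. y (r n)) \<longlonglongrightarrow> v"
      using Y[unfolded complete_def, rule_format, of "\<lambda>n. y (r n)"] y by blast
    have "(\<lambda>n. y (r' n)) \<longlonglongrightarrow> v" if r': "(\<lambda>n. e (r' n)) \<longlonglongrightarrow> x" for r'
    proof -
      have "(\<lambda>n. k * norm (e (r' n) - e (r n))) \<longlonglongrightarrow> k * norm (x - x)"
        by (intro tendsto_intros r r')
      then have "(\<lambda>n. k * norm (e (r' n) - e (r n))) \<longlonglongrightarrow> 0" by simp
      then have "(\<lambda>n. y (r' n) - y (r n)) \<longlonglongrightarrow> 0"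
        by (rule Lim_null_comparison[rotated]) (intro always_eventually allI diff)
      from tendsto_add[OF this v(2)] show ?thesis by simp
    qed
    then show ?thesis using v(1) by blast
  qed
  then have "\<forall>x. \<exists>v. x \<in> X \<longrightarrow> v \<in> Y \<and> (\<forall>r. (\<lambda>n. e (r n)) \<longlonglongrightarrow> x \<longrightarrow> (\<lambda>n. y (r n)) \<longlonglongrightarrow> v)"
    by blast
  from choice[OF this] obtain A0 where A0: "\<And>x. x \<in> X \<Longrightarrow> A0 x \<in> Y"
    "\<And>x r. x \<in> X \<Longrightarrow> (\<lambda>n. e (r n)) \<longlonglongrightarrow> x \<Longrightarrow> (\<lambda>n. y (r n)) \<longlonglongrightarrow> A0 x" by blast
  have lin: "A0 z = a *\<^sub>R A0 x + b *\<^sub>R A0 x'"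
    if x: "x \<in> X" "x' \<in> X" "z \<in> X" and z: "z = a *\<^sub>R x + b *\<^sub>R x'" for x x' z a b
  proof -
    obtain r s t :: "nat \<Rightarrow> nat" where r: "(\<lambda>n. e (r n)) \<longlonglongrightarrow> z" "(\<lambda>n. e (s n)) \<longlonglongrightarrow> x" "(\<lambda>n. e (t n)) \<longlonglongrightarrow> x'"
      using dense_sequence[OF e(2)] x by metis
    have "(\<lambda>n. k * norm (1 *\<^sub>R e (r n) + (- a) *\<^sub>R e (s n) + (- b) *\<^sub>R e (t n))) \<longlonglongrightarrow>
       k * norm (1 *\<^sub>R z + (- a) *\<^sub>R x + (- b) *\<^sub>R x')"
      by (intro tendsto_intros r)
    then have "(\<lambda>n. k * norm (1 *\<^sub>R e (r n) + (- a) *\<^sub>R e (s n) + (- b) *\<^sub>R e (t n))) \<longlonglongrightarrow> 0"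
      using z by simp
    then have "(\<lambda>n. 1 *\<^sub>R y (r n) + (- a) *\<^sub>R y (s n) + (- b) *\<^sub>R y (t n)) \<longlonglongrightarrow> 0"
      by (rule Lim_null_comparison[rotated]) (intro always_eventually allI three)
    from LIMSEQ_unique[OF _ this]
    have "v = 0" if "(\<lambda>n. 1 *\<^sub>R y (r n) + (- a) *\<^sub>R y (s n) + (- b) *\<^sub>R y (t n)) \<longlonglongrightarrow> v" for v
      using that .
    moreover have "(\<lambda>n. 1 *\<^sub>R y (r n) + (- a) *\<^sub>R y (s n) + (- b) *\<^sub>R y (t n)) \<longlonglongrightarrow> 1 *\<^sub>R A0 z + (- a) *\<^sub>R A0 x + (- b) *\<^sub>R A0 x'"
      by (intro tendsto_intros A0(2) r x)
    ultimately have "1 *\<^sub>R A0 z + (- a) *\<^sub>R A0 x + (- b) *\<^sub>R A0 x' = 0"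
      by blast
    then show ?thesis by (simp add: algebra_simps)
  qed
  have bound: "norm (A0 x) \<le> k * norm x" if x: "x \<in> X" for x
  proof -
    obtain r :: "nat \<Rightarrow> nat" where r: "(\<lambda>n. e (r n)) \<longlonglongrightarrow> x"
      using dense_sequence[OF e(2) x] by blast
    have lim: "(\<lambda>n. norm (y (r n))) \<longlonglongrightarrow> norm (A0 x)" "(\<lambda>n. k * norm (e (r n))) \<longlonglongrightarrow> k * norm x"
      by (intro tendsto_intros A0(2) r x)+
    have "norm (y i) \<le> k * norm (e i)" for i using three[of 1 i 0 0 0 0] by simp
    then show ?thesis by (intro LIMSEQ_le[OF lim]) blast
  qed
  have eX: "e n \<in> X" for n using e(1) by blast
  have "A0 (e n) = y n" for n
    using A0(2)[OF eX, of "\<lambda>_. n" n] by (simp add: LIMSEQ_const_iff)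
  moreover have "bounded_operator (subspace_nspace X) (subspace_nspace Y) (restrict A0 X)"
  proof -
    have "A0 (x + x') = A0 x + A0 x'" if "x \<in> X" "x' \<in> X" for x x'
      using lin[OF that subspace_add[OF X that], of 1 1] by simp
    moreover have "A0 (c *\<^sub>R x) = c *\<^sub>R A0 x" if "x \<in> X" for c x
      using lin[OF that that subspace_scale[OF X that], of c c 0] by simp
    ultimately show ?thesis
      using A0(1) bound X unfolding bounded_operator_def
      by (auto simp: subspace_add subspace_scale intro!: exI[of _ k])
  qed
  ultimately show ?thesis by (intro that[of "restrict A0 X"]) (simp_all add: eX)
qed

section \<open>The operator of a code and the codes of the tree operators\<close>

context
  fixes d :: "nat \<Rightarrow> cantor_fun set \<Rightarrow> cantor_fun"
  assumes d: "dense_selectors d"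
begin

lemma selectors:
  assumes "X \<in> SB"
  shows "range (\<lambda>n. d n X) \<subseteq> X" "X \<subseteq> closure (range (\<lambda>n. d n X))"
  using d assms unfolding dense_selectors_def by blast+

lemma SB_D: "X \<in> SB \<Longrightarrow> subspace X" "X \<in> SB \<Longrightarrow> closed X" "X \<in> SB \<Longrightarrow> complete X"
  by (auto simp: SB_def complete_cantor_fun)

lemma code_op_spec:
  assumes "(X, Y, y) \<in> op_codes d"
  shows "bounded_operator (subspace_nspace X) (subspace_nspace Y) (code_op d (X, Y, y))"
    "code_op d (X, Y, y) (d n X) = y n"
proof -
  obtain k where XY: "X \<in> SB" "Y \<in> SB" "\<And>n. y n \<in> Y"
    and dom: "\<And>n (q :: nat \<Rightarrow> rat). norm (\<Sum>i<n. of_rat (q i) *\<^sub>R y i) \<le> real k * norm (\<Sum>i<n. of_rat (q i) *\<^sub>R d i X)"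
    using assms unfolding op_codes_def by blast
  let ?P = "\<lambda>A. A \<in> extensional X \<and> bounded_operator (subspace_nspace X) (subspace_nspace Y) A \<and> (\<forall>n. A (d n X) = y n)"
  obtain A where A: "?P A"
    using ex_bounded_operator[OF SB_D(1)[OF XY(1)] SB_D(3)[OF XY(2)] selectors[OF XY(1)] XY(3) dom] by blast
  have "B = A" if B: "?P B" for B
  proof (rule extensionalityI[of _ X])
    fix x assume x: "x \<in> X"
    show "B x = A x"
    proof (rule bounded_operator_unique[OF _ _ SB_D(1)[OF XY(1)] selectors[OF XY(1)] _ x])
      show "bounded_operator (subspace_nspace X) (subspace_nspace Y) B"
        "bounded_operator (subspace_nspace X) (subspace_nspace Y) A" using A B by blast+
      show "B (d n X) = A (d n X)" for n using A B by simp
    qed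
  qed (use A B in blast)+
  then have "?P (THE A. ?P A)" using A by (intro theI[of ?P])
  then have "?P (code_op d (X, Y, y))"
    by (simp add: code_op_def code_dom_def code_cod_def)
  then show "bounded_operator (subspace_nspace X) (subspace_nspace Y) (code_op d (X, Y, y))"
    "code_op d (X, Y, y) (d n X) = y n" by blast+
qed

lemma code_op_unique:
  assumes t: "(X, Y, y) \<in> op_codes d" and A: "bounded_operator (subspace_nspace X) (subspace_nspace Y) A"
    and eq: "\<And>n. A (d n X) = y n" and x: "x \<in> X"
  shows "code_op d (X, Y, y) x = A x"
proof -
  have X: "X \<in> SB" using t by (auto simp: op_codes_def)
  show ?thesis
    by (rule bounded_operator_unique[OF code_op_spec(1)[OF t] A SB_D(1)[OF X] selectors[OF X] _ x])
      (simp add: code_op_spec(2)[OF t] eq)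
qed

definition tree_code :: "nat list set \<Rightarrow> op_code" where
  "tree_code T = (treeZ T, treeW, \<lambda>n. mulw (d n (treeZ T)))"

lemma treeZ_SB: "treeZ T \<in> SB" and treeW_SB: "treeW \<in> SB"
  using subspace_treeZ subspace_treeW by (auto simp: SB_def)

lemma norm_mulw_le: "norm (mulw g) \<le> norm g"
proof (rule norm_bound)
  show "norm (apply_bcontfun (mulw g) x) \<le> norm g" for x
    using mult_mono[of "weight x" 1 "\<bar>apply_bcontfun g x\<bar>" "norm g"] weight_le[of x] apply_bcontfun_le[of g x]
    by (simp add: abs_mult)
qed

lemma tree_code_in: "tree_code T \<in> op_codes d"
proof -
  interpret bounded_linear mulw by (rule bounded_linear_mulw)
  have "d n (treeZ T) \<in> treeZ T" for n
    using selectors(1)[OF treeZ_SB] by blast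
  moreover have "norm (\<Sum>i<n. of_rat (q i) *\<^sub>R mulw (d i (treeZ T))) \<le> real 1 * norm (\<Sum>i<n. of_rat (q i) *\<^sub>R d i (treeZ T))"
    for n and q :: "nat \<Rightarrow> rat"
    using norm_mulw_le[of "\<Sum>i<n. of_rat (q i) *\<^sub>R d i (treeZ T)"] by (simp add: sum scaleR)
  ultimately show ?thesis
    using treeZ_SB treeW_SB mulw_in unfolding op_codes_def tree_code_def by blast
qed

lemma code_op_tree_code: "x \<in> treeZ T \<Longrightarrow> code_op d (tree_code T) x = mulw x"
  using code_op_unique[OF tree_code_in[unfolded tree_code_def] bounded_operator_mulw]
  unfolding tree_code_def by blast

end

section \<open>Coding sequences\<close>

text \<open>Splits the odd entries into a double family of sequences: \<open>a\<close> is 0 for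
  vectors of the domain, 1 for vectors of the codomain, 2 for the coordinates \<open>z\<close> and 3
  for the constant \<open>k\<close>.\<close>

definition slot :: "(nat \<Rightarrow> nat) \<Rightarrow> nat \<Rightarrow> nat \<Rightarrow> nat \<Rightarrow> nat" where
  "slot u a i m = u (2 * prod_encode (a, prod_encode (i, m)) + 1)"

lemma ex_slots: "\<exists>p. slot (mix T p) = F"
proof (intro exI ext)
  fix a i m
  show "slot (mix T (\<lambda>n. case prod_decode n of (a, n') \<Rightarrow> case prod_decode n' of (i, m) \<Rightarrow> F a i m)) a i m = F a i m"
    by (simp add: slot_def mix_def)
qed

lemma measurable_coordinate: "(\<lambda>u. u n) \<in> baire \<rightarrow>\<^sub>M count_space UNIV"
  by (rule measurable_component_singleton) simp

lemma measurable_slot: "(\<lambda>u. slot u a i m) \<in> baire \<rightarrow>\<^sub>M count_space UNIV"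
  unfolding slot_def by (rule measurable_coordinate)

lemma pred_tree_part: "Measurable.pred baire (\<lambda>u. t \<in> tree_part u)"
  unfolding tree_part_def mem_Collect_eq
  using measurable_compose[OF measurable_coordinate, of "\<lambda>k. k \<noteq> 0" "count_space UNIV"] by simp

definition rat_real :: "nat \<Rightarrow> real" where "rat_real n = of_rat (from_nat n)"

lemma rat_real_dense: "closure (range rat_real) = UNIV"
proof -
  have "x \<in> closure (range rat_real)" for x
  proof -
    obtain q :: "nat \<Rightarrow> rat" where "(\<lambda>n. real_of_rat (q n)) \<longlonglongrightarrow> x" by (rule ex_rat_sequence)
    moreover have "real_of_rat (q n) \<in> range rat_real" for n
      unfolding rat_real_def by (rule range_eqI[of _ _ "to_nat (q n)"]) simp
    ultimately show ?thesis unfolding closure_sequential by (intro exI[of _ "\<lambda>n. real_of_rat (q n)"]) blast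
  qed
  then show ?thesis by blast
qed

definition code_z :: "(nat \<Rightarrow> nat) \<Rightarrow> nat \<Rightarrow> nat \<Rightarrow> real" where
  "code_z u i j = dec rat_real (slot u 2 (prod_encode (i, j)))"

definition code_k :: "(nat \<Rightarrow> nat) \<Rightarrow> nat" where
  "code_k u = slot u 3 0 0"

lemma measurable_code_z: "(\<lambda>u. code_z u i j) \<in> borel_measurable baire"
  unfolding code_z_def by (rule measurable_dec[OF complete_UNIV measurable_slot])

lemma measurable_code_k: "code_k \<in> baire \<rightarrow>\<^sub>M count_space UNIV"
  unfolding code_k_def[abs_def] by (rule measurable_slot)

lemma ex_code:
  fixes c :: "nat \<Rightarrow> cantor_fun"
  assumes c: "closure (range c) = UNIV"
  shows "\<exists>p. (\<forall>i. dec c (slot (mix T p) 0 i) = \<xi> i) \<and> (\<forall>i. dec c (slot (mix T p) 1 i) = \<eta> i) \<and>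
     code_z (mix T p) = z \<and> code_k (mix T p) = k"
proof -
  have "\<forall>v. \<exists>s. dec c s = v" using ex_dec[OF c] by blast
  from choice[OF this] obtain s where s: "\<And>v. dec c (s v) = v" by blast
  have "\<forall>v. \<exists>s. dec rat_real s = v" using ex_dec[OF rat_real_dense] by blast
  from choice[OF this] obtain s' where s': "\<And>v. dec rat_real (s' v) = v" by blast
  obtain p where p: "slot (mix T p) = (\<lambda>a i. if a = 0 then s (\<xi> i) else if a = 1 then s (\<eta> i) else if a = 2 then
      (case prod_decode i of (i, j) \<Rightarrow> s' (z i j)) else (\<lambda>_. k))"
    using ex_slots by blast
  show ?thesis
    by (intro exI[of _ p] conjI allI ext) (simp_all add: p s s' code_z_def code_k_def)
qed

section \<open>No universal operator\<close>

text \<open>Stated for an arbitrary \<open>J\<close> so as to cover both classes: the complement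
  must avoid the completely continuous operators and contain the transported tree operators.
  \<open>U\<close> enters only through one weakly null sequence with images that are not norm null,
  so its spaces may be nonseparable.\<close>

lemma no_universal_operator:
  fixes J :: "'a nspace \<Rightarrow> 'a nspace \<Rightarrow> ('a \<Rightarrow> 'a) \<Rightarrow> bool"
  assumes not_cc: "\<And>X Y A. compl_class J X Y A \<Longrightarrow> \<not> completely_continuous X Y A"
    and tree: "\<And>T (h :: cantor_fun \<Rightarrow> 'a). \<not> has_branch T \<Longrightarrow> inj h \<Longrightarrow>
      compl_class J (transport h (subspace_nspace (treeZ T))) (transport h (subspace_nspace treeW)) (h \<circ> mulw \<circ> inv h)"
  shows "\<not> universal_operator J X Y U"
proof
  assume univ: "universal_operator J X Y U"
  then have compl: "compl_class J X Y U" by (simp add: universal_operator_def)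
  then have X: "normed_space X" and Y: "normed_space Y" and U: "bounded_operator X Y U"
    by (auto simp: compl_class_def banach_space_def)
  obtain x where x: "weakly_null X x" and Ux: "\<not> (\<lambda>n. vnorm Y (U (x n))) \<longlonglongrightarrow> 0"
    using not_cc[OF compl] unfolding completely_continuous_def by blast
  have xc: "x n \<in> vcarrier X" for n using x by (simp add: weakly_null_def)
  \<comment> \<open>A nonzero vector guarantees that the type \<open>'a\<close> is large enough to
    carry the tree spaces.\<close>
  have "\<exists>n. vnorm X (x n) \<noteq> 0"
  proof (rule ccontr)
    assume "\<not> ?thesis"
    then have zero: "vnorm X (x n) = 0" for n by blast
    obtain K where "\<And>x. x \<in> vcarrier X \<Longrightarrow> vnorm Y (U x) \<le> K * vnorm X x"
      using bounded_operator_bound[OF U X] by blast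
    then have "vnorm Y (U (x n)) = 0" for n
      using xc[of n] zero[of n] normed_space.norm_nonneg[OF Y bounded_operatorD(1)[OF U xc]]
      by (metis antisym mult_zero_right)
    then show False using Ux by simp
  qed
  then obtain h :: "cantor_fun \<Rightarrow> 'a" where h: "inj h"
    using ex_inj_cantor_fun[OF X xc] by blast
  define \<nu> where "\<nu> l = vnorm X (vcomb X x (rat_comb l))" for l
  define \<mu> where "\<mu> i = vnorm Y (U (x i))" for i
  \<comment> \<open>\<open>\<nu>\<close> and \<open>\<mu>\<close> are constants belonging to
    \<open>U\<close>; only the tree, the coordinates and the bound are read off
    \<open>u\<close>.\<close>
  define M where "M = {u. relaxed (tree_part u) \<nu> \<mu> (code_z u) (code_k u)}"
  show False
  proof (rule no_measurable_wellfounded_codes[of M])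
    have "Measurable.pred baire (\<lambda>u. relaxed (tree_part u) \<nu> \<mu> (code_z u) (code_k u))"
      by (intro pred_relaxed pred_tree_part measurable_code_z measurable_code_k measurable_const) simp_all
    then show "M \<in> sets baire"
      unfolding M_def pred_def by (simp add: space_PiM)
  next
    fix u assume u: "u \<in> M"
    show "\<not> has_branch (tree_part u)"
    proof
      assume "has_branch (tree_part u)"
      then have "(\<lambda>n. \<mu> (id n)) \<longlonglongrightarrow> 0"
      proof (rule relaxed_branch_null[OF X xc])
        show "relaxed (tree_part u) (\<lambda>l. vnorm X (vcomb X x (rat_comb l))) \<mu> (code_z u) (code_k u)"
          using u by (simp add: M_def \<nu>_def[abs_def])
        show "0 \<le> \<mu> i" for i
          unfolding \<mu>_def by (rule normed_space.norm_nonneg[OF Y bounded_operatorD(1)[OF U xc]])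
        show "weakly_null X (\<lambda>n. x (id n))" using x by simp
      qed
      then show False using Ux by (simp add: \<mu>_def)
    qed
  next
    fix T assume T: "\<not> has_branch T"
    let ?Z = "subspace_nspace (treeZ T)" and ?W = "subspace_nspace treeW"
    have Z: "normed_space ?Z" and W: "normed_space ?W"
      using subspace_treeZ(1) subspace_treeW(1) normed_space_subspace by blast+
    have "factors_through X Y U (transport h ?Z) (transport h ?W) (h \<circ> mulw \<circ> inv h)"
      using univ tree[OF T h] unfolding universal_operator_def by blast
    then obtain C D where C: "bounded_operator X (transport h ?Z) C" and D: "bounded_operator (transport h ?W) Y D"
      and eq: "\<And>x. x \<in> vcarrier X \<Longrightarrow> U x = D ((h \<circ> mulw \<circ> inv h) (C x))"
      unfolding factors_through_def by blast
    have C': "bounded_operator X ?Z (inv h \<circ> C)"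
      by (rule bounded_operator_comp[OF C bounded_operator_transport(2)[OF h] X normed_space_transport[OF h Z]])
    have D': "bounded_operator ?W Y (D \<circ> h)"
      by (rule bounded_operator_comp[OF bounded_operator_transport(1)[OF h] D W normed_space_transport[OF h W]])
    have "U (x n) = (D \<circ> h) (mulw ((inv h \<circ> C) (x n)))" for n
      using eq[OF xc] by simp
    from factors_imp_relaxed[where x = x, OF X Y xc C' D' this]
    obtain z k where zk: "relaxed T \<nu> \<mu> z k"
      unfolding \<nu>_def[abs_def] \<mu>_def[abs_def] by blast
    obtain c :: "nat \<Rightarrow> cantor_fun" where c: "closure (range c) = UNIV"
      by (rule cantor_fun_separable)
    obtain p where "code_z (mix T p) = z" "code_k (mix T p) = k"
      using ex_code[OF c] by blast
    then show "\<exists>p. mix T p \<in> M" using zk by (auto simp: M_def)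
  qed
qed

section \<open>No universal Borel set of codes\<close>

text \<open>Decodes any sequence of vectors into a member of \<open>SB\<close>; every member arises,
  from a dense sequence in it.\<close>

definition rat_span :: "(nat \<Rightarrow> cantor_fun) \<Rightarrow> cantor_fun set" where
  "rat_span \<xi> = closure (range (\<lambda>l. \<Sum>(q, i)\<leftarrow>rat_comb l. q *\<^sub>R \<xi> i))"

lemma rat_span_base: "\<xi> i \<in> rat_span \<xi>"
proof -
  have "\<xi> i \<in> range (\<lambda>l. \<Sum>(q, i)\<leftarrow>rat_comb l. q *\<^sub>R \<xi> i)"
    by (rule range_eqI[of _ _ "[(1, i)]"]) simp
  then show ?thesis unfolding rat_span_def by (rule subsetD[OF closure_subset])
qed

lemma rat_span_SB: "rat_span \<xi> \<in> SB"
  unfolding SB_def rat_span_def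
proof (intro CollectI conjI subspace_closureI closed_closure)
  show "0 \<in> range (\<lambda>l. \<Sum>(q, i)\<leftarrow>rat_comb l. q *\<^sub>R \<xi> i)"
    by (rule range_eqI[of _ _ "[]"]) simp
next
  fix x y assume "x \<in> range (\<lambda>l. \<Sum>(q, i)\<leftarrow>rat_comb l. q *\<^sub>R \<xi> i)" "y \<in> range (\<lambda>l. \<Sum>(q, i)\<leftarrow>rat_comb l. q *\<^sub>R \<xi> i)"
  then obtain l l' where "x = (\<Sum>(q, i)\<leftarrow>rat_comb l. q *\<^sub>R \<xi> i)" "y = (\<Sum>(q, i)\<leftarrow>rat_comb l'. q *\<^sub>R \<xi> i)" by blast
  then show "x + y \<in> range (\<lambda>l. \<Sum>(q, i)\<leftarrow>rat_comb l. q *\<^sub>R \<xi> i)"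
    by (intro range_eqI[of _ _ "l @ l'"]) simp
next
  fix q :: rat and x assume "x \<in> range (\<lambda>l. \<Sum>(q, i)\<leftarrow>rat_comb l. q *\<^sub>R \<xi> i)"
  then obtain l where l: "x = (\<Sum>(q, i)\<leftarrow>rat_comb l. q *\<^sub>R \<xi> i)" by blast
  have "(\<Sum>(q, i)\<leftarrow>rat_comb (map (apfst ((*) q)) l). q *\<^sub>R \<xi> i) = of_rat q *\<^sub>R (\<Sum>(q, i)\<leftarrow>rat_comb l. q *\<^sub>R \<xi> i)"
    by (induction l) (auto simp: of_rat_mult scaleR_add_right)
  then show "of_rat q *\<^sub>R x \<in> range (\<lambda>l. \<Sum>(q, i)\<leftarrow>rat_comb l. q *\<^sub>R \<xi> i)"
    unfolding l by (intro range_eqI[of _ _ "map (apfst ((*) q)) l"]) simp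
qed

lemma rat_span_eq:
  assumes X: "X \<in> SB" and \<xi>: "range \<xi> \<subseteq> X" "X \<subseteq> closure (range \<xi>)"
  shows "rat_span \<xi> = X"
proof
  have sub: "subspace X" "closed X" using X by (auto simp: SB_def)
  have "\<xi> i \<in> X" for i using \<xi>(1) by blast
  then have "(\<Sum>(q, i)\<leftarrow>rat_comb l. q *\<^sub>R \<xi> i) \<in> X" for l
    by (induction l) (auto intro!: subspace_add[OF sub(1)] subspace_scale[OF sub(1)] subspace_0[OF sub(1)])
  then show "rat_span \<xi> \<subseteq> X"
    unfolding rat_span_def by (intro closure_minimal sub(2)) auto
  have "range \<xi> \<subseteq> rat_span \<xi>" using rat_span_base by blast
  then have "closure (range \<xi>) \<subseteq> rat_span \<xi>"
    by (rule closure_minimal) (simp add: rat_span_def)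
  then show "X \<subseteq> rat_span \<xi>" using \<xi>(2) by blast
qed

lemma measurable_comb:
  fixes \<xi> :: "'m \<Rightarrow> nat \<Rightarrow> 'b::real_normed_vector" and c :: "nat \<Rightarrow> 'b"
  assumes c: "closure (range c) = UNIV" and \<xi>: "\<And>i. (\<lambda>u. \<xi> u i) \<in> borel_measurable M"
  shows "(\<lambda>u. \<Sum>(q, i)\<leftarrow>l. q *\<^sub>R \<xi> u i) \<in> borel_measurable M"
proof (induction l)
  case (Cons p l)
  obtain q i where p: "p = (q, i)" by force
  have "(\<lambda>u. q *\<^sub>R \<xi> u i) \<in> borel_measurable M"
    by (rule measurable_compose[OF \<xi> borel_measurable_continuous_onI]) (intro continuous_intros)
  from borel_measurable_add_dense[OF c this Cons] show ?case by (simp add: p)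
qed simp

lemma measurable_norm:
  fixes f :: "'m \<Rightarrow> 'b::real_normed_vector"
  assumes "f \<in> borel_measurable M"
  shows "(\<lambda>u. norm (f u)) \<in> borel_measurable M"
  by (rule measurable_compose[OF assms borel_measurable_continuous_onI]) (intro continuous_intros)

text \<open>An open set meets a closure if and only if it meets the set itself, here a countable set
  of measurably varying vectors.\<close>

lemma measurable_rat_span:
  assumes "\<And>l. (\<lambda>u. \<Sum>(q, i)\<leftarrow>rat_comb l. q *\<^sub>R \<xi> u i) \<in> borel_measurable M"
  shows "(\<lambda>u. rat_span (\<xi> u)) \<in> M \<rightarrow>\<^sub>M effros_borel"
  unfolding effros_borel_def
proof (rule measurable_measure_of)
  show "(\<lambda>u. rat_span (\<xi> u)) \<in> space M \<rightarrow> SB" by (simp add: rat_span_SB)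
  fix A assume "A \<in> {{X \<in> SB. X \<inter> U \<noteq> {}} |U. open U}"
  then obtain U where A: "A = {X \<in> SB. X \<inter> U \<noteq> {}}" and U: "open U" by blast
  have "(\<lambda>u. rat_span (\<xi> u)) -` A \<inter> space M =
      (\<Union>l. (\<lambda>u. \<Sum>(q, i)\<leftarrow>rat_comb l. q *\<^sub>R \<xi> u i) -` U \<inter> space M)"
    unfolding A rat_span_def using U rat_span_SB[unfolded rat_span_def]
    by (auto simp: Int_commute[of _ U] open_Int_closure_eq_empty)
  also have "\<dots> \<in> sets M"
    using assms U by (intro sets.countable_UN') (auto intro: measurable_sets)
  finally show "(\<lambda>u. rat_span (\<xi> u)) -` A \<inter> space M \<in> sets M" .
qed auto

lemma rat_comb_of_list:
  "(\<Sum>i<length qs. of_rat (qs ! i) *\<^sub>R v i) = (\<Sum>(q, i)\<leftarrow>rat_comb (zip qs [0..<length qs]). q *\<^sub>R v i)"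
  by (subst sum_list_sum_nth) (simp add: atLeast0LessThan)

lemma pred_code_conditions:
  fixes f g :: "'m \<Rightarrow> rat list \<Rightarrow> real" and h :: "'m \<Rightarrow> nat \<Rightarrow> real"
  assumes [measurable]: "Measurable.pred M P" "\<And>qs. (\<lambda>u. f u qs) \<in> borel_measurable M"
    "\<And>qs. (\<lambda>u. g u qs) \<in> borel_measurable M" "\<And>i. (\<lambda>u. h u i) \<in> borel_measurable M" "Measurable.pred M R"
  shows "Measurable.pred M (\<lambda>u. P u \<and> (\<exists>k::nat. \<forall>qs. f u qs \<le> real k * g u qs) \<and> (\<forall>i. h u i = 0) \<and> R u)"
  by measurable

text \<open>With finite lists in place of sequences of rationals, the domination becomes a countable
  condition.\<close>

lemma op_codesI:
  assumes "X \<in> SB" "Y \<in> SB" "\<And>n. y n \<in> Y"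
    and dom: "\<And>qs :: rat list. norm (\<Sum>i<length qs. of_rat (qs ! i) *\<^sub>R y i) \<le> real k * norm (\<Sum>i<length qs. of_rat (qs ! i) *\<^sub>R d i X)"
  shows "(X, Y, y) \<in> op_codes d"
proof -
  have "norm (\<Sum>i<n. of_rat (q i) *\<^sub>R y i) \<le> real k * norm (\<Sum>i<n. of_rat (q i) *\<^sub>R d i X)" for n and q :: "nat \<Rightarrow> rat"
    using dom[of "map q [0..<n]"] by simp
  then show ?thesis using assms unfolding op_codes_def by blast
qed

text \<open>In contrast to a single operator, the code now has to name the member of the Borel set
  as well. All conditions on it are Borel, so the trees in question are again the projection of a
  Borel set.\<close>

lemma no_universal_codes:
  assumes d: "dense_selectors d"
    and not_cc: "\<And>X Y A. compl_class J X Y A \<Longrightarrow> \<not> completely_continuous X Y A"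
    and tree: "\<And>T. \<not> has_branch T \<Longrightarrow> compl_class J (subspace_nspace (treeZ T)) (subspace_nspace treeW) mulw"
    and cong: "\<And>X Y A B. compl_class J X Y A \<Longrightarrow> (\<And>x. x \<in> vcarrier X \<Longrightarrow> A x = B x) \<Longrightarrow> compl_class J X Y B"
    and \<B>: "\<B> \<in> sets (op_code_space d)"
  shows "\<not> universal_code_set d J \<B>"
proof
  assume univ: "universal_code_set d J \<B>"
  obtain B' where B': "B' \<in> sets (effros_borel \<Otimes>\<^sub>M effros_borel \<Otimes>\<^sub>M (\<Pi>\<^sub>M n\<in>UNIV. borel))" "\<B> = op_codes d \<inter> B'"
    using \<B> unfolding op_code_space_def sets_restrict_space by blast
  obtain c :: "nat \<Rightarrow> cantor_fun" where c: "closure (range c) = UNIV"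
    by (rule cantor_fun_separable)
  define \<xi> where "\<xi> u i = dec c (slot u 0 i)" for u i
  define \<eta> where "\<eta> u i = dec c (slot u 1 i)" for u i
  \<comment> \<open>One sequence carries the codomain and, at its even places, the images of the
    selected vectors, so these images lie in the decoded codomain for every
    \<open>u\<close>.\<close>
  define y where "y u i = \<eta> u (2 * i)" for u i
  define \<nu> where "\<nu> u l = norm (\<Sum>(q, i)\<leftarrow>rat_comb l. q *\<^sub>R \<xi> u i)" for u l
  define \<mu> where "\<mu> u i = norm (y u i)" for u i
  define Ny where "Ny u qs = norm (\<Sum>i<length qs. of_rat (qs ! i) *\<^sub>R y u i)" for u and qs :: "rat list"
  define N\<xi> where "N\<xi> u qs = norm (\<Sum>i<length qs. of_rat (qs ! i) *\<^sub>R \<xi> u i)" for u and qs :: "rat list"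
  \<comment> \<open>\<open>\<Delta> = 0\<close> forces \<open>\<xi>\<close> to be the selected dense
    sequence of the space that it spans, to which \<open>op_codes\<close> refers.\<close>
  define \<Delta> where "\<Delta> u i = norm (\<xi> u i + (-1) *\<^sub>R d i (rat_span (\<xi> u)))" for u i
  define R where "R u \<longleftrightarrow> relaxed (tree_part u) (\<nu> u) (\<mu> u) (code_z u) (code_k u)" for u
  \<comment> \<open>\<open>\<B>\<close> is only the trace of \<open>B'\<close> on
    \<open>op_codes\<close>; the domination together with \<open>\<Delta> = 0\<close> expresses
    membership in \<open>op_codes\<close>.\<close>
  define M where "M = {u. (rat_span (\<xi> u), rat_span (\<eta> u), y u) \<in> B' \<and>
     (\<exists>k. \<forall>qs. Ny u qs \<le> real k * N\<xi> u qs) \<and> (\<forall>i. \<Delta> u i = 0) \<and> R u}"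
  have m\<xi>: "(\<lambda>u. \<xi> u i) \<in> borel_measurable baire" and m\<eta>: "(\<lambda>u. \<eta> u i) \<in> borel_measurable baire" for i
    unfolding \<xi>_def \<eta>_def
    by (rule measurable_dec[OF complete_cantor_fun[OF closed_UNIV] measurable_slot])+
  have my: "(\<lambda>u. y u i) \<in> borel_measurable baire" for i
    unfolding y_def by (rule m\<eta>)
  have mX: "(\<lambda>u. rat_span (\<xi> u)) \<in> baire \<rightarrow>\<^sub>M effros_borel" and mY: "(\<lambda>u. rat_span (\<eta> u)) \<in> baire \<rightarrow>\<^sub>M effros_borel"
    by (intro measurable_rat_span measurable_comb[OF c] m\<xi> m\<eta>)+
  show False
  proof (rule no_measurable_wellfounded_codes[of M])
    have "(\<lambda>u. (rat_span (\<xi> u), rat_span (\<eta> u), y u)) \<in> baire \<rightarrow>\<^sub>M effros_borel \<Otimes>\<^sub>M effros_borel \<Otimes>\<^sub>M (\<Pi>\<^sub>M n\<in>UNIV. borel)"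
      by (intro measurable_Pair mX mY measurable_PiM_single' my) auto
    then have pB: "Measurable.pred baire (\<lambda>u. (rat_span (\<xi> u), rat_span (\<eta> u), y u) \<in> B')"
      using B'(1) by (rule pred_sets2[rotated])
    have mN: "(\<lambda>u. Ny u qs) \<in> borel_measurable baire" "(\<lambda>u. N\<xi> u qs) \<in> borel_measurable baire" for qs
      unfolding Ny_def N\<xi>_def rat_comb_of_list by (intro measurable_norm measurable_comb[OF c] my m\<xi>)+
    have m\<Delta>: "(\<lambda>u. \<Delta> u i) \<in> borel_measurable baire" for i
    proof -
      have "d i \<in> effros_borel \<rightarrow>\<^sub>M borel" using d unfolding dense_selectors_def by blast
      from measurable_compose[OF mX this]
      have "(\<lambda>u. (-1) *\<^sub>R d i (rat_span (\<xi> u))) \<in> borel_measurable baire"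
        by (rule measurable_compose[OF _ borel_measurable_continuous_onI]) (intro continuous_intros)
      then show ?thesis unfolding \<Delta>_def by (intro measurable_norm borel_measurable_add_dense[OF c] m\<xi>)
    qed
    have pR: "Measurable.pred baire R"
      unfolding R_def[abs_def] \<nu>_def \<mu>_def
      by (intro pred_relaxed pred_tree_part measurable_code_z measurable_code_k measurable_norm measurable_comb[OF c] m\<xi> my)
    have "Measurable.pred baire (\<lambda>u. (rat_span (\<xi> u), rat_span (\<eta> u), y u) \<in> B' \<and>
       (\<exists>k. \<forall>qs. Ny u qs \<le> real k * N\<xi> u qs) \<and> (\<forall>i. \<Delta> u i = 0) \<and> R u)"
      by (rule pred_code_conditions[OF pB mN m\<Delta> pR])
    then show "M \<in> sets baire"
      unfolding M_def pred_def by (simp add: space_PiM)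
  next
    fix u assume u: "u \<in> M"
    define X where "X = rat_span (\<xi> u)"
    define Y where "Y = rat_span (\<eta> u)"
    have SB: "X \<in> SB" "Y \<in> SB" by (simp_all add: X_def Y_def rat_span_SB)
    have sel: "\<xi> u i = d i X" for i using u by (simp add: M_def X_def \<Delta>_def)
    have b: "(X, Y, y u) \<in> \<B>"
    proof -
      obtain k where k: "\<And>qs. Ny u qs \<le> real k * N\<xi> u qs" using u by (auto simp: M_def)
      have "y u n \<in> Y" for n unfolding Y_def y_def by (rule rat_span_base)
      then have "(X, Y, y u) \<in> op_codes d"
        using k unfolding Ny_def N\<xi>_def sel by (intro op_codesI[where k = k] SB)
      then show ?thesis using u B'(2) by (simp add: M_def X_def Y_def)
    qed
    define A where "A = code_op d (X, Y, y u)"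
    have code: "(X, Y, y u) \<in> op_codes d" using b B'(2) by blast
    have compl: "compl_class J (subspace_nspace X) (subspace_nspace Y) A"
      using b univ unfolding universal_code_set_def coded_compl_class_def A_def code_dom_def code_cod_def by force
    have A: "bounded_operator (subspace_nspace X) (subspace_nspace Y) A" "\<And>n. A (d n X) = y u n"
      using code_op_spec[OF d code] by (auto simp: A_def)
    have X: "subspace X" using SB by (simp add: SB_def)
    interpret NX: normed_space "subspace_nspace X" by (rule normed_space_subspace[OF X])
    have dX: "d n X \<in> X" for n using selectors(1)[OF d SB(1)] by blast
    show "\<not> has_branch (tree_part u)"
    proof
      assume T: "has_branch (tree_part u)"
      have "completely_continuous (subspace_nspace X) (subspace_nspace Y) A"
        unfolding completely_continuous_def
      proof (intro allI impI)
        fix x assume x: "weakly_null (subspace_nspace X) x"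
        then have xX: "x n \<in> X" for n by (simp add: weakly_null_def)
        \<comment> \<open>\<open>relaxed\<close> speaks about the selected vectors only. Moving a
          weakly null sequence onto them by perturbations tending to 0 in norm preserves weak
          nullity and changes the images by a norm null sequence.\<close>
        have "\<forall>n. \<exists>i. norm (d i X - x n) < (1/2) ^ n"
        proof
          fix n :: nat
          have "x n \<in> closure (range (\<lambda>n. d n X))" using xX selectors(2)[OF d SB(1)] by blast
          then show "\<exists>i. norm (d i X - x n) < (1/2) ^ n"
            unfolding closure_approachable by (auto simp: dist_norm dest!: spec[of _ "(1/2) ^ n"])
        qed
        from choice[OF this] obtain r where r: "\<And>n. norm (d (r n) X - x n) < (1/2) ^ n" by blast
        have half: "(\<lambda>n. K * (1/2) ^ n) \<longlonglongrightarrow> 0" for K :: real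
          using tendsto_mult[OF tendsto_const LIMSEQ_realpow_zero[of "1/2"]] by fastforce
        have "weakly_null (subspace_nspace X) (\<lambda>n. d (r n) X)"
          unfolding weakly_null_def
        proof (intro conjI allI ballI)
          show "d (r n) X \<in> vcarrier (subspace_nspace X)" for n using dX by simp
          fix f assume f: "f \<in> vcarrier (dual_nspace (subspace_nspace X))"
          have "\<bar>f (d (r n) X) - f (x n)\<bar> \<le> vnorm (dual_nspace (subspace_nspace X)) f * (1/2) ^ n" for n
          proof -
            have "f (d (r n) X - x n + x n) = f (d (r n) X - x n) + f (x n)"
              using f xX dX subspace_diff[OF X] unfolding dual_iff subspace_nspace_simps by blast
            moreover have "\<bar>f (d (r n) X - x n)\<bar> \<le> vnorm (dual_nspace (subspace_nspace X)) f * norm (d (r n) X - x n)"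
              using NX.dual_normI[OF f, of "d (r n) X - x n"] subspace_diff[OF X dX xX] by simp
            moreover have "vnorm (dual_nspace (subspace_nspace X)) f * norm (d (r n) X - x n) \<le>
               vnorm (dual_nspace (subspace_nspace X)) f * (1/2) ^ n"
              using r[of n] by (intro mult_left_mono NX.dual_norm_nonneg[OF f]) simp
            ultimately show ?thesis by simp
          qed
          then have "(\<lambda>n. f (d (r n) X) - f (x n)) \<longlonglongrightarrow> 0"
            by (intro Lim_null_comparison[OF _ half[of "vnorm (dual_nspace (subspace_nspace X)) f"]]) (simp add: always_eventually)
          moreover have "(\<lambda>n. f (x n)) \<longlonglongrightarrow> 0"
            using x f unfolding weakly_null_def by blast
          ultimately have "(\<lambda>n. f (d (r n) X) - f (x n) + f (x n)) \<longlonglongrightarrow> 0 + 0"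
            by (rule tendsto_add)
          then show "(\<lambda>n. f (d (r n) X)) \<longlonglongrightarrow> 0" by simp
        qed
        then have null: "(\<lambda>n. \<mu> u (r n)) \<longlonglongrightarrow> 0"
        proof (rule relaxed_branch_null[OF NX.normed_space_axioms _ T, rotated 3])
          show "d n X \<in> vcarrier (subspace_nspace X)" for n using dX by simp
          show "relaxed (tree_part u) (\<lambda>l. vnorm (subspace_nspace X) (vcomb (subspace_nspace X) (\<lambda>n. d n X) (rat_comb l))) (\<mu> u) (code_z u) (code_k u)"
            using u by (simp add: M_def R_def \<nu>_def[abs_def] sel)
        qed (simp add: \<mu>_def)
        obtain K where K: "K > 0" "\<And>x y. x \<in> X \<Longrightarrow> y \<in> X \<Longrightarrow> norm (A x - A y) \<le> K * norm (x - y)"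
          using bounded_operator_diff_bound[OF A(1) X] by blast
        have le: "norm (A (x n)) \<le> \<mu> u (r n) + K * (1/2) ^ n" for n
        proof -
          have "norm (A (x n)) \<le> norm (A (d (r n) X)) + norm (A (d (r n) X) - A (x n))"
            using norm_triangle_ineq4[of "A (d (r n) X)" "A (d (r n) X) - A (x n)"] by simp
          also have "norm (A (d (r n) X) - A (x n)) \<le> K * norm (d (r n) X - x n)"
            by (rule K(2)[OF dX xX])
          also have "\<dots> \<le> K * (1/2) ^ n"
            using r[of n] K(1) by (intro mult_left_mono) auto
          finally show ?thesis by (simp add: \<mu>_def A(2))
        qed
        have "(\<lambda>n. \<mu> u (r n) + K * (1/2) ^ n) \<longlonglongrightarrow> 0 + 0"
          by (intro tendsto_add null half)
        then have "(\<lambda>n. \<mu> u (r n) + K * (1/2) ^ n) \<longlonglongrightarrow> 0" by simp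
        then have "(\<lambda>n. norm (A (x n))) \<longlonglongrightarrow> 0"
          by (rule Lim_null_comparison[rotated]) (simp add: le)
        then show "(\<lambda>n. vnorm (subspace_nspace Y) (A (x n))) \<longlonglongrightarrow> 0" by simp
      qed
      then show False using not_cc[OF compl] by blast
    qed
  next
    fix T assume T: "\<not> has_branch T"
    have "compl_class J (subspace_nspace (treeZ T)) (subspace_nspace treeW) (code_op d (tree_code d T))"
      by (rule cong[OF tree[OF T]]) (simp add: code_op_tree_code[OF d])
    then have "tree_code d T \<in> coded_compl_class d J"
      using tree_code_in[OF d] by (simp add: coded_compl_class_def code_dom_def code_cod_def tree_code_def[OF d])
    then obtain b where b: "b \<in> \<B>" and fact: "factors_through (code_dom b) (code_cod b) (code_op d b)
        (code_dom (tree_code d T)) (code_cod (tree_code d T)) (code_op d (tree_code d T))"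
      using univ unfolding universal_code_set_def by blast
    obtain X Y y0 where bXY: "b = (X, Y, y0)" by (cases b)
    have code: "(X, Y, y0) \<in> op_codes d" using b B'(2) bXY by blast
    obtain k where SB: "X \<in> SB" "Y \<in> SB" and y0: "\<And>n. y0 n \<in> Y"
      and domk: "\<And>n (q :: nat \<Rightarrow> rat). norm (\<Sum>i<n. of_rat (q i) *\<^sub>R y0 i) \<le> real k * norm (\<Sum>i<n. of_rat (q i) *\<^sub>R d i X)"
      using code unfolding op_codes_def by blast
    have dX: "d n X \<in> X" for n using selectors(1)[OF d SB(1)] by blast
    obtain C D where C: "bounded_operator (subspace_nspace X) (subspace_nspace (treeZ T)) C"
      and D: "bounded_operator (subspace_nspace treeW) (subspace_nspace Y) D"
      and eq: "\<And>x. x \<in> X \<Longrightarrow> code_op d b x = D (code_op d (tree_code d T) (C x))"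
      using fact unfolding factors_through_def code_dom_def code_cod_def bXY tree_code_def[OF d] by auto
    have "code_op d b (d n X) = D (mulw (C (d n X)))" for n
      using eq[OF dX] code_op_tree_code[OF d, of "C (d n X)" T] bounded_operator_subspace(1)[OF C dX] by simp
    then obtain z k' where zk: "relaxed T (\<lambda>l. vnorm (subspace_nspace X) (vcomb (subspace_nspace X) (\<lambda>n. d n X) (rat_comb l)))
        (\<lambda>i. vnorm (subspace_nspace Y) (code_op d b (d i X))) z k'"
      using factors_imp_relaxed[OF normed_space_subspace normed_space_subspace _ C D, of "\<lambda>n. d n X" "code_op d b"]
        SB dX by (auto simp: SB_def)
    \<comment> \<open>The even places reproduce \<open>y0\<close>; the odd ones, filled with the
      selected vectors of \<open>Y\<close>, make the span equal to \<open>Y\<close>.\<close>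
    define \<eta>0 where "\<eta>0 i = (if even i then y0 (i div 2) else d (i div 2) Y)" for i
    obtain p where p: "\<And>i. \<xi> (mix T p) i = d i X" "\<And>i. \<eta> (mix T p) i = \<eta>0 i"
      "code_z (mix T p) = z" "code_k (mix T p) = k'"
      using ex_code[OF c, of T "\<lambda>i. d i X" \<eta>0 z k'] unfolding \<xi>_def \<eta>_def by blast
    have y: "y (mix T p) = y0" by (rule ext) (simp add: y_def p \<eta>0_def)
    have \<xi>: "\<xi> (mix T p) = (\<lambda>i. d i X)" and \<eta>: "\<eta> (mix T p) = \<eta>0" using p by auto
    have X: "rat_span (\<xi> (mix T p)) = X"
      unfolding \<xi> by (rule rat_span_eq[OF SB(1) selectors[OF d SB(1)]])
    have Y: "rat_span (\<eta> (mix T p)) = Y"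
      unfolding \<eta>
    proof (rule rat_span_eq[OF SB(2)])
      show "range \<eta>0 \<subseteq> Y" using y0 selectors(1)[OF d SB(2)] by (auto simp: \<eta>0_def)
      have "d n Y = \<eta>0 (2 * n + 1)" for n by (simp add: \<eta>0_def)
      then have "range (\<lambda>n. d n Y) \<subseteq> range \<eta>0" by blast
      then show "Y \<subseteq> closure (range \<eta>0)" using selectors(2)[OF d SB(2)] closure_mono by blast
    qed
    have "mix T p \<in> M"
      unfolding M_def
    proof (intro CollectI conjI allI exI)
      show "(rat_span (\<xi> (mix T p)), rat_span (\<eta> (mix T p)), y (mix T p)) \<in> B'"
        using b bXY B'(2) by (simp add: X Y y)
      show "Ny (mix T p) qs \<le> real k * N\<xi> (mix T p) qs" for qs
        unfolding Ny_def N\<xi>_def y \<xi> using domk by blast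
      show "\<Delta> (mix T p) i = 0" for i
        by (simp add: \<Delta>_def X p)
      show "R (mix T p)"
        using zk by (simp add: R_def p \<nu>_def[abs_def] \<mu>_def[abs_def] \<xi> y bXY code_op_spec(2)[OF d code])
    qed
    then show "\<exists>p. mix T p \<in> M" by (rule exI[of _ p])
  qed
qed

lemma compl_dunford_pettis_imp:
  "compl_class dunford_pettis X Y A \<Longrightarrow> compl_class completely_continuous X Y A"
  unfolding compl_class_def banach_space_def
  using completely_continuous_imp_dunford_pettis by blast

lemma bounded_operator_cong:
  assumes "normed_space X" "bounded_operator X Y A" "\<And>x. x \<in> vcarrier X \<Longrightarrow> A x = B x"
  shows "bounded_operator X Y B"
  using assms(2,3) normed_space.add_closed[OF assms(1)] normed_space.scale_closed[OF assms(1)]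
  unfolding bounded_operator_def by (auto simp: Pi_iff)

lemma compl_class_cong:
  assumes "\<And>x. x \<in> vcarrier X \<Longrightarrow> A x = B x"
  shows "compl_class completely_continuous X Y A \<Longrightarrow> compl_class completely_continuous X Y B"
    "compl_class dunford_pettis X Y A \<Longrightarrow> compl_class dunford_pettis X Y B"
proof -
  have "completely_continuous X Y B = completely_continuous X Y A"
    unfolding completely_continuous_def using assms by (auto simp: weakly_null_def)
  moreover have "dunford_pettis X Y B = dunford_pettis X Y A"
    unfolding dunford_pettis_def using assms by (auto simp: weakly_null_def)
  ultimately show "compl_class completely_continuous X Y A \<Longrightarrow> compl_class completely_continuous X Y B"
    "compl_class dunford_pettis X Y A \<Longrightarrow> compl_class dunford_pettis X Y B"
    using bounded_operator_cong[of X Y A B] assms unfolding compl_class_def banach_space_def by blast+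
qed

theorem theorem5p21:
  shows "(\<nexists>X Y (U :: 'a \<Rightarrow> 'a). universal_operator completely_continuous X Y U) \<and>
         (\<nexists>X Y (U :: 'a \<Rightarrow> 'a). universal_operator dunford_pettis X Y U) \<and>
         (\<forall>d. dense_selectors d \<longrightarrow>
            (\<nexists>\<B>. \<B> \<in> sets (op_code_space d) \<and> universal_code_set d completely_continuous \<B>) \<and>
            (\<nexists>\<B>. \<B> \<in> sets (op_code_space d) \<and> universal_code_set d dunford_pettis \<B>))"
proof (intro conjI allI impI notI; (elim exE conjE)?)
  fix X Y and U :: "'a \<Rightarrow> 'a"
  assume "universal_operator completely_continuous X Y U"
  moreover have "\<not> universal_operator completely_continuous X Y U"
    by (rule no_universal_operator)
      (simp add: compl_class_def, intro compl_dunford_pettis_imp compl_dunford_pettis_transport compl_class_mulw)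
  ultimately show False by blast
next
  fix X Y and U :: "'a \<Rightarrow> 'a"
  assume "universal_operator dunford_pettis X Y U"
  moreover have "\<not> universal_operator dunford_pettis X Y U"
    by (rule no_universal_operator)
      (drule compl_dunford_pettis_imp, simp add: compl_class_def, intro compl_dunford_pettis_transport compl_class_mulw)
  ultimately show False by blast
next
  fix d \<B> assume d: "dense_selectors d" and \<B>: "\<B> \<in> sets (op_code_space d)"
    and univ: "universal_code_set d completely_continuous \<B>"
  have "\<not> universal_code_set d completely_continuous \<B>"
  proof (rule no_universal_codes[OF d _ _ _ \<B>])
    show "\<not> completely_continuous X Y A" if "compl_class completely_continuous X Y A"
      for X Y :: "cantor_fun nspace" and A
      using that by (simp add: compl_class_def)
    show "compl_class completely_continuous X Y B"
      if "compl_class completely_continuous X Y A" "\<And>x. x \<in> vcarrier X \<Longrightarrow> A x = B x"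
      for X Y :: "cantor_fun nspace" and A B
      using compl_class_cong(1)[OF that(2) that(1)] .
  qed (rule compl_dunford_pettis_imp[OF compl_class_mulw])
  then show False using univ by blast
next
  fix d \<B> assume d: "dense_selectors d" and \<B>: "\<B> \<in> sets (op_code_space d)"
    and univ: "universal_code_set d dunford_pettis \<B>"
  have "\<not> universal_code_set d dunford_pettis \<B>"
  proof (rule no_universal_codes[OF d _ _ _ \<B>])
    show "\<not> completely_continuous X Y A" if "compl_class dunford_pettis X Y A"
      for X Y :: "cantor_fun nspace" and A
      using compl_dunford_pettis_imp[OF that] by (simp add: compl_class_def)
    show "compl_class dunford_pettis X Y B"
      if "compl_class dunford_pettis X Y A" "\<And>x. x \<in> vcarrier X \<Longrightarrow> A x = B x"
      for X Y :: "cantor_fun nspace" and A B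
      using compl_class_cong(2)[OF that(2) that(1)] .
  qed (rule compl_class_mulw)
  then show False using univ by blast
qed

end
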